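(* Let $A$ be the preprojective algebra of type $\mathrm{A}_n$ ($n\geq3$) over a field $\mathbb{F}$, and let $m=\lfloor\frac{n-1}{2}\rfloor$. A basis of $\mathrm{HK}^0(A)$ is given by the set $\{z_\ell;\ 0\leq\ell\leq m\}$ with $z_0=1$ and $z_\ell=\sum_{i=1}^{n-2}(a_i^*a_i)^\ell=\sum_{i=\ell}^{n-1-\ell}(a_i^*a_i)^\ell=z_1^\ell$ for $1\leq\ell\leq m$. A basis of $\mathrm{HK}^1(A)$ is given by the set $\{\overline{\zeta}_\ell;\ 0\leq\ell\leq n-2-m\}$, where $\zeta_\ell\in\mathrm{Hom}_{k^e}(V,A)$ is defined by $\zeta_\ell(a_i)=a_i(a_i^*a_i)^\ell$ for all $i$. A basis of $\mathrm{HK}^2(A)$ is given by the set $\{\overline{h}_i;\ 0\leq i\leq n-1\}$, where $h_i\in\mathrm{Hom}_{k^e}(R,A)$ is defined by $h_i(\sigma_j)=\delta_{ij}e_i$ for all $j$.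
   Context: The algebra. $\overline{Q}$ is the quiver with vertices $0,1,\ldots,n-1$ and arrows $a_i:i\to i+1$, $a_i^*:i+1\to i$ for $0\leq i\leq n-2$; paths are written from right to left. $k=\bigoplus_i\mathbb{F}e_i$, $V=\mathbb{F}\overline{Q}_1$, $k^e=k\otimes_{\mathbb{F}}k$, and $A=\mathbb{F}\overline{Q}/(R)$ where $R\subseteq V\otimes_kV$ is spanned by $\sigma_0=-a_0^*a_0$, $\sigma_i=a_{i-1}a_{i-1}^*-a_i^*a_i$ ($1\leq i\leq n-2$), $\sigma_{n-1}=a_{n-2}a_{n-2}^*$. Koszul cohomology. $W_0=k$, $W_1=V$, $W_p=\bigcap_{i+2+j=p}V^{\otimes_k i}\otimes_kR\otimes_kV^{\otimes_k j}$ for $p\geq2$ (so $W_2=R$); elements of $W_p$ are written $x_1\ldots x_p$ (a sum is understood). $\mathrm{HK}^\bullet(A)=H^\bullet(\mathrm{Hom}_{k^e}(W_\bullet,A),b_K)$ with $b_K(f)(x_1\ldots x_{p+1})=f(x_1\ldots x_p)x_{p+1}-(-1)^px_1f(x_2\ldots x_{p+1})$ for $f:W_p\to A$. $\mathrm{Hom}_{k^e}(k,A)$ is identified with $\bigoplus_ie_iAe_i$ and $\mathrm{HK}^0(A)$ with the centre of $A$. $\overline{f}$ denotes the class of a cocycle $f$. Convention: a cochain takes the value $0$ on basis elements (arrows or relations $\sigma_j$) where no value is specified. *)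

theory Defs
  imports
    "Jordan_Normal_Form.VS_Connect"
    "Graph_Theory.Arc_Walk"
    "HOL-Algebra.QuotRing"
begin

section \<open>The double quiver and its path algebra\<close>

text \<open>\<open>Up i\<close> is the arrow \<open>a\<^sub>i : i \<rightarrow> i + 1\<close> and \<open>Down i\<close> is \<open>a\<^sub>i\<^sup>* : i + 1 \<rightarrow> i\<close>.\<close>

datatype arrow = Up nat | Down nat

fun arrow_tail :: "arrow \<Rightarrow> nat" where
  "arrow_tail (Up i) = i"
| "arrow_tail (Down i) = i + 1"

fun arrow_head :: "arrow \<Rightarrow> nat" where
  "arrow_head (Up i) = i + 1"
| "arrow_head (Down i) = i"

definition double_quiver :: "nat \<Rightarrow> (nat, arrow) pre_digraph" where
  "double_quiver n =
    \<lparr>verts = {..<n}, arcs = Up ` {..<n - 1} \<union> Down ` {..<n - 1},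
     tail = arrow_tail, head = arrow_head\<rparr>"

text \<open>A path is stored as its start vertex together with its arrows in the order in which they
  are traversed. The written form of a path is the reverse: \<open>a\<^sub>1 a\<^sub>0\<close> is \<open>(0, [Up 0, Up 1])\<close>.\<close>

type_synonym path = "nat \<times> arrow list"

definition paths :: "nat \<Rightarrow> path set" where
  "paths n = {(u, es). \<exists>v. pre_digraph.awalk (double_quiver n) u es v}"

definition path_end :: "nat \<Rightarrow> path \<Rightarrow> nat" where
  "path_end n p = pre_digraph.awlast (double_quiver n) (fst p) (snd p)"

type_synonym 'f palg = "path \<Rightarrow> 'f"

text \<open>The product \<open>x y\<close> runs first through the path of \<open>y\<close>, then through that of \<open>x\<close>:
  a path contributes for each of its decompositions into an initial part (evaluated by \<open>y\<close>)
  and a final part (evaluated by \<open>x\<close>).\<close>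

definition path_algebra :: "nat \<Rightarrow> ('f::field, 'f palg) module" where
  "path_algebra n =
    \<lparr>carrier = {x. finite {p. x p \<noteq> 0} \<and> {p. x p \<noteq> 0} \<subseteq> paths n},
     mult = (\<lambda>x y (u, es). \<Sum>k\<le>length es.
               x (path_end n (u, take k es), drop k es) * y (u, take k es)),
     one = (\<lambda>(u, es). if u < n \<and> es = [] then 1 else 0),
     zero = (\<lambda>p. 0),
     add = (\<lambda>x y p. x p + y p),
     smult = (\<lambda>c x p. c * x p)\<rparr>"

definition path_elt :: "path \<Rightarrow> 'f::field palg" where
  "path_elt p = (\<lambda>q. if q = p then 1 else 0)"

definition vert_elt :: "nat \<Rightarrow> 'f::field palg" where
  "vert_elt i = path_elt (i, [])"

definition arrow_elt :: "arrow \<Rightarrow> 'f::field palg" where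
  "arrow_elt \<alpha> = path_elt (arrow_tail \<alpha>, [\<alpha>])"

definition sigma :: "nat \<Rightarrow> nat \<Rightarrow> 'f::field palg" where
  "sigma n i =
    (let P = path_algebra n; a = (\<lambda>i. arrow_elt (Up i)); a' = (\<lambda>i. arrow_elt (Down i)) in
     if i = 0 then \<ominus>\<^bsub>P\<^esub> (a' 0 \<otimes>\<^bsub>P\<^esub> a 0)
     else if i = n - 1 then a (n - 2) \<otimes>\<^bsub>P\<^esub> a' (n - 2)
     else (a (i - 1) \<otimes>\<^bsub>P\<^esub> a' (i - 1)) \<ominus>\<^bsub>P\<^esub> (a' i \<otimes>\<^bsub>P\<^esub> a i))"

section \<open>The spaces \<open>W\<^sub>p\<close>\<close>

text \<open>The path algebra is the tensor algebra \<open>T\<^sub>k(V)\<close>, and \<open>k\<close> is semisimple. So, for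
  \<open>k\<close>-subbimodules \<open>X \<subseteq> V\<^sup>\<otimes>\<^sup>i\<close> and \<open>Y \<subseteq> V\<^sup>\<otimes>\<^sup>j\<close>, the tensor product \<open>X \<otimes>\<^sub>k Y\<close> is the span
  of the products \<open>x y\<close> in the path algebra.\<close>

definition pspan :: "nat \<Rightarrow> 'f::field palg set \<Rightarrow> 'f palg set" where
  "pspan n = LinearCombinations.module.span class_ring (path_algebra n)"

definition tensor :: "nat \<Rightarrow> 'f::field palg set \<Rightarrow> 'f palg set \<Rightarrow> 'f palg set" where
  "tensor n X Y = pspan n {x \<otimes>\<^bsub>path_algebra n\<^esub> y | x y. x \<in> X \<and> y \<in> Y}"

definition vertex_space :: "nat \<Rightarrow> 'f::field palg set" where
  "vertex_space n = pspan n (vert_elt ` verts (double_quiver n))"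

definition arrow_space :: "nat \<Rightarrow> 'f::field palg set" where
  "arrow_space n = pspan n (arrow_elt ` arcs (double_quiver n))"

definition relation_space :: "nat \<Rightarrow> 'f::field palg set" where
  "relation_space n = pspan n (sigma n ` {..<n})"

fun tensor_power :: "nat \<Rightarrow> nat \<Rightarrow> 'f::field palg set" where
  "tensor_power n 0 = vertex_space n"
| "tensor_power n (Suc i) = tensor n (tensor_power n i) (arrow_space n)"

definition W :: "nat \<Rightarrow> nat \<Rightarrow> 'f::field palg set" where
  "W n p =
    (if p = 0 then vertex_space n
     else if p = 1 then arrow_space n
     else \<Inter>{tensor n (tensor n (tensor_power n i) (relation_space n)) (tensor_power n j)
            | i j. i + 2 + j = p})"

section \<open>The preprojective algebra\<close>

text \<open>The quotient \<open>M Quot N\<close> of the library has no scalar multiplication; here it is equipped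
  with the induced one. If \<open>N\<close> is only a submodule and not an ideal, then the multiplicative
  part of the record is meaningless and only the module part is used.\<close>

definition quotient :: "('f, 'a) module \<Rightarrow> 'a set \<Rightarrow> ('f, 'a set) module" where
  "quotient M N =
    \<lparr>carrier = carrier (M Quot N), mult = mult (M Quot N), one = one (M Quot N),
     zero = zero (M Quot N), add = add (M Quot N),
     smult = (\<lambda>c X. set_add M N ((\<lambda>x. c \<odot>\<^bsub>M\<^esub> x) ` X))\<rparr>"

definition relation_ideal :: "nat \<Rightarrow> 'f::field palg set" where
  "relation_ideal n = Idl\<^bsub>path_algebra n\<^esub> (relation_space n)"

definition preproj :: "nat \<Rightarrow> ('f::field, 'f palg set) module" where
  "preproj n = quotient (path_algebra n) (relation_ideal n)"

definition proj :: "nat \<Rightarrow> 'f::field palg \<Rightarrow> 'f palg set" where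
  "proj n x = relation_ideal n +>\<^bsub>path_algebra n\<^esub> x"

definition centre :: "nat \<Rightarrow> ('f::field, 'f palg set) module" where
  "centre n = (preproj n)
    \<lparr>carrier := {z \<in> carrier (preproj n).
       \<forall>x \<in> carrier (preproj n). z \<otimes>\<^bsub>preproj n\<^esub> x = x \<otimes>\<^bsub>preproj n\<^esub> z}\<rparr>"

section \<open>Koszul cohomology\<close>

type_synonym 'f cochain = "'f palg \<Rightarrow> 'f palg set"

text \<open>\<open>Hom\<close> over \<open>k \<otimes> k\<close> from \<open>W\<^sub>p\<close> to \<open>A\<close>; a cochain is \<open>undefined\<close> outside \<open>W\<^sub>p\<close>.\<close>

definition cochains :: "nat \<Rightarrow> nat \<Rightarrow> ('f::field, 'f cochain) module" where
  "cochains n p = (let P = path_algebra n; A = preproj n in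
    \<lparr>carrier = {f \<in> LinearCombinations.module_hom class_ring (P\<lparr>carrier := W n p\<rparr>) A \<inter> extensional (W n p).
        \<forall>u \<in> vertex_space n. \<forall>v \<in> vertex_space n. \<forall>x \<in> W n p.
          f (u \<otimes>\<^bsub>P\<^esub> x \<otimes>\<^bsub>P\<^esub> v) = proj n u \<otimes>\<^bsub>A\<^esub> f x \<otimes>\<^bsub>A\<^esub> proj n v},
     mult = undefined,
     one = undefined,
     zero = (\<lambda>x \<in> W n p. \<zero>\<^bsub>A\<^esub>),
     add = (\<lambda>f g. \<lambda>x \<in> W n p. f x \<oplus>\<^bsub>A\<^esub> g x),
     smult = (\<lambda>c f. \<lambda>x \<in> W n p. c \<odot>\<^bsub>A\<^esub> f x)\<rparr>)"

text \<open>For \<open>x\<close> of positive degree, \<open>x = (\<Sum>\<alpha>. right_part \<alpha> x \<cdot> \<alpha>) = (\<Sum>\<alpha>. \<alpha> \<cdot> left_part \<alpha> x)\<close>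
  over all arrows \<open>\<alpha>\<close>, where \<open>right_part \<alpha> x\<close> lies in the span of the paths that start where
  \<open>\<alpha>\<close> ends and \<open>left_part \<alpha> x\<close> in the span of those that end where \<open>\<alpha>\<close> starts. These are the
  decompositions of \<open>x \<in> W\<^sub>p\<^sub>+\<^sub>1\<close> in \<open>W\<^sub>p \<otimes>\<^sub>k V\<close> and in \<open>V \<otimes>\<^sub>k W\<^sub>p\<close>.\<close>

definition right_part :: "arrow \<Rightarrow> 'f::field palg \<Rightarrow> 'f palg" where
  "right_part \<alpha> x = (\<lambda>(u, es). if u = arrow_head \<alpha> then x (arrow_tail \<alpha>, \<alpha> # es) else 0)"

definition left_part :: "nat \<Rightarrow> arrow \<Rightarrow> 'f::field palg \<Rightarrow> 'f palg" where
  "left_part n \<alpha> x =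
    (\<lambda>(u, es). if path_end n (u, es) = arrow_tail \<alpha> then x (u, es @ [\<alpha>]) else 0)"

definition b_K :: "nat \<Rightarrow> nat \<Rightarrow> 'f::field cochain \<Rightarrow> 'f cochain" where
  "b_K n p f = (let A = preproj n; Q\<^sub>1 = arcs (double_quiver n) in
    (\<lambda>x \<in> W n (p + 1).
      (\<Oplus>\<^bsub>A\<^esub>\<alpha>\<in>Q\<^sub>1. f (right_part \<alpha> x) \<otimes>\<^bsub>A\<^esub> proj n (arrow_elt \<alpha>))
      \<ominus>\<^bsub>A\<^esub> ((- 1) ^ p \<odot>\<^bsub>A\<^esub> (\<Oplus>\<^bsub>A\<^esub>\<alpha>\<in>Q\<^sub>1. proj n (arrow_elt \<alpha>) \<otimes>\<^bsub>A\<^esub> f (left_part n \<alpha> x)))))"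

definition cocycles :: "nat \<Rightarrow> nat \<Rightarrow> 'f::field cochain set" where
  "cocycles n p = {f \<in> carrier (cochains n p). b_K n p f = \<zero>\<^bsub>cochains n (p + 1)\<^esub>}"

definition coboundaries :: "nat \<Rightarrow> nat \<Rightarrow> 'f::field cochain set" where
  "coboundaries n p =
    (case p of 0 \<Rightarrow> {\<zero>\<^bsub>cochains n 0\<^esub>} | Suc q \<Rightarrow> b_K n q ` carrier (cochains n q))"

definition HK :: "nat \<Rightarrow> nat \<Rightarrow> ('f::field, 'f cochain set) module" where
  "HK n p = quotient ((cochains n p)\<lparr>carrier := cocycles n p\<rparr>) (coboundaries n p)"

definition HK_class :: "nat \<Rightarrow> nat \<Rightarrow> 'f::field cochain \<Rightarrow> 'f cochain set" where
  "HK_class n p f = coboundaries n p +>\<^bsub>cochains n p\<^esub> f"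

text \<open>The identification of \<open>\<Oplus>\<^sub>i e\<^sub>i A e\<^sub>i\<close> with \<open>Hom(k, A)\<close>; its inverse is evaluation at \<open>1 \<in> k\<close>.\<close>

definition cochain_of_elt :: "nat \<Rightarrow> 'f::field palg set \<Rightarrow> 'f cochain" where
  "cochain_of_elt n z = (\<lambda>x \<in> W n 0. proj n x \<otimes>\<^bsub>preproj n\<^esub> z)"

section \<open>The elements \<open>z\<^sub>\<ell>\<close> and the cochains \<open>\<zeta>\<^sub>\<ell>\<close>, \<open>h\<^sub>i\<close>\<close>

definition loop :: "nat \<Rightarrow> nat \<Rightarrow> 'f::field palg set" where
  "loop n i = proj n (arrow_elt (Down i)) \<otimes>\<^bsub>preproj n\<^esub> proj n (arrow_elt (Up i))"

definition zelt :: "nat \<Rightarrow> nat \<Rightarrow> 'f::field palg set" where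
  "zelt n l =
    (if l = 0 then \<one>\<^bsub>preproj n\<^esub>
     else (\<Oplus>\<^bsub>preproj n\<^esub>i\<in>{1..n - 2}. loop n i [^]\<^bsub>preproj n\<^esub> l))"

text \<open>A cochain is determined by its values on the arrows, respectively on the relations
  \<open>\<sigma>\<^sub>j\<close>, which span \<open>W\<^sub>1\<close> and \<open>W\<^sub>2\<close>.\<close>

definition zeta :: "nat \<Rightarrow> nat \<Rightarrow> 'f::field cochain" where
  "zeta n l = (THE f. f \<in> carrier (cochains n 1) \<and>
    (\<forall>i < n - 1.
      f (arrow_elt (Up i)) =
        proj n (arrow_elt (Up i)) \<otimes>\<^bsub>preproj n\<^esub> (loop n i [^]\<^bsub>preproj n\<^esub> l) \<and>
      f (arrow_elt (Down i)) = \<zero>\<^bsub>preproj n\<^esub>))"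

definition hcochain :: "nat \<Rightarrow> nat \<Rightarrow> 'f::field cochain" where
  "hcochain n i = (THE f. f \<in> carrier (cochains n 2) \<and>
    (\<forall>j < n. f (sigma n j) = (if i = j then proj n (vert_elt i) else \<zero>\<^bsub>preproj n\<^esub>)))"

definition basis_family :: "('f::field, 'a) module \<Rightarrow> ('i \<Rightarrow> 'a) \<Rightarrow> 'i set \<Rightarrow> bool" where
  "basis_family V b I \<longleftrightarrow>
    vectorspace class_ring V \<and> inj_on b I \<and> vectorspace.basis class_ring V (b ` I)"

end

theory Submission
  imports Defs
begin

text \<open>Modulo the relations, two paths with the same ends and the same length are equal: where they
  first diverge, both can be rerouted to return to the point of divergence after two steps. A path
  from \<open>u\<close> to \<open>v\<close> of length \<open>d\<close> can be rerouted through the end \<open>0\<close> of the quiver, where it vanishes,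
  iff \<open>d > u + v\<close>, and through the end \<open>n - 1\<close> iff \<open>u + v + d > 2 (n - 1)\<close>. The remaining
  monomials are linearly independent because the functionals which sum the coefficients of an
  element over all paths with given \<open>(u, v, d)\<close> cut out an ideal that contains the relations. Hence
  the algebra is an algebra of functions of \<open>(u, v, d)\<close> under convolution, and a Koszul cochain
  is a family of scalars indexed by a basis element of \<open>W\<^sub>p\<close> and a degree.

  In these coordinates the differentials \<open>b\<^sub>K\<close> are difference operators along the vertices. In degree
  0 the cocycles are the functions that are constant on the segments \<open>l \<le> i \<le> n - 1 - l\<close>; in degree 1
  the cohomology class is read off from the sums of the coefficients at \<open>a\<^sub>i\<close> and \<open>a\<^sub>i\<^sup>*\<close>, which are
  constant on segments for a cocycle and vanish for a coboundary; in degree 2 all cochains are cocycles, as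
  \<open>W\<^sub>3 = 0\<close>, and exactly the ones without constant terms are coboundaries.\<close>

text \<open>The ranges of l count nonempty segments: a loop of degree 2l survives at the vertices l
  <= i <= n - 1 - l, which exist iff l <= m, and a monomial of degree 2l + 1 along an edge survives
  at l <= i <= n - 2 - l, which exist iff l <= n - 2 - m. Each segment contributes one class. Why
  sums of coefficients in degree 1: on sigma_i a cochain is applied to either letter of a_i^* a_i,
  and the two results, having equal ends and length, are multiples of the same monomial; the sign
  (-1)^p at p = 1 makes them add. A coboundary takes the difference of the values at head and tail,
  which changes sign between a_i and a_i^*, so its sums are zero. No division by an integer occurs,
  so the characteristic is arbitrary. The formal obstacle is that quotients are stacked, cohomology
  over A over the path algebra. Every space is therefore presented as the image of a function space
  under a linear map with known kernel, and a basis is verified by dual functionals whose common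
  kernel is that kernel; no dimension is computed.\<close>

section \<open>Linear algebra through a coordinate map\<close>

text \<open>\<open>mk\<close> may have a kernel, so that one element has many coordinate functions.
  A quotient then keeps \<open>Y\<close> and only changes \<open>mk\<close>.\<close>

locale coordinates =
  fixes M :: "('f::field, 'c) module" and Y :: "('a \<Rightarrow> 'f) set" and mk :: "('a \<Rightarrow> 'f) \<Rightarrow> 'c"
  assumes carrier_eq: "carrier M = mk ` Y"
    and zero_mem: "(\<lambda>_. 0) \<in> Y"
    and add_mem: "\<And>y y'. y \<in> Y \<Longrightarrow> y' \<in> Y \<Longrightarrow> (\<lambda>a. y a + y' a) \<in> Y"
    and smult_mem: "\<And>c y. y \<in> Y \<Longrightarrow> (\<lambda>a. c * y a) \<in> Y"
    and zero_eq: "\<zero>\<^bsub>M\<^esub> = mk (\<lambda>_. 0)"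
    and add_eq: "\<And>y y'. y \<in> Y \<Longrightarrow> y' \<in> Y \<Longrightarrow> mk y \<oplus>\<^bsub>M\<^esub> mk y' = mk (\<lambda>a. y a + y' a)"
    and smult_eq: "\<And>c y. y \<in> Y \<Longrightarrow> c \<odot>\<^bsub>M\<^esub> mk y = mk (\<lambda>a. c * y a)"
begin

lemma uminus_mem: "y \<in> Y \<Longrightarrow> (\<lambda>a. - y a) \<in> Y"
  using smult_mem[of y "-1"] by simp

lemma minus_mem: "y \<in> Y \<Longrightarrow> y' \<in> Y \<Longrightarrow> (\<lambda>a. y a - y' a) \<in> Y"
  using add_mem[OF _ uminus_mem, of y y'] by simp

lemma mk_closed: "y \<in> Y \<Longrightarrow> mk y \<in> carrier M"
  by (simp add: carrier_eq)

lemma abelian_group: "abelian_group M"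
proof (rule abelian_groupI)
  fix x assume "x \<in> carrier M"
  then obtain y where y: "y \<in> Y" "x = mk y"
    using carrier_eq by auto
  show "\<exists>x'\<in>carrier M. x' \<oplus>\<^bsub>M\<^esub> x = \<zero>\<^bsub>M\<^esub>"
    by (rule bexI[of _ "mk (\<lambda>a. - y a)"])
      (use y in \<open>auto simp: add_eq uminus_mem zero_eq carrier_eq\<close>)
qed (auto simp: carrier_eq add_eq zero_eq add_mem zero_mem algebra_simps)

lemma module: "Module.module class_ring M"
proof (rule moduleI)
  show "cring (class_ring :: 'f ring)"
    by (rule class_cring.is_cring)
qed (auto simp: abelian_group carrier_eq add_eq smult_eq add_mem smult_mem algebra_simps)

lemma vectorspace: "vectorspace class_ring M"
  by (simp add: vectorspace_def module class_field)

lemma sum_mem: "(\<And>i. i \<in> I \<Longrightarrow> y i \<in> Y) \<Longrightarrow> (\<lambda>a. \<Sum>i\<in>I. y i a) \<in> Y"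
  by (induction I rule: infinite_finite_induct) (auto simp: zero_mem add_mem)

lemma finsum_eq:
  assumes "finite I" "\<And>i. i \<in> I \<Longrightarrow> y i \<in> Y"
  shows "(\<Oplus>\<^bsub>M\<^esub>i\<in>I. mk (y i)) = mk (\<lambda>a. \<Sum>i\<in>I. y i a)"
proof -
  interpret abelian_group M by (rule abelian_group)
  show ?thesis
    using assms
  proof (induction I rule: finite_induct)
    case (insert i I)
    then show ?case
      by (subst finsum_insert) (auto simp: carrier_eq add_eq sum_mem)
  qed (simp add: zero_eq)
qed

lemma a_inv_eq: "y \<in> Y \<Longrightarrow> \<ominus>\<^bsub>M\<^esub> mk y = mk (\<lambda>a. - y a)"
  by (rule abelian_group.minus_equality[OF abelian_group])
    (auto simp: add_eq uminus_mem zero_eq carrier_eq)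

lemma a_minus_eq:
  "y \<in> Y \<Longrightarrow> y' \<in> Y \<Longrightarrow> mk y \<ominus>\<^bsub>M\<^esub> mk y' = mk (\<lambda>a. y a - y' a)"
  by (simp add: a_minus_def a_inv_eq add_eq uminus_mem)

lemma mk_eq_iff:
  assumes y: "y \<in> Y" "y' \<in> Y"
  shows "mk y = mk y' \<longleftrightarrow> mk (\<lambda>a. y a - y' a) = \<zero>\<^bsub>M\<^esub>"
proof
  assume "mk y = mk y'"
  then show "mk (\<lambda>a. y a - y' a) = \<zero>\<^bsub>M\<^esub>"
    using a_minus_eq[OF y] a_minus_eq[OF y(2) y(2)] by (simp add: zero_eq)
next
  assume 0: "mk (\<lambda>a. y a - y' a) = \<zero>\<^bsub>M\<^esub>"
  have "mk (\<lambda>a. y a - y' a) \<oplus>\<^bsub>M\<^esub> mk y' = mk y"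
    using y by (simp add: add_eq minus_mem)
  then show "mk y = mk y'"
    using y add_eq[OF zero_mem y(2)] unfolding 0 by (simp add: zero_eq)
qed

lemma restrict:
  assumes "Y' \<subseteq> Y" "(\<lambda>_. 0) \<in> Y'"
    and "\<And>y y'. y \<in> Y' \<Longrightarrow> y' \<in> Y' \<Longrightarrow> (\<lambda>a. y a + y' a) \<in> Y'"
    and "\<And>c y. y \<in> Y' \<Longrightarrow> (\<lambda>a. c * y a) \<in> Y'"
  shows "coordinates (M\<lparr>carrier := mk ` Y'\<rparr>) Y' mk"
  by unfold_locales (use assms in \<open>simp_all add: zero_eq add_eq smult_eq subset_iff\<close>)

text \<open>By \<open>ker\<close>, an element of \<open>M\<close> is determined by the scalars
  \<open>T y i\<close>, and \<open>e\<close> is dual to \<open>T\<close>. Hence \<open>mk y\<close>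
  is the combination of the \<open>b i\<close> with coefficients \<open>T y i\<close>, and applying
  \<open>T\<close> to a vanishing combination isolates each coefficient.\<close>

lemma basis_familyI:
  fixes T :: "('a \<Rightarrow> 'f) \<Rightarrow> 'i \<Rightarrow> 'f"
  assumes fin_I: "finite I"
    and T_add: "\<And>y y' i. i \<in> I \<Longrightarrow> T (\<lambda>a. y a + y' a) i = T y i + T y' i"
    and T_smult: "\<And>c y i. i \<in> I \<Longrightarrow> T (\<lambda>a. c * y a) i = c * T y i"
    and ker: "\<And>y. y \<in> Y \<Longrightarrow> mk y = \<zero>\<^bsub>M\<^esub> \<longleftrightarrow> (\<forall>i\<in>I. T y i = 0)"
    and e: "\<And>i. i \<in> I \<Longrightarrow> e i \<in> Y" "\<And>i j. i \<in> I \<Longrightarrow> j \<in> I \<Longrightarrow> T (e i) j = (if i = j then 1 else 0)"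
    and b: "\<And>i. i \<in> I \<Longrightarrow> b i = mk (e i)"
  shows "basis_family M b I"
proof -
  interpret vectorspace class_ring M by (rule vectorspace)
  have T0: "T (\<lambda>_. 0) i = 0" if "i \<in> I" for i
    using T_smult[OF that, of 0 "\<lambda>_. 0"] by simp
  have T_sum: "T (\<lambda>a. \<Sum>j\<in>J. c j * y j a) i = (\<Sum>j\<in>J. c j * T (y j) i)" if "finite J" "i \<in> I"
    for J :: "'i set" and c y i
    using that(1)
    by (induction J rule: finite_induct) (simp_all add: T0 T_add T_smult that(2))
  have T_diff: "T (\<lambda>a. y a - y' a) i = T y i - T y' i" if "i \<in> I" for y y' i
    using T_add[OF that, of y "\<lambda>a. -1 * y' a"] T_smult[OF that, of "-1" y'] by simp
  have eq_iff: "mk y = mk y' \<longleftrightarrow> (\<forall>i\<in>I. T y i = T y' i)" if y: "y \<in> Y" "y' \<in> Y" for y y'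
    using y by (simp add: mk_eq_iff ker minus_mem T_diff)
  have comb: "(\<Oplus>\<^bsub>M\<^esub>i\<in>I. c i \<odot>\<^bsub>M\<^esub> b i) = mk (\<lambda>a. \<Sum>i\<in>I. c i * e i a)" for c
  proof -
    have "(\<Oplus>\<^bsub>M\<^esub>i\<in>I. c i \<odot>\<^bsub>M\<^esub> b i) = (\<Oplus>\<^bsub>M\<^esub>i\<in>I. mk (\<lambda>a. c i * e i a))"
      by (rule finsum_cong') (auto simp: b smult_eq e smult_mem mk_closed)
    then show ?thesis
      using finsum_eq[OF fin_I, of "\<lambda>i a. c i * e i a"] by (simp add: e smult_mem)
  qed
  have comb_mem: "(\<lambda>a. \<Sum>i\<in>I. c i * e i a) \<in> Y" for c
    by (rule sum_mem) (simp add: e smult_mem)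
  have T_comb: "T (\<lambda>a. \<Sum>i\<in>I. c i * e i a) j = c j" if "j \<in> I" for c j
  proof -
    have "T (\<lambda>a. \<Sum>i\<in>I. c i * e i a) j = (\<Sum>i\<in>I. if i = j then c i else 0)"
      unfolding T_sum[OF fin_I that] by (rule sum.cong) (simp_all add: e that)
    then show ?thesis
      using that fin_I by simp
  qed
  have inj: "inj_on b I"
  proof (rule inj_onI)
    fix i j assume ij: "i \<in> I" "j \<in> I" "b i = b j"
    then have "T (e i) i = T (e j) i"
      using eq_iff[of "e i" "e j"] b e(1) by metis
    then show "i = j"
      using ij e(2)[of i i] e(2)[of j i] by (auto split: if_splits)
  qed
  have b_closed: "b ` I \<subseteq> carrier M"
    by (auto simp: b e mk_closed)
  have lincomb_b: "lincomb c (b ` I) = mk (\<lambda>a. \<Sum>i\<in>I. c (b i) * e i a)" for c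
  proof -
    have "lincomb c (b ` I) = (\<Oplus>\<^bsub>M\<^esub>i\<in>I. c (b i) \<odot>\<^bsub>M\<^esub> b i)"
      unfolding lincomb_def
      by (rule finsum_reindex) (use inj b_closed in \<open>auto intro: smult_closed\<close>)
    then show ?thesis
      by (simp only: comb)
  qed
  have "lin_indpt (b ` I)"
  proof (rule finite_lin_indpt2)
    fix c :: "'c \<Rightarrow> 'f" assume 0: "lincomb c (b ` I) = \<zero>\<^bsub>M\<^esub>"
    show "\<forall>v\<in>b ` I. c v = \<zero>\<^bsub>class_ring\<^esub>"
    proof
      fix v assume "v \<in> b ` I"
      then obtain j where j: "j \<in> I" "v = b j" by blast
      have "\<forall>i\<in>I. T (\<lambda>a. \<Sum>i\<in>I. c (b i) * e i a) i = 0"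
        using 0 by (simp add: lincomb_b ker comb_mem)
      then show "c v = \<zero>\<^bsub>class_ring\<^esub>"
        using j T_comb[of j "\<lambda>i. c (b i)"] by simp
    qed
  qed (use finite_imageI[OF fin_I] b_closed in blast)+
  moreover have "carrier M \<subseteq> span (b ` I)"
  proof
    fix x assume "x \<in> carrier M"
    then obtain y where y: "y \<in> Y" "x = mk y"
      using carrier_eq by auto
    \<comment> \<open>Linear combinations take coefficients indexed by vectors, so the index is
      recovered from the vector by inverting \<open>b\<close>.\<close>
    define c where "c v = T y (the_inv_into I b v)" for v
    have "x = mk (\<lambda>a. \<Sum>i\<in>I. c (b i) * e i a)"
      using y by (subst y, subst eq_iff) (auto simp: comb_mem T_comb c_def the_inv_into_f_f inj)
    then have "x = lincomb c (b ` I)"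
      by (simp add: lincomb_b)
    then show "x \<in> span (b ` I)"
      unfolding span_def using finite_imageI[OF fin_I, of b] by auto
  qed
  then have "gen_set (b ` I)"
    using span_is_subset2[OF b_closed] by auto
  ultimately show ?thesis
    unfolding basis_family_def basis_def using inj b_closed vectorspace by blast
qed

text \<open>\<open>Q\<close> expresses membership in \<open>N\<close> on coordinates. Since
  \<open>mk\<close> may identify functions, \<open>Q_cong\<close> is what makes this independent of
  the representative.\<close>

lemma quotient:
  assumes Q0: "Q (\<lambda>_. 0)"
    and Q_add: "\<And>y y'. y \<in> Y \<Longrightarrow> y' \<in> Y \<Longrightarrow> Q y \<Longrightarrow> Q y' \<Longrightarrow> Q (\<lambda>a. y a + y' a)"
    and Q_smult: "\<And>c y. y \<in> Y \<Longrightarrow> Q y \<Longrightarrow> Q (\<lambda>a. c * y a)"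
    and N: "N = mk ` {y \<in> Y. Q y}"
    and Q_cong: "\<And>y y'. y \<in> Y \<Longrightarrow> y' \<in> Y \<Longrightarrow> Q y \<Longrightarrow> mk y = mk y' \<Longrightarrow> Q y'"
  shows "coordinates (quotient M N) Y (\<lambda>y. N +>\<^bsub>M\<^esub> mk y)"
    and "\<And>y. y \<in> Y \<Longrightarrow> N +>\<^bsub>M\<^esub> mk y = \<zero>\<^bsub>quotient M N\<^esub> \<longleftrightarrow> Q y"
proof -
  interpret Module.module class_ring M by (rule module)
  have N_sub: "N \<subseteq> carrier M"
    by (auto simp: N mk_closed)
  have N0: "\<zero>\<^bsub>M\<^esub> \<in> N"
    by (auto simp: N zero_eq Q0 zero_mem)
  have N_add: "x \<oplus>\<^bsub>M\<^esub> y \<in> N" if "x \<in> N" "y \<in> N" for x y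
    using that by (auto simp: N add_eq Q_add add_mem)
  have N_smult: "c \<odot>\<^bsub>M\<^esub> x \<in> N" if "x \<in> N" for x c
    using that by (auto simp: N smult_eq Q_smult smult_mem)
  have N_neg: "\<ominus>\<^bsub>M\<^esub> x \<in> N" if "x \<in> N" for x
    using N_smult[OF that, of "-1"] smult_minus_1[of x] that N_sub
    by (auto simp: class_ring_simps)
  have "subgroup N (add_monoid M)"
    by (rule subgroup.intro) (use N_sub N0 N_add N_neg[unfolded a_inv_def] in \<open>simp_all add: subset_iff\<close>)
  then have "additive_subgroup N M"
    by (rule additive_subgroupI)
  then interpret abelian_subgroup N M
    by (rule abelian_subgroupI3) (rule abelian_group)
  have mem_N: "mk y \<in> N \<longleftrightarrow> Q y" if "y \<in> Y" for y
  proof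
    assume "mk y \<in> N"
    then obtain y' where "y' \<in> Y" "Q y'" "mk y = mk y'"
      unfolding N by (elim imageE CollectE conjE)
    then show "Q y"
      using Q_cong[of y' y] that by simp
  qed (simp add: N that)
  \<comment> \<open>For c = 0 the image of a coset under scaling is only the zero set; adding
    \<open>N\<close> makes it a coset again.\<close>
  have sm: "set_add M N ((\<lambda>x. c \<odot>\<^bsub>M\<^esub> x) ` (N +>\<^bsub>M\<^esub> x)) = N +>\<^bsub>M\<^esub> (c \<odot>\<^bsub>M\<^esub> x)" (is "?L = ?R")
    if x: "x \<in> carrier M" for c x
  proof
    show "?L \<subseteq> ?R"
    proof
      fix z assume "z \<in> ?L"
      then obtain h k where hk: "h \<in> N" "k \<in> N" "z = h \<oplus>\<^bsub>M\<^esub> c \<odot>\<^bsub>M\<^esub> (k \<oplus>\<^bsub>M\<^esub> x)"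
        unfolding set_add_def' a_r_coset_def' by (auto simp only: UN_iff image_iff singleton_iff)
      moreover from this have "h \<in> carrier M" "k \<in> carrier M"
        using N_sub by auto
      ultimately have "z = (h \<oplus>\<^bsub>M\<^esub> c \<odot>\<^bsub>M\<^esub> k) \<oplus>\<^bsub>M\<^esub> c \<odot>\<^bsub>M\<^esub> x"
        using x by (simp add: smult_r_distr M.a_assoc)
      moreover have "h \<oplus>\<^bsub>M\<^esub> c \<odot>\<^bsub>M\<^esub> k \<in> N"
        using hk N_add N_smult by blast
      ultimately show "z \<in> ?R"
        unfolding a_r_coset_def' by blast
    qed
    show "?R \<subseteq> ?L"
    proof
      fix z assume "z \<in> ?R"
      then obtain h where h: "h \<in> N" "z = h \<oplus>\<^bsub>M\<^esub> c \<odot>\<^bsub>M\<^esub> x"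
        unfolding a_r_coset_def' by blast
      have "x \<in> N +>\<^bsub>M\<^esub> x"
        using x by (rule a_rcos_self)
      then have "c \<odot>\<^bsub>M\<^esub> x \<in> (\<lambda>x. c \<odot>\<^bsub>M\<^esub> x) ` (N +>\<^bsub>M\<^esub> x)"
        by (rule imageI)
      then show "z \<in> ?L"
        unfolding set_add_def' h(2) by (intro UN_I[OF h(1)] UN_I) auto
    qed
  qed
  show "coordinates (quotient M N) Y (\<lambda>y. N +>\<^bsub>M\<^esub> mk y)"
  proof
    show "carrier (quotient M N) = (\<lambda>y. N +>\<^bsub>M\<^esub> mk y) ` Y"
      by (auto simp: quotient_def FactRing_def A_RCOSETS_def' a_r_coset_def' carrier_eq)
    show "\<zero>\<^bsub>quotient M N\<^esub> = N +>\<^bsub>M\<^esub> mk (\<lambda>_. 0)"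
      using N_sub by (simp add: quotient_def FactRing_def flip: zero_eq)
  next
    fix y y' assume "y \<in> Y" "y' \<in> Y"
    then show "(N +>\<^bsub>M\<^esub> mk y) \<oplus>\<^bsub>quotient M N\<^esub> (N +>\<^bsub>M\<^esub> mk y') = N +>\<^bsub>M\<^esub> mk (\<lambda>a. y a + y' a)"
      by (simp add: quotient_def FactRing_def a_rcos_sum mk_closed add_eq)
  next
    fix c y assume "y \<in> Y"
    then show "c \<odot>\<^bsub>quotient M N\<^esub> (N +>\<^bsub>M\<^esub> mk y) = N +>\<^bsub>M\<^esub> mk (\<lambda>a. c * y a)"
      by (simp add: quotient_def sm mk_closed smult_eq)
  qed (auto intro: zero_mem add_mem smult_mem)
  show "N +>\<^bsub>M\<^esub> mk y = \<zero>\<^bsub>quotient M N\<^esub> \<longleftrightarrow> Q y" if y: "y \<in> Y" for y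
  proof -
    have "N +>\<^bsub>M\<^esub> mk y = N \<longleftrightarrow> mk y \<in> N"
      using a_rcos_self[OF mk_closed[OF y]] a_coset_join2[OF mk_closed[OF y] a_subgroup] by auto
    then show ?thesis
      by (simp add: quotient_def FactRing_def mem_N y)
  qed
qed

end

section \<open>Walks in the double quiver\<close>

lemma arcs_double_quiver [simp]:
  "Up i \<in> arcs (double_quiver n) \<longleftrightarrow> i < n - 1"
  "Down i \<in> arcs (double_quiver n) \<longleftrightarrow> i < n - 1"
  by (auto simp: double_quiver_def)

lemma finite_arcs [simp]: "finite (arcs (double_quiver n))"
  by (simp add: double_quiver_def)

lemma arrow_ends_less:
  assumes "\<alpha> \<in> arcs (double_quiver n)"
  shows "arrow_tail \<alpha> < n" "arrow_head \<alpha> < n"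
  using assms by (cases \<alpha>; simp)+

text \<open>A recursion on the arrow list that replaces \<open>awalk\<close> (see
  \<open>awalk_eq_walk\<close>), so that walks can be taken apart at their first arrow.\<close>

primrec walk :: "nat \<Rightarrow> arrow list \<Rightarrow> nat \<Rightarrow> nat \<Rightarrow> bool" where
  "walk n [] u v \<longleftrightarrow> u < n \<and> u = v"
| "walk n (\<alpha> # es) u v \<longleftrightarrow>
     \<alpha> \<in> arcs (double_quiver n) \<and> arrow_tail \<alpha> = u \<and> walk n es (arrow_head \<alpha>) v"

text \<open>Total on purpose: the head of the last arrow even if the list is not composable, and the
  start for the empty list.\<close>

definition walk_end :: "nat \<Rightarrow> arrow list \<Rightarrow> nat" where
  "walk_end u es = foldl (\<lambda>_. arrow_head) u es"

lemma walk_end_simps [simp]: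
  "walk_end u [] = u"
  "walk_end u (\<alpha> # es) = walk_end (arrow_head \<alpha>) es"
  "walk_end u (es @ es') = walk_end (walk_end u es) es'"
  by (simp_all add: walk_end_def)

lemma path_end_eq: "path_end n (u, es) = walk_end u es"
proof -
  have "pre_digraph.awlast (double_quiver n) u es = walk_end u es"
  proof (induction es arbitrary: u)
    case Nil
    then show ?case
      by (simp add: pre_digraph.awalk_verts.simps)
  next
    case (Cons \<alpha> es)
    have "pre_digraph.awalk_verts (double_quiver n) (arrow_head \<alpha>) es \<noteq> []"
      by (cases es) (simp_all add: pre_digraph.awalk_verts.simps)
    with Cons show ?case
      by (simp add: pre_digraph.awalk_verts.simps double_quiver_def)
  qed
  then show ?thesis
    by (simp add: path_end_def)
qed

lemma awalk_eq_walk: "pre_digraph.awalk (double_quiver n) u es v \<longleftrightarrow> walk n es u v"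
proof (induction es arbitrary: u)
  case Nil
  then show ?case
    by (auto simp: pre_digraph.awalk_def pre_digraph.cas.simps double_quiver_def)
next
  case (Cons \<alpha> es)
  have "head (double_quiver n) \<alpha> = arrow_head \<alpha>" "tail (double_quiver n) \<alpha> = arrow_tail \<alpha>"
    "verts (double_quiver n) = {..<n}"
    by (simp_all add: double_quiver_def)
  with Cons[of "arrow_head \<alpha>"] arrow_ends_less[of \<alpha> n] show ?case
    by (auto simp: pre_digraph.awalk_def pre_digraph.cas.simps)
qed

lemma walk_end_walk: "walk n es u v \<Longrightarrow> walk_end u es = v"
  by (induction es arbitrary: u) auto

lemma walk_start_less: "walk n es u v \<Longrightarrow> u < n"
  by (cases es) (auto dest: arrow_ends_less)

lemma walk_end_less: "walk n es u v \<Longrightarrow> v < n"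
  by (induction es arbitrary: u) auto

lemma walk_append: "walk n (es @ es') u v \<longleftrightarrow> walk n es u (walk_end u es) \<and> walk n es' (walk_end u es) v"
  by (induction es arbitrary: u) (auto dest: walk_start_less)

lemma paths_iff: "(u, es) \<in> paths n \<longleftrightarrow> walk n es u (walk_end u es)"
  by (auto simp: paths_def awalk_eq_walk dest: walk_end_walk)

lemma paths_append:
  "(u, es @ es') \<in> paths n \<longleftrightarrow> (u, es) \<in> paths n \<and> (walk_end u es, es') \<in> paths n"
  by (simp add: paths_iff walk_append)

definition walks :: "nat \<Rightarrow> nat \<Rightarrow> nat \<Rightarrow> nat \<Rightarrow> arrow list set" where
  "walks n u v d = {es. walk n es u v \<and> length es = d}"

lemma finite_walks [simp]: "finite (walks n u v d)"
proof (rule finite_subset)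
  show "walks n u v d \<subseteq> {es. set es \<subseteq> arcs (double_quiver n) \<and> length es = d}"
  proof -
    have "walk n es u v \<Longrightarrow> set es \<subseteq> arcs (double_quiver n)" for es
      by (induction es arbitrary: u) auto
    then show ?thesis
      by (auto simp: walks_def)
  qed
qed (simp add: finite_lists_length_eq)

section \<open>The path algebra is a ring\<close>

lemma path_algebra_simps [simp]:
  "\<one>\<^bsub>path_algebra n\<^esub> = (\<lambda>(u, es). if u < n \<and> es = [] then 1 else 0)"
  "\<zero>\<^bsub>path_algebra n\<^esub> = (\<lambda>_. 0)"
  "x \<oplus>\<^bsub>path_algebra n\<^esub> y = (\<lambda>p. x p + y p)"
  "c \<odot>\<^bsub>path_algebra n\<^esub> x = (\<lambda>p. c * x p)"
  by (simp_all add: path_algebra_def)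

lemma path_algebra_carrier:
  "x \<in> carrier (path_algebra n) \<longleftrightarrow> finite {p. x p \<noteq> 0} \<and> (\<forall>p. x p \<noteq> 0 \<longrightarrow> p \<in> paths n)"
  by (auto simp: path_algebra_def)

lemma path_algebra_support: "x \<in> carrier (path_algebra n) \<Longrightarrow> x p \<noteq> 0 \<Longrightarrow> p \<in> paths n"
  by (metis path_algebra_carrier)

lemma path_algebraI:
  "finite S \<Longrightarrow> (\<And>p. x p \<noteq> 0 \<Longrightarrow> p \<in> S) \<Longrightarrow> (\<And>p. x p \<noteq> 0 \<Longrightarrow> p \<in> paths n) \<Longrightarrow>
    x \<in> carrier (path_algebra n)"
proof -
  assume S: "finite S" "\<And>p. x p \<noteq> 0 \<Longrightarrow> p \<in> S" and "\<And>p. x p \<noteq> 0 \<Longrightarrow> p \<in> paths n"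
  moreover have "finite {p. x p \<noteq> 0}"
    by (rule finite_subset[OF _ S(1)], rule subsetI, rule S(2), erule CollectD)
  ultimately show ?thesis
    by (metis path_algebra_carrier)
qed

lemma path_algebra_mult:
  "(x \<otimes>\<^bsub>path_algebra n\<^esub> y) (u, es) =
    (\<Sum>k\<le>length es. x (walk_end u (take k es), drop k es) * y (u, take k es))"
  by (simp add: path_algebra_def path_end_eq)

lemma coordinates_path_algebra:
  "coordinates (path_algebra n :: ('f::field, 'f palg) module) (carrier (path_algebra n)) (\<lambda>x. x)"
proof
  fix x y :: "'f palg" and c :: 'f
  assume x: "x \<in> carrier (path_algebra n)"
  show "(\<lambda>p. c * x p) \<in> carrier (path_algebra n)"
  proof (rule path_algebraI)
    show "finite {p. x p \<noteq> 0}"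
      using x by (simp add: path_algebra_carrier)
    fix p assume "c * x p \<noteq> 0"
    then have p: "x p \<noteq> 0" by simp
    then show "p \<in> {p. x p \<noteq> 0}" by simp
    show "p \<in> paths n"
      using x p by (rule path_algebra_support)
  qed
  assume y: "y \<in> carrier (path_algebra n)"
  show "(\<lambda>p. x p + y p) \<in> carrier (path_algebra n)"
  proof (rule path_algebraI)
    show "finite ({p. x p \<noteq> 0} \<union> {p. y p \<noteq> 0})"
      using x y by (simp add: path_algebra_carrier)
    fix p assume "x p + y p \<noteq> 0"
    then have p: "x p \<noteq> 0 \<or> y p \<noteq> 0" by auto
    then show "p \<in> {p. x p \<noteq> 0} \<union> {p. y p \<noteq> 0}" by simp
    show "p \<in> paths n"
      using p path_algebra_support[OF x] path_algebra_support[OF y] by (elim disjE)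
  qed
qed (simp_all add: path_algebra_carrier)

lemma path_algebra_mult_closed:
  assumes x: "x \<in> carrier (path_algebra n)" and y: "y \<in> carrier (path_algebra n)"
  shows "x \<otimes>\<^bsub>path_algebra n\<^esub> y \<in> carrier (path_algebra n)"
proof -
  have *: "\<exists>k\<le>length es. x (walk_end u (take k es), drop k es) \<noteq> 0 \<and> y (u, take k es) \<noteq> 0"
    if "(x \<otimes>\<^bsub>path_algebra n\<^esub> y) (u, es) \<noteq> 0" for u es
  proof (rule ccontr)
    assume "\<not> ?thesis"
    then have "(x \<otimes>\<^bsub>path_algebra n\<^esub> y) (u, es) = 0"
      unfolding path_algebra_mult by (intro sum.neutral) auto
    with that show False by simp
  qed
  \<comment> \<open>A path in the support of the product is a concatenation of paths from the two
    supports.\<close>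
  let ?S = "(\<lambda>((v, es'), (u, es)). (u, es @ es')) ` ({p. x p \<noteq> 0} \<times> {p. y p \<noteq> 0})"
  show ?thesis
  proof (rule path_algebraI)
    show "finite ?S"
      using x y by (simp add: path_algebra_carrier)
    fix p :: path assume "(x \<otimes>\<^bsub>path_algebra n\<^esub> y) p \<noteq> 0"
    then obtain u es k where p: "p = (u, es)"
      and k: "x (walk_end u (take k es), drop k es) \<noteq> 0" "y (u, take k es) \<noteq> 0"
      using * by (cases p) blast
    show "p \<in> ?S"
      by (rule image_eqI[of _ _ "((walk_end u (take k es), drop k es), (u, take k es))"])
        (simp_all add: p k)
    have "(u, take k es @ drop k es) \<in> paths n"
      unfolding paths_append
      using path_algebra_support[OF x k(1)] path_algebra_support[OF y k(2)] by simp
    then show "p \<in> paths n"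
      by (simp add: p)
  qed
qed

text \<open>Both sides sum over the ways of cutting the path into three consecutive pieces; the
  first is evaluated by \<open>z\<close>, the second by \<open>y\<close>, the third by
  \<open>x\<close>. The pairs (i, j) of the first two lengths fill a triangle, which is summed along
  rows or along diagonals.\<close>

lemma path_algebra_assoc:
  fixes x y z :: "'f::field palg"
  shows "x \<otimes>\<^bsub>path_algebra n\<^esub> y \<otimes>\<^bsub>path_algebra n\<^esub> z = x \<otimes>\<^bsub>path_algebra n\<^esub> (y \<otimes>\<^bsub>path_algebra n\<^esub> z)"
proof (rule ext, clarify)
  fix u es
  define f :: "nat \<Rightarrow> nat \<Rightarrow> 'f" where "f i j =
    x (walk_end u (take (i + j) es), drop (i + j) es) *
    y (walk_end u (take i es), take j (drop i es)) * z (u, take i es)" for i j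
  let ?d = "length es"
  have "(x \<otimes>\<^bsub>path_algebra n\<^esub> y \<otimes>\<^bsub>path_algebra n\<^esub> z) (u, es) = (\<Sum>i\<le>?d. \<Sum>j\<le>?d-i. f i j)"
    unfolding path_algebra_mult sum_distrib_right
    by (intro sum.cong) (auto simp: f_def take_add add.commute)
  also have "\<dots> = (\<Sum>(i, j)\<in>(SIGMA i:{..?d}. {..?d - i}). f i j)"
    by (rule sum.Sigma) auto
  also have "(SIGMA i:{..?d}. {..?d - i}) = {(i, j). i + j \<le> ?d}"
    by auto
  also have "(\<Sum>(i, j)\<in>{(i, j). i + j \<le> ?d}. f i j) = (\<Sum>k\<le>?d. \<Sum>i\<le>k. f i (k - i))"
    by (rule sum.triangle_reindex_eq)
  also have "\<dots> = (x \<otimes>\<^bsub>path_algebra n\<^esub> (y \<otimes>\<^bsub>path_algebra n\<^esub> z)) (u, es)"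
    unfolding path_algebra_mult sum_distrib_left
    by (intro sum.cong) (auto simp: f_def drop_take mult.assoc min_absorb1)
  finally show "(x \<otimes>\<^bsub>path_algebra n\<^esub> y \<otimes>\<^bsub>path_algebra n\<^esub> z) (u, es) = (x \<otimes>\<^bsub>path_algebra n\<^esub> (y \<otimes>\<^bsub>path_algebra n\<^esub> z)) (u, es)" .
qed

lemma ring_path_algebra: "ring (path_algebra n :: ('f::field, 'f palg) module)"
proof (rule ringI)
  interpret coordinates "path_algebra n :: ('f, 'f palg) module" "carrier (path_algebra n)" "\<lambda>x. x"
    by (rule coordinates_path_algebra)
  show "abelian_group (path_algebra n :: ('f, 'f palg) module)"
    by (rule abelian_group)
  show "Group.monoid (path_algebra n :: ('f, 'f palg) module)"
  proof (rule monoidI)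
    show "\<one>\<^bsub>path_algebra n\<^esub> \<in> carrier (path_algebra n :: ('f, 'f palg) module)"
      by (rule path_algebraI[of "(\<lambda>u. (u, [])) ` {..<n}"]) (auto simp: paths_iff split: if_splits)
  next
    fix x :: "'f palg" assume x: "x \<in> carrier (path_algebra n)"
    show "\<one>\<^bsub>path_algebra n\<^esub> \<otimes>\<^bsub>path_algebra n\<^esub> x = x"
    proof (rule ext, clarify)
      fix u es
      have "(\<one>\<^bsub>path_algebra n\<^esub> \<otimes>\<^bsub>path_algebra n\<^esub> x) (u, es)
          = (\<Sum>k\<le>length es. if k = length es then (if walk_end u es < n then x (u, es) else 0) else 0)"
        unfolding path_algebra_mult by (rule sum.cong) auto
      moreover have "x (u, es) = 0" if "\<not> walk_end u es < n"
        using path_algebra_support[OF x, of "(u, es)"] that walk_end_less[of n es u]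
        unfolding paths_iff by metis
      ultimately show "(\<one>\<^bsub>path_algebra n\<^esub> \<otimes>\<^bsub>path_algebra n\<^esub> x) (u, es) = x (u, es)"
        by auto
    qed
    show "x \<otimes>\<^bsub>path_algebra n\<^esub> \<one>\<^bsub>path_algebra n\<^esub> = x"
    proof (rule ext, clarify)
      fix u es
      have "(x \<otimes>\<^bsub>path_algebra n\<^esub> \<one>\<^bsub>path_algebra n\<^esub>) (u, es)
          = (\<Sum>k\<le>length es. if k = 0 then (if u < n then x (u, es) else 0) else 0)"
        unfolding path_algebra_mult by (rule sum.cong) auto
      moreover have "x (u, es) = 0" if "\<not> u < n"
        using path_algebra_support[OF x, of "(u, es)"] that walk_start_less[of n es u]
        unfolding paths_iff by metis
      ultimately show "(x \<otimes>\<^bsub>path_algebra n\<^esub> \<one>\<^bsub>path_algebra n\<^esub>) (u, es) = x (u, es)"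
        by auto
    qed
  qed (simp_all only: path_algebra_mult_closed path_algebra_assoc)
qed (auto intro!: ext simp: path_algebra_mult algebra_simps sum.distrib)

section \<open>Coefficients with respect to the two ends and the length of a path\<close>

definition coef :: "nat \<Rightarrow> 'f::field palg \<Rightarrow> nat \<times> nat \<times> nat \<Rightarrow> 'f" where
  "coef n x = (\<lambda>(u, v, d). \<Sum>es\<in>walks n u v d. x (u, es))"

lemma coef_add: "coef n (\<lambda>p. x p + y p) \<tau> = coef n x \<tau> + coef n y \<tau>"
  by (simp add: coef_def sum.distrib split: prod.split)

lemma coef_smult: "coef n (\<lambda>p. c * x p) \<tau> = c * coef n x \<tau>"
  by (simp add: coef_def sum_distrib_left split: prod.split)

lemma coef_zero: "coef n (\<lambda>p. 0) \<tau> = 0"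
  by (simp add: coef_def split: prod.split)

text \<open>Cutting after e steps is a bijection between walks from u to w of length d and triples
  of a middle vertex v, a final part and an initial part. Thus multiplication becomes convolution on
  triples.\<close>

lemma coef_mult:
  "coef n (x \<otimes>\<^bsub>path_algebra n\<^esub> y) (u, w, d) =
    (\<Sum>e\<le>d. \<Sum>v<n. coef n x (v, w, d - e) * coef n y (u, v, e))"
proof -
  have "coef n (x \<otimes>\<^bsub>path_algebra n\<^esub> y) (u, w, d) =
      (\<Sum>es\<in>walks n u w d. \<Sum>k\<le>d. x (walk_end u (take k es), drop k es) * y (u, take k es))"
    by (simp add: coef_def path_algebra_mult walks_def)
  also have "\<dots> = (\<Sum>k\<le>d. \<Sum>es\<in>walks n u w d. x (walk_end u (take k es), drop k es) * y (u, take k es))"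
    by (rule sum.swap)
  also have "\<dots> = (\<Sum>k\<le>d. \<Sum>v<n. coef n x (v, w, d - k) * coef n y (u, v, k))"
  proof (rule sum.cong)
    fix k assume "k \<in> {..d}"
    then have k: "k \<le> d" by simp
    have "(\<Sum>v<n. coef n x (v, w, d - k) * coef n y (u, v, k)) =
        (\<Sum>v<n. \<Sum>(es2, es1)\<in>walks n v w (d - k) \<times> walks n u v k. x (v, es2) * y (u, es1))"
      by (simp add: coef_def sum_product sum.cartesian_product)
    also have "\<dots> = (\<Sum>(v, es2, es1)\<in>(SIGMA v:{..<n}. walks n v w (d - k) \<times> walks n u v k). x (v, es2) * y (u, es1))"
      by (subst sum.Sigma) (auto simp: case_prod_unfold)
    also have "\<dots> = (\<Sum>es\<in>walks n u w d. x (walk_end u (take k es), drop k es) * y (u, take k es))"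
    proof (rule sum.reindex_bij_witness[where
          i = "\<lambda>es. (walk_end u (take k es), drop k es, take k es)" and j = "\<lambda>(v, es2, es1). es1 @ es2"], goal_cases)
      case (1 a)
      obtain v es2 es1 where a: "a = (v, es2, es1)" by (cases a)
      with 1 have "walk n es1 u v" "length es1 = k"
        by (auto simp: walks_def)
      then show ?case
        using walk_end_walk[of n es1 u v] by (simp add: a)
    next
      case (2 a)
      obtain v es2 es1 where a: "a = (v, es2, es1)" by (cases a)
      with 2 have "walk n es1 u v" "length es1 = k" "walk n es2 v w" "length es2 = d - k"
        by (auto simp: walks_def)
      then show ?case
        using walk_end_walk[of n es1 u v] k by (simp add: a walks_def walk_append)
    next
      case (3 es)
      show ?case by (simp only: prod.case append_take_drop_id)
    next
      case (4 es)
      then have "walk n (take k es @ drop k es) u w" and len: "length es = d"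
        by (auto simp: walks_def)
      then have "walk n (take k es) u (walk_end u (take k es))" "walk n (drop k es) (walk_end u (take k es)) w"
        unfolding walk_append by simp_all
      then show ?case
        using k len walk_end_less[of n "take k es"] by (simp add: walks_def)
    next
      case (5 a)
      obtain v es2 es1 where a: "a = (v, es2, es1)" by (cases a)
      with 5 have "walk n es1 u v" "length es1 = k"
        by (auto simp: walks_def)
      then show ?case
        using walk_end_walk[of n es1 u v] by (simp add: a)
    qed
    finally show "(\<Sum>es\<in>walks n u w d. x (walk_end u (take k es), drop k es) * y (u, take k es)) =
        (\<Sum>v<n. coef n x (v, w, d - k) * coef n y (u, v, k))" ..
  qed simp
  finally show ?thesis .
qed

lemma path_elt_closed [simp]: "path_elt p \<in> carrier (path_algebra n) \<longleftrightarrow> p \<in> paths n"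
proof
  show "path_elt p \<in> carrier (path_algebra n) \<Longrightarrow> p \<in> paths n"
    by (erule path_algebra_support) (simp add: path_elt_def)
  show "p \<in> paths n \<Longrightarrow> path_elt p \<in> carrier (path_algebra n)"
    by (rule path_algebraI[of "{p}"]) (simp_all add: path_elt_def split: if_splits)
qed

lemma coef_path_elt:
  assumes "walk n es u v"
  shows "coef n (path_elt (u, es)) \<tau> = (if \<tau> = (u, v, length es) then 1 else 0)"
proof -
  have "(\<Sum>es'\<in>walks n u' v' d. path_elt (u, es) (u', es')) = (if (u', v', d) = (u, v, length es) then 1 else 0)"
    for u' v' d
  proof -
    have "(\<Sum>es'\<in>walks n u' v' d. path_elt (u, es) (u', es')) =
        (\<Sum>es'\<in>walks n u' v' d. if es' = es then (if u' = u then 1 else 0) else 0)"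
      by (rule sum.cong) (auto simp: path_elt_def)
    also have "\<dots> = (if es \<in> walks n u' v' d then (if u' = u then 1 else 0) else 0)"
      by (rule sum.delta) simp
    also have "\<dots> = (if (u', v', d) = (u, v, length es) then 1 else 0)"
      using assms walk_end_walk[of n es u] by (auto simp: walks_def)
    finally show ?thesis .
  qed
  then show ?thesis
    unfolding coef_def by (cases \<tau>) (simp only: prod.case)
qed

section \<open>Linear spans in the path algebra\<close>

lemma submodule_path_algebraI:
  fixes U :: "'f::field palg set"
  assumes "U \<subseteq> carrier (path_algebra n)" "(\<lambda>_. 0) \<in> U"
    and "\<And>x y. x \<in> U \<Longrightarrow> y \<in> U \<Longrightarrow> (\<lambda>p. x p + y p) \<in> U"
    and "\<And>c x. x \<in> U \<Longrightarrow> (\<lambda>p. c * x p) \<in> U"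
  shows "submodule class_ring U (path_algebra n)"
  using assms coordinates.module[OF coordinates_path_algebra]
  by (intro submodule.intro) simp_all

lemma pspan_least:
  assumes "S \<subseteq> U" "submodule class_ring U (path_algebra n)"
  shows "pspan n S \<subseteq> U"
  unfolding pspan_def
  by (rule module.span_is_subset[OF coordinates.module[OF coordinates_path_algebra] assms])

lemma pspan_superset:
  assumes "S \<subseteq> carrier (path_algebra n)"
  shows "S \<subseteq> pspan n S"
  unfolding pspan_def
  by (rule module.in_own_span[OF coordinates.module[OF coordinates_path_algebra] assms])

lemma submodule_pspan:
  assumes "S \<subseteq> carrier (path_algebra n)"
  shows "submodule class_ring (pspan n S) (path_algebra n)"
  unfolding pspan_def
  by (rule module.span_is_submodule[OF coordinates.module[OF coordinates_path_algebra] assms])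

lemma submodule_sum:
  fixes x :: "'i \<Rightarrow> 'f::field palg"
  assumes "submodule class_ring U (path_algebra n)" "\<And>i. i \<in> I \<Longrightarrow> x i \<in> U"
  shows "(\<lambda>p. \<Sum>i\<in>I. c i * x i p) \<in> U"
proof -
  have "(\<lambda>p. c i * x i p) \<in> U" if "i \<in> I" for i
    using submodule.smult_closed[OF assms(1), of "c i" "x i"] assms(2)[OF that] by simp
  then show ?thesis
  proof (induction I rule: infinite_finite_induct)
    case (insert i I)
    then show ?case
      using submodule.m_closed[OF assms(1), of "\<lambda>p. c i * x i p" "\<lambda>p. \<Sum>i\<in>I. c i * x i p"] by simp
  qed (use submodule.zero_closed[OF assms(1)] in simp_all)
qed

lemma submodule_carrier: "submodule class_ring (carrier (path_algebra n)) (path_algebra n :: ('f::field, 'f palg) module)"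
proof -
  interpret coordinates "path_algebra n :: ('f, 'f palg) module" "carrier (path_algebra n)" "\<lambda>x. x"
    by (rule coordinates_path_algebra)
  show ?thesis
    by (intro submodule_path_algebraI) (simp_all add: zero_mem add_mem smult_mem)
qed

text \<open>Coefficients are indexed by \<open>I\<close> and not by vectors, so \<open>g\<close> may
  repeat values.\<close>

lemma pspan_family:
  fixes g :: "'i \<Rightarrow> 'f::field palg"
  assumes fin: "finite I" and g: "\<And>i. i \<in> I \<Longrightarrow> g i \<in> carrier (path_algebra n)"
  shows "pspan n (g ` I) = range (\<lambda>c p. \<Sum>i\<in>I. c i * g i p)" (is "_ = ?R")
proof
  show "pspan n (g ` I) \<subseteq> ?R"
  proof (rule pspan_least)
    show "g ` I \<subseteq> ?R"
    proof (rule image_subsetI)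
      fix i assume i: "i \<in> I"
      have "g i p = (\<Sum>j\<in>I. (if j = i then 1 else 0) * g j p)" for p
      proof -
        have "(\<Sum>j\<in>I. (if j = i then 1 else 0) * g j p) = (\<Sum>j\<in>I. if j = i then g j p else 0)"
          by (rule sum.cong) simp_all
        then show ?thesis
          using i fin by simp
      qed
      then show "g i \<in> ?R"
        by (intro image_eqI[of _ _ "\<lambda>j. if j = i then 1 else 0"] ext) simp_all
    qed
    show "submodule class_ring ?R (path_algebra n)"
    proof (rule submodule_path_algebraI)
      show "?R \<subseteq> carrier (path_algebra n)"
        using submodule_sum[OF submodule_carrier g] by (intro image_subsetI) simp
      show "(\<lambda>_. 0) \<in> ?R"
        by (rule image_eqI[of _ _ "\<lambda>_. 0"]) simp_all
    next
      fix x y assume "x \<in> ?R" "y \<in> ?R"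
      then obtain c c' where "x = (\<lambda>p. \<Sum>i\<in>I. c i * g i p)" "y = (\<lambda>p. \<Sum>i\<in>I. c' i * g i p)"
        by (elim imageE)
      then show "(\<lambda>p. x p + y p) \<in> ?R"
        by (intro image_eqI[of _ _ "\<lambda>i. c i + c' i"]) (simp_all add: algebra_simps sum.distrib)
    next
      fix c x assume "x \<in> ?R"
      then obtain c' where "x = (\<lambda>p. \<Sum>i\<in>I. c' i * g i p)"
        by (elim imageE)
      then show "(\<lambda>p. c * x p) \<in> ?R"
        by (intro image_eqI[of _ _ "\<lambda>i. c * c' i"]) (simp_all add: algebra_simps sum_distrib_left)
    qed
  qed
  have S: "g ` I \<subseteq> carrier (path_algebra n)"
    using g by (rule image_subsetI)
  show "?R \<subseteq> pspan n (g ` I)"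
    using submodule_sum[OF submodule_pspan[OF S], of I g] pspan_superset[OF S]
    by (intro image_subsetI) (simp add: subset_iff)
qed

section \<open>The relation ideal\<close>

lemma path_elt_mult:
  "path_elt (v, es') \<otimes>\<^bsub>path_algebra n\<^esub> path_elt (u, es) =
    (if walk_end u es = v then path_elt (u, es @ es') else (\<lambda>_. 0 :: 'f::field))"
proof (rule ext, clarify)
  fix w fs
  have eq: "take k fs = es \<and> drop k fs = es' \<longleftrightarrow> k = length es \<and> fs = es @ es'" if "k \<le> length fs" for k
    using that append_take_drop_id[of k fs] by auto
  have "(path_elt (v, es') \<otimes>\<^bsub>path_algebra n\<^esub> path_elt (u, es)) (w, fs) =
      (\<Sum>k\<le>length fs. if k = length es then (if w = u \<and> fs = es @ es' \<and> walk_end u es = v then 1 else 0 :: 'f) else 0)"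
    unfolding path_algebra_mult
  proof (rule sum.cong)
    fix k assume "k \<in> {..length fs}"
    then have "k \<le> length fs" by simp
    from eq[OF this] show "path_elt (v, es') (walk_end w (take k fs), drop k fs) * path_elt (u, es) (w, take k fs)
        = (if k = length es then (if w = u \<and> fs = es @ es' \<and> walk_end u es = v then 1 else 0 :: 'f) else 0)"
      by (simp only: path_elt_def prod.inject) (smt (verit) mult_not_zero mult_cancel_left1)
  qed simp
  then show "(path_elt (v, es') \<otimes>\<^bsub>path_algebra n\<^esub> path_elt (u, es)) (w, fs) =
      (if walk_end u es = v then path_elt (u, es @ es') else (\<lambda>_. 0 :: 'f)) (w, fs)"
    by (auto simp: path_elt_def)
qed

text \<open>The three cases of the definition become one formula in which a term is dropped when its
  path would leave the quiver. Arrows are listed as traversed, so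
  \<open>[Down (i - 1), Up (i - 1)]\<close> is a_{i-1} a_{i-1}^*.\<close>

lemma sigma_eq:
  assumes "n \<ge> 2" "i < n"
  shows "sigma n i =
    (\<lambda>p. (if i = 0 then 0 else path_elt (i, [Down (i - 1), Up (i - 1)]) p)
       - (if i = n - 1 then 0 else path_elt (i, [Up i, Down i]) p) :: 'f::field)"
proof -
  interpret coordinates "path_algebra n :: ('f, 'f palg) module" "carrier (path_algebra n)" "\<lambda>x. x"
    by (rule coordinates_path_algebra)
  have "path_elt (i, [Up i, Down i]) \<in> carrier (path_algebra n :: ('f, 'f palg) module)" if "i \<noteq> n - 1"
    using assms that by (simp add: paths_iff)
  moreover have "path_elt (i, [Down (i - 1), Up (i - 1)]) \<in> carrier (path_algebra n :: ('f, 'f palg) module)"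
    if "i \<noteq> 0"
    using assms that by (simp add: paths_iff)
  moreover have "Suc (n - Suc (Suc 0)) = n - Suc 0"
    using assms by simp
  ultimately show ?thesis
    using assms
    by (auto simp: sigma_def Let_def arrow_elt_def path_elt_mult a_inv_eq a_minus_eq numeral_2_eq_2)
qed

lemma sigma_closed:
  assumes "n \<ge> 2" "i < n"
  shows "sigma n i \<in> carrier (path_algebra n :: ('f::field, 'f palg) module)"
proof -
  let ?C = "carrier (path_algebra n :: ('f, 'f palg) module)"
  interpret coordinates "path_algebra n :: ('f, 'f palg) module" ?C "\<lambda>x. x"
    by (rule coordinates_path_algebra)
  have "(\<lambda>p. if i = n - 1 then 0 else path_elt (i, [Up i, Down i]) p) \<in> ?C"
    using assms zero_mem by (cases "i = n - 1") (simp_all add: paths_iff)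
  moreover have "(\<lambda>p. if i = 0 then 0 else path_elt (i, [Down (i - 1), Up (i - 1)]) p) \<in> ?C"
    using assms zero_mem by (cases "i = 0") (simp_all add: paths_iff)
  ultimately show ?thesis
    unfolding sigma_eq[OF assms] using minus_mem by blast
qed

lemma relation_space_closed: "n \<ge> 2 \<Longrightarrow> relation_space n \<subseteq> carrier (path_algebra n)"
  unfolding relation_space_def
  by (rule pspan_least[OF _ submodule_carrier]) (auto intro: sigma_closed)

lemma ideal_relation_ideal: "n \<ge> 2 \<Longrightarrow> ideal (relation_ideal n) (path_algebra n)"
  unfolding relation_ideal_def by (intro ring.genideal_ideal ring_path_algebra relation_space_closed)

lemma sigma_mem_relation_ideal:
  assumes "n \<ge> 2" "i < n"
  shows "sigma n i \<in> relation_ideal n"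
proof -
  have "sigma n i \<in> relation_space n"
    unfolding relation_space_def using assms
    by (intro subsetD[OF pspan_superset] image_eqI) (auto intro: sigma_closed)
  then show ?thesis
    unfolding relation_ideal_def
    using ring.genideal_self[OF ring_path_algebra relation_space_closed[OF assms(1)]] by blast
qed

text \<open>The monomials of length \<open>d\<close> from \<open>u\<close> to \<open>v\<close> that do not vanish in the preprojective
  algebra: writing \<open>d = \<bar>u - v\<bar> + 2 l\<close>, the conditions say \<open>l \<le> min u v\<close> and
  \<open>max u v + l \<le> n - 1\<close>.\<close>

definition admissible :: "nat \<Rightarrow> nat \<times> nat \<times> nat \<Rightarrow> bool" where
  "admissible n = (\<lambda>(u, v, d).
    u \<le> v + d \<and> v \<le> u + d \<and> even (u + v + d) \<and> d \<le> u + v \<and> u + v + d \<le> 2 * (n - 1))"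

lemma walk_parity: "walk n es u v \<Longrightarrow> u \<le> v + length es \<and> v \<le> u + length es \<and> even (u + v + length es)"
proof (induction es arbitrary: u)
  case (Cons \<alpha> es)
  then have "arrow_head \<alpha> \<le> v + length es \<and> v \<le> arrow_head \<alpha> + length es \<and> even (arrow_head \<alpha> + v + length es)"
    and "arrow_tail \<alpha> = u"
    by simp_all
  then show ?case
    by (cases \<alpha>) (simp_all, presburger+)
qed simp

text \<open>Step towards v as long as u differs from v; at v itself, step aside to any neighbour,
  which exists because n >= 2. Parity guarantees that there is time to return.\<close>

lemma walks_nonempty:
  assumes "u < n" "v < n" "n \<ge> 2" "u \<le> v + d" "v \<le> u + d" "even (u + v + d)"
  shows "walks n u v d \<noteq> {}"
  using assms
proof (induction d arbitrary: u)
  case 0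
  then have "[] \<in> walks n u v 0" by (simp add: walks_def)
  then show ?case by blast
next
  case (Suc d)
  consider "u < v \<or> u = v \<and> u < n - 1" | "u > v \<or> u = v \<and> u > 0"
    using Suc.prems by linarith
  then show ?case
  proof cases
    case 1
    have "walks n (u + 1) v d \<noteq> {}"
      by (rule Suc.IH) (use Suc.prems 1 in \<open>auto elim: oddE evenE\<close>)
    then obtain es where "es \<in> walks n (u + 1) v d" by blast
    then have "Up u # es \<in> walks n u v (Suc d)"
      using 1 Suc.prems by (auto simp: walks_def)
    then show ?thesis by blast
  next
    case 2
    have "walks n (u - 1) v d \<noteq> {}"
      by (rule Suc.IH) (use Suc.prems 2 in \<open>auto elim: oddE evenE\<close>)
    then obtain es where "es \<in> walks n (u - 1) v d" by blast
    then have "Down (u - 1) # es \<in> walks n u v (Suc d)"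
      using 2 Suc.prems by (auto simp: walks_def)
    then show ?thesis by blast
  qed
qed

lemma admissible_less:
  assumes "admissible n (u, v, d)" "n \<ge> 1"
  shows "u < n" "v < n"
  using assms by (auto simp: admissible_def)

text \<open>If e + f <= u + w and w <= v + f, then e <= u + v, and similarly for the other bounds: a
  part that is long enough to reach an end of the quiver makes the whole walk long enough. This is
  why the inadmissible monomials absorb products.\<close>

lemma admissible_factor:
  assumes "admissible n (u, w, d)" "e \<le> d" "es \<in> walks n u v e" "es' \<in> walks n v w (d - e)"
  shows "admissible n (u, v, e)" "admissible n (v, w, d - e)"
proof -
  obtain f where d: "d = e + f"
    using assms(2) le_Suc_ex by blast
  have "u \<le> v + e \<and> v \<le> u + e \<and> even (u + v + e)" "v \<le> w + f \<and> w \<le> v + f \<and> even (v + w + f)"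
    using walk_parity[of n es u v] walk_parity[of n es' v w] assms(3,4) by (simp_all add: walks_def d)
  moreover have "e + f \<le> u + w \<and> u + w + (e + f) \<le> 2 * (n - 1)"
    using assms(1) by (simp add: admissible_def d)
  ultimately show "admissible n (u, v, e)" "admissible n (v, w, d - e)"
    by (simp_all add: admissible_def d)
qed

lemma coef_not_walk: "walks n u v d = {} \<Longrightarrow> coef n x (u, v, d) = 0"
  by (simp add: coef_def)

text \<open>An upper bound for the relation ideal. It is in fact equal to it; the other inclusion is
  contained in \<open>proj_eq_theta\<close>.\<close>

definition coef_kernel :: "nat \<Rightarrow> 'f::field palg set" where
  "coef_kernel n = {x \<in> carrier (path_algebra n). \<forall>\<tau>. admissible n \<tau> \<longrightarrow> coef n x \<tau> = 0}"

text \<open>In the convolution a term contributes only if both parts are realised by walks, and then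
  both have admissible parameters, so the factor in the kernel contributes zero.\<close>

lemma coef_kernel_mult:
  assumes "(\<forall>\<tau>. admissible n \<tau> \<longrightarrow> coef n x \<tau> = 0) \<or> (\<forall>\<tau>. admissible n \<tau> \<longrightarrow> coef n y \<tau> = 0)"
    and \<tau>: "admissible n \<tau>"
  shows "coef n (x \<otimes>\<^bsub>path_algebra n\<^esub> y) \<tau> = 0"
proof -
  obtain u w d where \<tau>': "\<tau> = (u, w, d)" by (cases \<tau>)
  have "coef n x (v, w, d - e) * coef n y (u, v, e) = 0" if "e \<le> d" for v e
  proof (cases "walks n u v e = {} \<or> walks n v w (d - e) = {}")
    case True
    then show ?thesis by (auto simp: coef_not_walk)
  next
    case False
    then obtain es es' where "es \<in> walks n u v e" "es' \<in> walks n v w (d - e)" by blast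
    from admissible_factor[OF _ that this] \<tau> assms(1) show ?thesis
      unfolding \<tau>' by (metis mult_eq_0_iff)
  qed
  then show ?thesis
    unfolding \<tau>' coef_mult by (intro sum.neutral ballI) simp
qed

lemma submodule_coef_kernel: "submodule class_ring (coef_kernel n) (path_algebra n)"
proof (rule submodule_path_algebraI)
  interpret coordinates "path_algebra n :: ('f::field, 'f palg) module" "carrier (path_algebra n)" "\<lambda>x. x"
    by (rule coordinates_path_algebra)
  show "coef_kernel n \<subseteq> carrier (path_algebra n :: ('f, 'f palg) module)"
    by (auto simp: coef_kernel_def)
  show "(\<lambda>_. 0) \<in> (coef_kernel n :: 'f palg set)"
    unfolding coef_kernel_def using zero_mem by (simp add: coef_zero)
  show "(\<lambda>p. x p + y p) \<in> coef_kernel n" if "x \<in> coef_kernel n" "y \<in> coef_kernel n" for x y :: "'f palg"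
    using that unfolding coef_kernel_def by (simp add: coef_add add_mem)
  show "(\<lambda>p. c * x p) \<in> coef_kernel n" if "x \<in> coef_kernel n" for c and x :: "'f palg"
    using that unfolding coef_kernel_def by (simp add: coef_smult smult_mem)
qed

lemma ideal_coef_kernel: "ideal (coef_kernel n) (path_algebra n :: ('f::field, 'f palg) module)"
proof (rule idealI)
  interpret coordinates "path_algebra n :: ('f::field, 'f palg) module" "carrier (path_algebra n)" "\<lambda>x. x"
    by (rule coordinates_path_algebra)
  interpret K: submodule class_ring "coef_kernel n" "path_algebra n :: ('f, 'f palg) module"
    by (rule submodule_coef_kernel)
  show "subgroup (coef_kernel n) (add_monoid (path_algebra n :: ('f, 'f palg) module))"
  proof (rule subgroup.intro)
    fix x :: "'f palg" assume x: "x \<in> coef_kernel n"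
    have "(\<lambda>p. - x p) \<in> coef_kernel n"
      using K.smult_closed[of "-1" x] x by simp
    then show "inv\<^bsub>add_monoid (path_algebra n)\<^esub> x \<in> coef_kernel n"
      using a_inv_eq[of x] x unfolding a_inv_def by (simp add: coef_kernel_def)
  qed (use K.subset K.m_closed K.zero_closed in auto)
  fix a x :: "'f palg" assume a: "a \<in> coef_kernel n" and x: "x \<in> carrier (path_algebra n)"
  show "x \<otimes>\<^bsub>path_algebra n\<^esub> a \<in> coef_kernel n" "a \<otimes>\<^bsub>path_algebra n\<^esub> x \<in> coef_kernel n"
    using a x coef_kernel_mult[of n x a] coef_kernel_mult[of n a x]
    by (simp_all add: coef_kernel_def path_algebra_mult_closed)
qed (rule ring_path_algebra)

text \<open>At an interior vertex both terms have the parameters (i, i, 2) and cancel; at the two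
  ends of the quiver (i, i, 2) is not admissible.\<close>

lemma coef_sigma:
  assumes "n \<ge> 2" "i < n" "admissible n \<tau>"
  shows "coef n (sigma n i) \<tau> = (0 :: 'f::field)"
proof -
  have diff: "coef n (\<lambda>p. x p - y p) \<tau> = coef n x \<tau> - coef n y \<tau>" for x y :: "'f palg"
    using coef_add[of n x "\<lambda>p. -1 * y p" \<tau>] coef_smult[of n "-1" y \<tau>] by simp
  have "coef n (\<lambda>p. if i = 0 then 0 else path_elt (i, [Down (i - 1), Up (i - 1)]) p) \<tau> =
      (if i \<noteq> 0 \<and> \<tau> = (i, i, 2) then 1 else 0 :: 'f)"
    using assms coef_path_elt[of n "[Down (i - 1), Up (i - 1)]" i i \<tau>, where ?'a = 'f]
    by (cases "i = 0") (simp_all add: coef_zero numeral_2_eq_2)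
  moreover have "coef n (\<lambda>p. if i = n - 1 then 0 else path_elt (i, [Up i, Down i]) p) \<tau> =
      (if i \<noteq> n - 1 \<and> \<tau> = (i, i, 2) then 1 else 0 :: 'f)"
    using assms coef_path_elt[of n "[Up i, Down i]" i i \<tau>, where ?'a = 'f]
    by (cases "i = n - 1") (simp_all add: coef_zero numeral_2_eq_2)
  moreover have "i \<noteq> 0 \<and> i \<noteq> n - 1" if "\<tau> = (i, i, 2)"
    using that assms by (auto simp: admissible_def)
  ultimately show ?thesis
    unfolding sigma_eq[OF assms(1,2)] diff by auto
qed

lemma relation_ideal_subset:
  assumes "n \<ge> 2"
  shows "relation_ideal n \<subseteq> (coef_kernel n :: 'f::field palg set)"
  unfolding relation_ideal_def
proof (rule ring.genideal_minimal[OF ring_path_algebra ideal_coef_kernel])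
  show "relation_space n \<subseteq> (coef_kernel n :: 'f palg set)"
    unfolding relation_space_def
    by (rule pspan_least[OF _ submodule_coef_kernel])
      (use assms in \<open>auto simp: coef_kernel_def sigma_closed coef_sigma\<close>)
qed

section \<open>The preprojective algebra\<close>

lemma preproj_quotient:
  assumes n: "n \<ge> 2"
  shows "coordinates (preproj n :: ('f::field, 'f palg set) module) (carrier (path_algebra n)) (proj n)"
    and "x \<in> carrier (path_algebra n) \<Longrightarrow>
      proj n x = \<zero>\<^bsub>preproj n\<^esub> \<longleftrightarrow> x \<in> (relation_ideal n :: 'f palg set)"
proof -
  let ?P = "path_algebra n :: ('f, 'f palg) module" and ?I = "relation_ideal n :: 'f palg set"
  interpret coordinates ?P "carrier ?P" "\<lambda>x. x"
    by (rule coordinates_path_algebra)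
  interpret I: ideal ?I ?P
    by (rule ideal_relation_ideal[OF n])
  \<comment> \<open>A ring ideal is closed under scalars because c x = (c 1) x.\<close>
  have smult: "(\<lambda>p. c * x p) \<in> ?I" if x: "x \<in> ?I" for c x
  proof -
    have xP: "x \<in> carrier ?P"
      by (rule subsetD[OF I.a_subset x])
    have "(\<lambda>p. c * \<one>\<^bsub>?P\<^esub> p) \<otimes>\<^bsub>?P\<^esub> x \<in> ?I"
      using x I.one_closed smult_mem by (intro I.I_l_closed)
    moreover have "(\<lambda>p. c * \<one>\<^bsub>?P\<^esub> p) \<otimes>\<^bsub>?P\<^esub> x = (\<lambda>p. c * (\<one>\<^bsub>?P\<^esub> \<otimes>\<^bsub>?P\<^esub> x) p)"
      by (rule ext, clarify) (simp only: path_algebra_mult sum_distrib_left mult.assoc)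
    ultimately show ?thesis
      by (simp only: I.l_one[OF xP])
  qed
  have add: "(\<lambda>p. x p + y p) \<in> ?I" if "x \<in> ?I" "y \<in> ?I" for x y
    using additive_subgroup.a_closed[OF I.additive_subgroup_axioms that] by simp
  have N: "?I = (\<lambda>x. x) ` {x \<in> carrier ?P. x \<in> ?I}"
    by (simp add: Collect_conj_eq Int_absorb1[OF I.a_subset])
  have zero: "(\<lambda>_. 0) \<in> ?I"
    using additive_subgroup.zero_closed[OF I.additive_subgroup_axioms] by simp
  show "coordinates (preproj n) (carrier ?P) (proj n)"
    unfolding preproj_def proj_def
    by (rule quotient(1)[where Q = "\<lambda>x. x \<in> ?I", OF _ _ _ N]) (simp_all add: zero add smult)
  show "x \<in> carrier ?P \<Longrightarrow> proj n x = \<zero>\<^bsub>preproj n\<^esub> \<longleftrightarrow> x \<in> ?I"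
    unfolding preproj_def proj_def
    by (rule quotient(2)[where Q = "\<lambda>x. x \<in> ?I", OF _ _ _ N]) (simp_all add: zero add smult)
qed

lemma proj_mult:
  assumes "n \<ge> 2" "x \<in> carrier (path_algebra n)" "y \<in> carrier (path_algebra n)"
  shows "proj n x \<otimes>\<^bsub>preproj n\<^esub> proj n y = proj n (x \<otimes>\<^bsub>path_algebra n\<^esub> y)"
  using ideal.rcoset_mult_add[OF ideal_relation_ideal assms(2,3)] assms(1)
  by (simp add: preproj_def quotient_def FactRing_def proj_def)

lemma proj_one: "\<one>\<^bsub>preproj n\<^esub> = proj n \<one>\<^bsub>path_algebra n\<^esub>"
  by (simp add: preproj_def quotient_def FactRing_def proj_def)

lemma proj_eq_iff:
  assumes n: "n \<ge> 2" and "x \<in> carrier (path_algebra n)" "y \<in> carrier (path_algebra n)"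
  shows "proj n x = proj n y \<longleftrightarrow> (\<lambda>p. x p - y p) \<in> relation_ideal n"
  using assms coordinates.mk_eq_iff[OF preproj_quotient(1)[OF n] assms(2,3)]
    preproj_quotient(2)[OF n coordinates.minus_mem[OF preproj_quotient(1)[OF n] assms(2,3)]]
  by simp

section \<open>Rerouting walks modulo the relations\<close>

text \<open>The arrow traversed first is the rightmost factor.\<close>

lemma proj_Cons:
  assumes "n \<ge> 2" "\<alpha> \<in> arcs (double_quiver n)" "walk n es (arrow_head \<alpha>) v"
  shows "proj n (path_elt (arrow_tail \<alpha>, \<alpha> # es)) =
    (proj n (path_elt (arrow_head \<alpha>, es)) \<otimes>\<^bsub>preproj n\<^esub> proj n (arrow_elt \<alpha>) :: 'f::field palg set)"
proof -
  have "(arrow_head \<alpha>, es) \<in> paths n"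
    using assms(3) walk_end_walk[OF assms(3)] by (simp add: paths_iff)
  moreover have "(arrow_tail \<alpha>, [\<alpha>]) \<in> paths n"
    using assms(2) arrow_ends_less[OF assms(2)] by (simp add: paths_iff)
  ultimately show ?thesis
    by (simp add: proj_mult assms(1) arrow_elt_def path_elt_mult)
qed

text \<open>This is the product of the walk w with sigma_u: a turn on the left of u may be traded
  for a turn on the right before w is followed. At an end of the quiver one side is missing, and the
  walk with the remaining turn lies in the ideal.\<close>

lemma walk_sigma_mem:
  assumes n: "n \<ge> 2" and w: "walk n w u v"
  shows "(\<lambda>p. (if u = 0 then 0 else path_elt (u, Down (u - 1) # Up (u - 1) # w) p)
      - (if u = n - 1 then 0 else path_elt (u, Up u # Down u # w) p)) \<in> (relation_ideal n :: 'f::field palg set)"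
proof -
  have u: "u < n" using w by (rule walk_start_less)
  have wP: "(u, w) \<in> paths n"
    using w walk_end_walk[OF w] by (simp add: paths_iff)
  have diff: "x \<otimes>\<^bsub>path_algebra n\<^esub> (\<lambda>p. y p - z p) =
      (\<lambda>p. (x \<otimes>\<^bsub>path_algebra n\<^esub> y) p - (x \<otimes>\<^bsub>path_algebra n\<^esub> z) p)" for x y z :: "'f palg"
    by (rule ext, clarify) (simp only: path_algebra_mult right_diff_distrib sum_subtractf)
  have 0: "x \<otimes>\<^bsub>path_algebra n\<^esub> (\<lambda>p. 0) = (\<lambda>p. 0 :: 'f)" for x
    by (rule ext, clarify) (simp add: path_algebra_mult)
  have "path_elt (u, w) \<otimes>\<^bsub>path_algebra n\<^esub> sigma n u \<in> (relation_ideal n :: 'f palg set)"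
    by (intro ideal.I_l_closed[OF ideal_relation_ideal[OF n] sigma_mem_relation_ideal[OF n u]]) (simp add: wP)
  also have "path_elt (u, w) \<otimes>\<^bsub>path_algebra n\<^esub> sigma n u =
     (\<lambda>p. (if u = 0 then 0 else path_elt (u, Down (u - 1) # Up (u - 1) # w) p)
      - (if u = n - 1 then 0 else path_elt (u, Up u # Down u # w) p) :: 'f)"
    unfolding sigma_eq[OF n u] diff
    using u n by (cases "u = 0"; cases "u = n - 1") (simp_all add: 0 path_elt_mult Suc_diff_Suc)
  finally show ?thesis .
qed

text \<open>Induction on the length. Equal first arrows reduce to the tails; unequal ones are Up and
  Down at an interior vertex, and there \<open>walk_sigma_mem\<close> links a walk of either kind to
  one of the other.\<close>

lemma proj_walk_cong:
  assumes n: "n \<ge> 2" and "es \<in> walks n u v d" "es' \<in> walks n u v d"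
  shows "proj n (path_elt (u, es)) = (proj n (path_elt (u, es')) :: 'f::field palg set)"
  using assms(2,3)
proof (induction d arbitrary: u es es')
  case 0
  then show ?case by (simp add: walks_def)
next
  case (Suc d)
  from Suc.prems obtain \<alpha> fs \<beta> fs' where es: "es = \<alpha> # fs" "es' = \<beta> # fs'"
    by (auto simp: walks_def length_Suc_conv)
  have \<alpha>: "\<alpha> \<in> arcs (double_quiver n)" "arrow_tail \<alpha> = u" "fs \<in> walks n (arrow_head \<alpha>) v d"
    and \<beta>: "\<beta> \<in> arcs (double_quiver n)" "arrow_tail \<beta> = u" "fs' \<in> walks n (arrow_head \<beta>) v d"
    using Suc.prems by (simp_all add: walks_def es)
  have cons: "proj n (path_elt (u, \<gamma> # gs)) = (proj n (path_elt (u, \<gamma> # gs')) :: 'f palg set)"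
    if "\<gamma> \<in> arcs (double_quiver n)" "arrow_tail \<gamma> = u"
      "gs \<in> walks n (arrow_head \<gamma>) v d" "gs' \<in> walks n (arrow_head \<gamma>) v d" for \<gamma> gs gs'
    using Suc.IH[OF that(3,4)] that proj_Cons[OF n that(1), of gs v, where ?'f = 'f]
      proj_Cons[OF n that(1), of gs' v, where ?'f = 'f]
    by (simp add: walks_def)
  text \<open>If the first steps differ, then both walks can be replaced by ones that return to \<open>u\<close> after
    two steps and agree from there on.\<close>
  have turn: "proj n (path_elt (u, Up u # gs)) = (proj n (path_elt (u, Down (u - 1) # gs')) :: 'f palg set)"
    if u: "0 < u" "u < n - 1" and gs: "gs \<in> walks n (u + 1) v d" "gs' \<in> walks n (u - 1) v d" for gs gs'
  proof -
    have gs_walk: "walk n gs (u + 1) v" "walk n gs' (u - 1) v" "length gs = d" "length gs' = d"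
      using gs by (simp_all add: walks_def)
    have par: "u + 1 \<le> v + d" "v + 1 \<le> u + d" "even (u + 1 + v + d)"
      using walk_parity[OF gs_walk(1)] walk_parity[OF gs_walk(2)] u(1)
      unfolding gs_walk(3,4) by linarith+
    \<comment> \<open>Both neighbours of u reach v in d steps, so d > 0 and v is at distance at most
      d - 1 from u. A two-step turn at u leaves d - 1 of the d + 1 steps.\<close>
    define e where "e = d - 1"
    have e: "d = Suc e"
      using par(1,2) unfolding e_def by linarith
    have "walks n u v e \<noteq> {}"
    proof (rule walks_nonempty)
      show "v < n" by (rule walk_end_less[OF gs_walk(1)])
      show "u \<le> v + e" "v \<le> u + e" "even (u + v + e)"
        using par unfolding e by simp_all
    qed (use u n in simp_all)
    then obtain w where w: "w \<in> walks n u v e" by (auto simp only: ex_in_conv[symmetric])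
    have "proj n (path_elt (u, Up u # gs)) = (proj n (path_elt (u, Up u # Down u # w)) :: 'f palg set)"
      by (rule cons) (use u w gs e in \<open>simp_all add: walks_def\<close>)
    also have "\<dots> = proj n (path_elt (u, Down (u - 1) # Up (u - 1) # w))"
    proof (rule proj_eq_iff[THEN iffD2, symmetric])
      have "walk n w u v" using w by (simp add: walks_def)
      from walk_sigma_mem[OF n this] u show "(\<lambda>p. path_elt (u, Down (u - 1) # Up (u - 1) # w) p
          - path_elt (u, Up u # Down u # w) p) \<in> (relation_ideal n :: 'f palg set)" by simp
      show "path_elt (u, Down (u - 1) # Up (u - 1) # w) \<in> carrier (path_algebra n :: ('f, 'f palg) module)"
        "path_elt (u, Up u # Down u # w) \<in> carrier (path_algebra n :: ('f, 'f palg) module)"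
        using \<open>walk n w u v\<close> walk_end_walk[OF \<open>walk n w u v\<close>] u by (simp_all add: paths_iff)
    qed (rule n)
    also have "\<dots> = proj n (path_elt (u, Down (u - 1) # gs'))"
      by (rule cons) (use u w gs e in \<open>simp_all add: walks_def\<close>)
    finally show ?thesis .
  qed
  show ?case
  proof (cases "\<alpha> = \<beta>")
    case True
    show ?thesis
      unfolding es True using \<beta>(1,2) \<alpha>(3)[unfolded True] \<beta>(3) by (rule cons)
  next
    case False
    then consider "\<alpha> = Up u" "\<beta> = Down (u - 1)" "u > 0" | "\<beta> = Up u" "\<alpha> = Down (u - 1)" "u > 0"
      using \<alpha>(2) \<beta>(2) by (cases \<alpha>; cases \<beta>) auto
    then show ?thesis
    proof cases
      case 1
      have "proj n (path_elt (u, Up u # fs)) = (proj n (path_elt (u, Down (u - 1) # fs')) :: 'f palg set)"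
        by (rule turn) (use 1 \<alpha> \<beta> in simp_all)
      then show ?thesis
        by (simp only: es 1)
    next
      case 2
      have "proj n (path_elt (u, Up u # fs')) = (proj n (path_elt (u, Down (u - 1) # fs)) :: 'f palg set)"
        by (rule turn) (use 2 \<alpha> \<beta> in simp_all)
      then show ?thesis
        by (simp only: es 2)
    qed
  qed
qed

text \<open>By congruence it suffices to find, for each inadmissible triple, one vanishing walk with
  these parameters.\<close>

lemma proj_walk_zero:
  assumes n: "n \<ge> 2" and "es \<in> walks n u v d" "\<not> admissible n (u, v, d)"
  shows "proj n (path_elt (u, es)) = (proj n (\<lambda>_. 0) :: 'f::field palg set)"
proof -
  have closed: "path_elt (u, es) \<in> carrier (path_algebra n :: ('f, 'f palg) module)"
    if "walk n es u v" for u es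
    using that walk_end_walk[OF that] by (simp add: paths_iff)
  interpret A: coordinates "preproj n :: ('f, 'f palg set) module" "carrier (path_algebra n)" "proj n"
    by (rule preproj_quotient[OF n])
  \<comment> \<open>Vanishing propagates backwards along an arrow: prefixing a vanishing walk by
    \<open>\<alpha>\<close> gives zero, and every walk with the same parameters is congruent to the
    result.\<close>
  have step: "proj n (path_elt (u, es)) = (proj n (\<lambda>_. 0) :: 'f palg set)"
    if es: "es \<in> walks n u v (Suc d)" and \<alpha>: "\<alpha> \<in> arcs (double_quiver n)" "arrow_tail \<alpha> = u"
      and fs: "fs \<in> walks n (arrow_head \<alpha>) v d"
      and 0: "proj n (path_elt (arrow_head \<alpha>, fs)) = (proj n (\<lambda>_. 0) :: 'f palg set)" for u es d \<alpha> fs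
  proof -
    have "\<alpha> # fs \<in> walks n u v (Suc d)"
      using \<alpha> fs by (simp add: walks_def)
    then have "proj n (path_elt (u, es)) = (proj n (path_elt (u, \<alpha> # fs)) :: 'f palg set)"
      by (rule proj_walk_cong[OF n es])
    also have "\<dots> = proj n (\<lambda>_. 0) \<otimes>\<^bsub>preproj n\<^esub> proj n (arrow_elt \<alpha>)"
      using proj_Cons[OF n \<alpha>(1), of fs v, where ?'f = 'f] fs 0 \<alpha>(2) by (simp add: walks_def)
    also have "\<dots> = proj n ((\<lambda>_. 0) \<otimes>\<^bsub>path_algebra n\<^esub> arrow_elt \<alpha>)"
      using \<alpha>(1) arrow_ends_less[OF \<alpha>(1)]
      by (intro proj_mult n A.zero_mem) (simp add: arrow_elt_def paths_iff)
    also have "(\<lambda>_. 0) \<otimes>\<^bsub>path_algebra n\<^esub> arrow_elt \<alpha> = (\<lambda>_. 0 :: 'f)"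
      by (rule ext, clarify) (simp add: path_algebra_mult)
    finally show ?thesis .
  qed
  \<comment> \<open>The inequality d > u + v is preserved when a step down decreases both u and d by
    one, so the start can be moved to the vertex 0.\<close>
  have low: "proj n (path_elt (u, es)) = (proj n (\<lambda>_. 0) :: 'f palg set)"
    if "es \<in> walks n u v d" "d > u + v" for u d es
    using that
  proof (induction u arbitrary: d es)
    case 0
    have es: "walk n es 0 v" "length es = d" using 0 by (simp_all add: walks_def)
    note par = walk_parity[OF es(1), unfolded es(2)]
    \<comment> \<open>Parity excludes d = v + 1, which leaves room for the turn \<open>Up 0\<close>,
      \<open>Down 0\<close>, a multiple of sigma_0.\<close>
    have d: "v + 2 \<le> d" "even (v + d)"
      using 0(2) par by presburger+
    define e where "e = d - 2"
    have e: "d = Suc (Suc e)" "v \<le> e" "even (v + e)"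
      using d unfolding e_def by presburger+
    have "walks n 0 v e \<noteq> {}"
      using e n walk_end_less[OF es(1)] by (intro walks_nonempty) simp_all
    then obtain w where "w \<in> walks n 0 v e" by blast
    then have w: "walk n w 0 v" "length w = e" by (simp_all add: walks_def)
    have "proj n (path_elt (0, es)) = (proj n (path_elt (0, Up 0 # Down 0 # w)) :: 'f palg set)"
      by (rule proj_walk_cong[OF n 0(1)]) (use w n e in \<open>simp add: walks_def\<close>)
    also have "\<dots> = proj n (\<lambda>_. 0)"
    proof (rule proj_eq_iff[THEN iffD2, symmetric])
      show "(\<lambda>p. 0 - path_elt (0, Up 0 # Down 0 # w) p) \<in> (relation_ideal n :: 'f palg set)"
        using walk_sigma_mem[OF n w(1)] n by simp
      show "path_elt (0, Up 0 # Down 0 # w) \<in> carrier (path_algebra n :: ('f, 'f palg) module)"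
        by (rule closed) (use w n in simp)
    qed (use n A.zero_mem in auto)
    finally show ?case .
  next
    case (Suc u)
    have es: "walk n es (Suc u) v" "length es = d" using Suc.prems by (simp_all add: walks_def)
    note par = walk_parity[OF es(1), unfolded es(2)] and less = walk_start_less[OF es(1)] walk_end_less[OF es(1)]
    from Suc.prems obtain e where e: "d = Suc e" by (cases d) auto
    have "walks n u v e \<noteq> {}"
    proof (rule walks_nonempty)
      show "u \<le> v + e" "v \<le> u + e"
        using Suc.prems(2) par unfolding e by linarith+
      show "even (u + v + e)"
        using par unfolding e by simp
    qed (use less n in simp_all)
    then obtain fs where fs: "fs \<in> walks n u v e" by blast
    show ?case
    proof (rule step[of es "Suc u" e "Down u" fs])
      show "proj n (path_elt (arrow_head (Down u), fs)) = (proj n (\<lambda>_. 0) :: 'f palg set)"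
        using Suc.IH[OF fs] Suc.prems(2) unfolding e by simp
    qed (use Suc.prems(1) fs less in \<open>simp_all add: e\<close>)
  qed
  \<comment> \<open>The mirror image: a step up preserves u + v + d and decreases the distance to
    the end n - 1, where sigma_{n-1} provides the vanishing turn.\<close>
  have high: "proj n (path_elt (u, es)) = (proj n (\<lambda>_. 0) :: 'f palg set)"
    if "es \<in> walks n u v d" "u + v + d > 2 * (n - 1)" for u d es
    using that
  proof (induction "n - 1 - u" arbitrary: u d es)
    case 0
    have es: "walk n es u v" "length es = d" using 0 by (simp_all add: walks_def)
    note par = walk_parity[OF es(1), unfolded es(2)] and less = walk_start_less[OF es(1)] walk_end_less[OF es(1)]
    have u: "u = n - 1" using 0 less by simp
    then have u1: "Suc (u - Suc 0) = u" "u - 1 < n - 1" using n by simp_all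
    have "u < v + d" "v \<le> u" "even (u + v + d)"
      using 0(3) par less(2) unfolding u by linarith+
    then have d: "u + 2 \<le> v + d" "v \<le> u" "2 \<le> d" "even (u + v + d)"
      by presburger+
    define e where "e = d - 2"
    have e: "d = Suc (Suc e)" "u \<le> v + e" "even (u + v + e)" "v \<le> u + e"
      using d unfolding e_def by presburger+
    have "walks n u v e \<noteq> {}"
      using e n less by (intro walks_nonempty)
    then obtain w where "w \<in> walks n u v e" by blast
    then have w: "walk n w u v" "length w = e" by (simp_all add: walks_def)
    have "proj n (path_elt (u, es)) = (proj n (path_elt (u, Down (u - 1) # Up (u - 1) # w)) :: 'f palg set)"
      by (rule proj_walk_cong[OF n 0(2)]) (use w n e u1 in \<open>simp add: walks_def\<close>)
    also have "\<dots> = proj n (\<lambda>_. 0)"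
    proof (rule proj_eq_iff[THEN iffD2])
      show "(\<lambda>p. path_elt (u, Down (u - 1) # Up (u - 1) # w) p - 0) \<in> (relation_ideal n :: 'f palg set)"
        using walk_sigma_mem[OF n w(1)] n u by simp
      show "path_elt (u, Down (u - 1) # Up (u - 1) # w) \<in> carrier (path_algebra n :: ('f, 'f palg) module)"
        by (rule closed) (use w u1 in simp)
    qed (use n A.zero_mem in auto)
    finally show ?case .
  next
    case (Suc k)
    have es: "walk n es u v" "length es = d" using Suc.prems by (simp_all add: walks_def)
    note par = walk_parity[OF es(1), unfolded es(2)] and less = walk_start_less[OF es(1)] walk_end_less[OF es(1)]
    have "d > 0" using Suc.hyps(2) Suc.prems(2) par by linarith
    then obtain e where e: "d = Suc e" by (cases d) auto
    have "walks n (u + 1) v e \<noteq> {}"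
    proof (rule walks_nonempty)
      show "u + 1 \<le> v + e" "v \<le> u + 1 + e"
        using Suc.prems(2) Suc.hyps(2) par less unfolding e by linarith+
      show "even (u + 1 + v + e)"
        using par unfolding e by simp
    qed (use less n Suc.hyps(2) in simp_all)
    then obtain fs where fs: "fs \<in> walks n (u + 1) v e" by blast
    show ?case
    proof (rule step[of es u e "Up u" fs])
      show "proj n (path_elt (arrow_head (Up u), fs)) = (proj n (\<lambda>_. 0) :: 'f palg set)"
        using Suc.hyps(1)[OF _ fs] Suc.hyps(2) Suc.prems(2) unfolding e by simp
    qed (use Suc.prems(1) Suc.hyps(2) fs less in \<open>simp_all add: e\<close>)
  qed
  have "walk n es u v" "length es = d" using assms(2) by (simp_all add: walks_def)
  then have "u \<le> v + d \<and> v \<le> u + d \<and> even (u + v + d)"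
    using walk_parity[of n es u v] by simp
  \<comment> \<open>The distance and parity conditions hold for every walk, so inadmissibility must
    come from one of the two length bounds.\<close>
  then consider "d > u + v" | "u + v + d > 2 * (n - 1)"
    using assms(3) unfolding admissible_def prod.case by linarith
  then show ?thesis
  proof cases
    case 1
    then show ?thesis by (rule low[OF assms(2)])
  next
    case 2
    then show ?thesis by (rule high[OF assms(2)])
  qed
qed

text \<open>All paths from \<open>u\<close> to \<open>v\<close> of length \<open>d\<close> are congruent modulo the relations, so that an arbitrary
  choice of one of them represents the monomial with the parameters \<open>(u, v, d)\<close>.\<close>

definition canon :: "nat \<Rightarrow> (nat \<times> nat \<times> nat \<Rightarrow> 'f) \<Rightarrow> 'f::field palg" where
  "canon n Z = (\<lambda>(u, es).
    if admissible n (u, walk_end u es, length es)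
      \<and> es = (SOME es'. es' \<in> walks n u (walk_end u es) (length es))
      \<and> (u, es) \<in> paths n
    then Z (u, walk_end u es, length es) else 0)"

text \<open>Only the values of \<open>Z\<close> at admissible triples matter, so all functions can
  serve as coordinates of the preprojective algebra.\<close>

definition theta :: "nat \<Rightarrow> (nat \<times> nat \<times> nat \<Rightarrow> 'f) \<Rightarrow> 'f::field palg set" where
  "theta n Z = proj n (canon n Z)"

lemma finite_admissible: "finite {\<tau>. admissible n \<tau>}"
proof (rule finite_subset)
  show "{\<tau>. admissible n \<tau>} \<subseteq> {..2 * n} \<times> {..2 * n} \<times> {..2 * n}"
  proof (rule subsetI)
    fix \<tau> assume "\<tau> \<in> {\<tau>. admissible n \<tau>}"
    moreover obtain u v d where "\<tau> = (u, v, d)" by (cases \<tau>)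
    ultimately show "\<tau> \<in> {..2 * n} \<times> {..2 * n} \<times> {..2 * n}"
      by (simp add: admissible_def) linarith
  qed
qed simp

lemma canon_closed: "canon n Z \<in> carrier (path_algebra n)"
proof (rule path_algebraI)
  show "finite ((\<lambda>(u, v, d). (u, SOME es. es \<in> walks n u v d)) ` {\<tau>. admissible n \<tau>})"
    by (rule finite_imageI[OF finite_admissible])
  fix p assume p: "canon n Z p \<noteq> 0"
  obtain u es where p_eq: "p = (u, es)" by (cases p)
  show "p \<in> paths n"
    using p unfolding p_eq canon_def by (simp split: if_splits)
  show "p \<in> (\<lambda>(u, v, d). (u, SOME es. es \<in> walks n u v d)) ` {\<tau>. admissible n \<tau>}"
    by (rule image_eqI[of _ _ "(u, walk_end u es, length es)"])
      (use p in \<open>simp_all add: p_eq canon_def split: if_splits\<close>)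
qed

lemma canon_add: "canon n (\<lambda>\<tau>. Z \<tau> + Z' \<tau>) = (\<lambda>p. canon n Z p + canon n Z' p)"
  by (rule ext) (simp add: canon_def split: prod.split)

lemma canon_smult: "canon n (\<lambda>\<tau>. c * Z \<tau>) = (\<lambda>p. c * canon n Z p)"
  by (rule ext) (simp add: canon_def split: prod.split)

lemma canon_zero: "canon n (\<lambda>_. 0) = (\<lambda>_. 0)"
  by (rule ext) (simp add: canon_def split: prod.split)

lemma canon_cong: "(\<And>\<tau>. admissible n \<tau> \<Longrightarrow> Z \<tau> = Z' \<tau>) \<Longrightarrow> canon n Z = canon n Z'"
  by (rule ext) (simp add: canon_def split: prod.split)

lemma admissible_some_walk:
  assumes "n \<ge> 2" "admissible n (u, v, d)"
  shows "(SOME es. es \<in> walks n u v d) \<in> walks n u v d"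
proof -
  have "walks n u v d \<noteq> {}"
    using assms admissible_less[OF assms(2)] by (intro walks_nonempty) (simp_all add: admissible_def)
  then show ?thesis
    by (simp add: some_in_eq)
qed

lemma canon_walk:
  assumes "es \<in> walks n u v d"
  shows "canon n Z (u, es) =
    (if admissible n (u, v, d) \<and> es = (SOME es'. es' \<in> walks n u v d) then Z (u, v, d) else 0)"
proof -
  have es: "walk n es u v" "length es = d"
    using assms by (simp_all add: walks_def)
  then have "walk_end u es = v" "(u, es) \<in> paths n"
    using walk_end_walk[OF es(1)] by (simp_all add: paths_iff)
  then show ?thesis
    by (simp only: canon_def prod.case es(2) simp_thms)
qed

lemma coef_canon:
  assumes n: "n \<ge> 2"
  shows "coef n (canon n Z) \<tau> = (if admissible n \<tau> then Z \<tau> else 0)"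
proof -
  obtain u v d where \<tau>: "\<tau> = (u, v, d)" by (cases \<tau>)
  let ?s = "SOME es. es \<in> walks n u v d"
  have "coef n (canon n Z) (u, v, d)
      = (\<Sum>es\<in>walks n u v d. if es = ?s then (if admissible n (u, v, d) then Z (u, v, d) else 0) else 0)"
    unfolding coef_def prod.case by (rule sum.cong) (simp_all add: canon_walk)
  also have "\<dots> = (if ?s \<in> walks n u v d then (if admissible n (u, v, d) then Z (u, v, d) else 0) else 0)"
    by (rule sum.delta) simp
  finally show ?thesis
    using admissible_some_walk[OF n, of u v d] unfolding \<tau> by simp
qed

lemma theta_cong: "(\<And>\<tau>. admissible n \<tau> \<Longrightarrow> Z \<tau> = Z' \<tau>) \<Longrightarrow> theta n Z = theta n Z'"
  unfolding theta_def by (simp only: canon_cong[of n Z Z'])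

lemma coef_diff: "coef n (\<lambda>p. x p - y p) \<tau> = coef n x \<tau> - coef n y \<tau>"
  by (simp add: coef_def sum_subtractf split: prod.split)

text \<open>Linear independence of the admissible monomials: a difference in the relation ideal has
  vanishing coefficients, and the coefficients of \<open>canon n Z\<close> give \<open>Z\<close>
  back.\<close>

lemma theta_eq_iff:
  assumes n: "n \<ge> 2"
  shows "theta n Z = theta n Z' \<longleftrightarrow> (\<forall>\<tau>. admissible n \<tau> \<longrightarrow> Z \<tau> = Z' \<tau>)"
proof
  assume "theta n Z = theta n Z'"
  then have "(\<lambda>p. canon n Z p - canon n Z' p) \<in> relation_ideal n"
    unfolding theta_def using proj_eq_iff[OF n canon_closed canon_closed] by metis
  then have "(\<lambda>p. canon n Z p - canon n Z' p) \<in> coef_kernel n"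
    by (rule subsetD[OF relation_ideal_subset[OF n]])
  then have *: "\<forall>\<tau>. admissible n \<tau> \<longrightarrow> coef n (\<lambda>p. canon n Z p - canon n Z' p) \<tau> = 0"
    unfolding coef_kernel_def mem_Collect_eq by (rule conjunct2)
  show "\<forall>\<tau>. admissible n \<tau> \<longrightarrow> Z \<tau> = Z' \<tau>"
  proof (intro allI impI)
    fix \<tau> assume \<tau>: "admissible n \<tau>"
    have "coef n (\<lambda>p. canon n Z p - canon n Z' p) \<tau> = 0"
      by (rule *[rule_format, OF \<tau>])
    then show "Z \<tau> = Z' \<tau>"
      unfolding coef_diff using \<tau> by (simp add: coef_canon[OF n])
  qed
next
  assume "\<forall>\<tau>. admissible n \<tau> \<longrightarrow> Z \<tau> = Z' \<tau>"
  then show "theta n Z = theta n Z'"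
    by (intro theta_cong) metis
qed

text \<open>Induction on the finite support, removing one path at a time.\<close>

lemma path_algebra_induct [consumes 1, case_names zero step]:
  assumes x: "x \<in> carrier (path_algebra n)"
    and zero: "Q (\<lambda>_. 0)"
    and step: "\<And>x p c. x \<in> carrier (path_algebra n) \<Longrightarrow> p \<in> paths n \<Longrightarrow> Q x \<Longrightarrow>
      Q (\<lambda>q. x q + c * path_elt p q)"
  shows "Q (x :: 'f::field palg)"
proof -
  have "Q x" if "finite S" "x \<in> carrier (path_algebra n)" "{p. x p \<noteq> 0} = S" for S and x :: "'f palg"
    using that
  proof (induction S arbitrary: x rule: finite_induct)
    case empty
    then have "x = (\<lambda>_. 0)"
      by (intro ext) (metis (mono_tags) empty_Collect_eq)
    then show ?case
      using zero by simp
  next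
    case (insert p S)
    have p: "x p \<noteq> 0"
      using insert.prems(2) by (metis (mono_tags) insertI1 mem_Collect_eq)
    have supp: "{q. (x(p := 0)) q \<noteq> 0} = S"
    proof (rule Set.set_eqI)
      fix q
      have "q \<in> insert p S \<longleftrightarrow> x q \<noteq> 0"
        using insert.prems(2) by (metis (mono_tags) mem_Collect_eq)
      then show "q \<in> {q. (x(p := 0)) q \<noteq> 0} \<longleftrightarrow> q \<in> S"
        using insert.hyps(2) by (cases "q = p") simp_all
    qed
    have closed: "x(p := 0) \<in> carrier (path_algebra n)"
    proof (rule path_algebraI[OF insert.hyps(1)])
      fix q assume q: "(x(p := 0)) q \<noteq> 0"
      then show "q \<in> S"
        using supp by (metis (mono_tags) mem_Collect_eq)
      from q have "x q \<noteq> 0" by (simp split: if_splits)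
      then show "q \<in> paths n"
        by (rule path_algebra_support[OF insert.prems(1)])
    qed
    have "Q (\<lambda>q. (x(p := 0)) q + x p * path_elt p q)"
      by (rule step[OF closed path_algebra_support[OF insert.prems(1) p] insert.IH[OF closed supp]])
    moreover have "(\<lambda>q. (x(p := 0)) q + x p * path_elt p q) = x"
      by (rule ext) (simp add: path_elt_def)
    ultimately show ?case by simp
  qed
  from this[OF _ x refl] show ?thesis
    using x by (simp add: path_algebra_carrier)
qed

text \<open>An admissible walk is congruent to the chosen walk with its parameters; an inadmissible
  one is zero, as is \<open>theta\<close> of a function supported at its triple.\<close>

lemma proj_path_elt:
  assumes n: "n \<ge> 2" and es: "walk n es u v"
  shows "proj n (path_elt (u, es)) =
    (theta n (\<lambda>\<tau>. if \<tau> = (u, v, length es) then 1 else 0) :: 'f::field palg set)"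
proof (cases "admissible n (u, v, length es)")
  case True
  let ?s = "SOME es'. es' \<in> walks n u v (length es)"
  have s: "?s \<in> walks n u v (length es)"
    by (rule admissible_some_walk[OF n True])
  then have s': "walk n ?s u v" "length ?s = length es"
    by (simp_all add: walks_def)
  have "canon n (\<lambda>\<tau>. if \<tau> = (u, v, length es) then 1 else 0) = (path_elt (u, ?s) :: 'f palg)"
  proof (rule ext, clarify)
    fix w fs
    show "canon n (\<lambda>\<tau>. if \<tau> = (u, v, length es) then 1 else 0) (w, fs) = (path_elt (u, ?s) (w, fs) :: 'f)"
    proof (cases "w = u \<and> fs = ?s")
      case True
      then show ?thesis
        using s \<open>admissible n (u, v, length es)\<close> by (simp add: canon_walk path_elt_def)
    next
      case ne: False
      have "canon n (\<lambda>\<tau>. if \<tau> = (u, v, length es) then 1 else 0) (w, fs) = (0 :: 'f)"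
      proof (cases "(w, walk_end w fs, length fs) = (u, v, length es)")
        case True
        note eq = True[unfolded prod.inject]
        note w = eq[THEN conjunct1]
        note eqs = w eq[THEN conjunct2, THEN conjunct1, unfolded w] eq[THEN conjunct2, THEN conjunct2]
        from ne eqs(1) have "fs \<noteq> ?s" by simp
        then show ?thesis
          by (simp only: canon_def prod.case eqs simp_thms if_False)
      next
        case False
        show ?thesis
          by (simp only: canon_def prod.case False if_False if_cancel)
      qed
      moreover have "path_elt (u, ?s) (w, fs) = (0 :: 'f)"
        using ne by (simp add: path_elt_def)
      ultimately show ?thesis by simp
    qed
  qed
  then show ?thesis
    unfolding theta_def using proj_walk_cong[OF n _ s, of es] es by (simp add: walks_def)
next
  case False
  have "canon n (\<lambda>\<tau>. if \<tau> = (u, v, length es) then 1 else 0) = (canon n (\<lambda>_. 0) :: 'f palg)"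
  proof (rule canon_cong)
    fix \<tau> assume "admissible n \<tau>"
    with False have "\<tau> \<noteq> (u, v, length es)" by metis
    then show "(if \<tau> = (u, v, length es) then 1 else 0) = (0 :: 'f)" by simp
  qed
  then show ?thesis
    unfolding theta_def using proj_walk_zero[OF n _ False, of es] es by (simp add: walks_def canon_zero)
qed

text \<open>The spanning half of the monomial basis, with explicit coefficients: \<open>coef\<close>
  computes the normal form. Together with \<open>theta_eq_iff\<close> it identifies A with the
  functions on admissible triples.\<close>

lemma proj_eq_theta:
  assumes n: "n \<ge> 2" and x: "x \<in> carrier (path_algebra n)"
  shows "proj n x = (theta n (coef n x) :: 'f::field palg set)"
  using x
proof (induction rule: path_algebra_induct)
  interpret A: coordinates "preproj n :: ('f, 'f palg set) module" "carrier (path_algebra n)" "proj n"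
    by (rule preproj_quotient[OF n])
  case zero
  have "coef n (\<lambda>_. 0) = (\<lambda>_. 0 :: 'f)"
    by (rule ext) (simp add: coef_zero)
  then show ?case
    by (simp add: theta_def canon_zero)
  case (step x p c)
  obtain u es where p: "p = (u, es)" by (cases p)
  have es: "walk n es u (walk_end u es)"
    using step(2) by (simp add: p paths_iff)
  have pc: "path_elt p \<in> carrier (path_algebra n :: ('f, 'f palg) module)"
    using step(2) by simp
  have "proj n (path_elt p) = (theta n (coef n (path_elt p)) :: 'f palg set)"
    unfolding p proj_path_elt[OF n es] by (intro theta_cong) (simp add: coef_path_elt[OF es])
  then have "proj n (\<lambda>q. x q + c * path_elt p q) =
      proj n (canon n (coef n x)) \<oplus>\<^bsub>preproj n\<^esub> (c \<odot>\<^bsub>preproj n\<^esub> proj n (canon n (coef n (path_elt p))))"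
    using step(1,3) pc A.smult_mem[OF pc] A.add_eq[OF step(1) A.smult_mem[OF pc], of c] A.smult_eq[OF pc, of c]
    by (simp add: theta_def)
  also have "\<dots> = proj n (\<lambda>q. canon n (coef n x) q + c * canon n (coef n (path_elt p)) q)"
    by (simp add: A.add_eq A.smult_eq A.smult_mem canon_closed)
  also have "(\<lambda>q. canon n (coef n x) q + c * canon n (coef n (path_elt p)) q) =
      canon n (\<lambda>\<tau>. coef n x \<tau> + c * coef n (path_elt p) \<tau>)"
    by (simp add: canon_add canon_smult)
  also have "(\<lambda>\<tau>. coef n x \<tau> + c * coef n (path_elt p) \<tau>) = coef n (\<lambda>q. x q + c * path_elt p q)"
    by (rule ext) (simp add: coef_add coef_smult)
  finally show ?case
    by (simp add: theta_def)
qed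

lemma coordinates_theta:
  assumes n: "n \<ge> 2"
  shows "coordinates (preproj n :: ('f::field, 'f palg set) module) UNIV (theta n)"
proof -
  interpret A: coordinates "preproj n :: ('f, 'f palg set) module" "carrier (path_algebra n)" "proj n"
    by (rule preproj_quotient[OF n])
  show ?thesis
  proof
  show "carrier (preproj n :: ('f, 'f palg set) module) = range (theta n)"
  proof
    show "carrier (preproj n :: ('f, 'f palg set) module) \<subseteq> range (theta n)"
      unfolding A.carrier_eq by (rule image_subsetI) (simp add: proj_eq_theta[OF n])
    show "range (theta n) \<subseteq> carrier (preproj n :: ('f, 'f palg set) module)"
      by (rule image_subsetI) (simp add: theta_def A.mk_closed canon_closed)
  qed
  show "\<zero>\<^bsub>preproj n\<^esub> = (theta n (\<lambda>_. 0) :: 'f palg set)"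
    by (simp add: A.zero_eq theta_def canon_zero)
qed (simp_all add: theta_def A.add_eq A.smult_eq canon_closed canon_add canon_smult)
qed

section \<open>Products in the preprojective algebra\<close>

text \<open>The factors are masked explicitly because \<open>theta\<close> is blind to inadmissible
  values of \<open>Z\<close> and \<open>Z'\<close>, whereas an unmasked convolution would mix them
  into admissible ones.\<close>

lemma theta_mult:
  assumes n: "n \<ge> 2"
  shows "theta n Z \<otimes>\<^bsub>preproj n\<^esub> theta n Z' = (theta n (\<lambda>(u, w, d). \<Sum>e\<le>d. \<Sum>v<n.
    (if admissible n (v, w, d - e) then Z (v, w, d - e) else 0) *
    (if admissible n (u, v, e) then Z' (u, v, e) else 0)) :: 'f::field palg set)"
proof -
  have "theta n Z \<otimes>\<^bsub>preproj n\<^esub> theta n Z' =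
      theta n (coef n (canon n Z \<otimes>\<^bsub>path_algebra n\<^esub> canon n Z'))"
    unfolding theta_def[of n Z] theta_def[of n Z'] proj_mult[OF n canon_closed canon_closed]
    by (rule proj_eq_theta[OF n path_algebra_mult_closed[OF canon_closed canon_closed]])
  moreover have "coef n (canon n Z \<otimes>\<^bsub>path_algebra n\<^esub> canon n Z') = (\<lambda>(u, w, d). \<Sum>e\<le>d. \<Sum>v<n.
      (if admissible n (v, w, d - e) then Z (v, w, d - e) else 0) *
      (if admissible n (u, v, e) then Z' (u, v, e) else 0))"
    by (rule ext, clarify) (simp only: coef_mult coef_canon[OF n] prod.case)
  ultimately show ?thesis by simp
qed

lemma sum_single_pair:
  fixes f :: "'b::comm_monoid_add" and e0 v0 d n :: nat
  shows "(\<Sum>e\<le>d. \<Sum>v<n. if e = e0 \<and> v = v0 then f else 0) = (if e0 \<le> d \<and> v0 < n then f else 0)"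
proof -
  have "(\<Sum>e\<le>d. \<Sum>v<n. if e = e0 \<and> v = v0 then f else 0) =
      (\<Sum>e\<le>d. if e = e0 then (if v0 < n then f else 0) else 0)"
  proof (rule sum.cong)
    fix e
    show "(\<Sum>v<n. if e = e0 \<and> v = v0 then f else 0) = (if e = e0 then (if v0 < n then f else 0) else 0)"
      by (cases "e = e0") simp_all
  qed simp
  then show ?thesis by simp
qed

text \<open>The left factor is traversed last, so it takes up the last f steps and fixes the end;
  only one cut survives in the convolution.\<close>

lemma theta_mono_mult:
  assumes n: "n \<ge> 2"
  shows "theta n (\<lambda>\<tau>. if \<tau> = (v0, w0, f) then 1 else 0) \<otimes>\<^bsub>preproj n\<^esub> theta n Z =
    (theta n (\<lambda>(u, w, d). if w = w0 \<and> f \<le> d \<and> admissible n (v0, w0, f) \<and> admissible n (u, v0, d - f)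
      then Z (u, v0, d - f) else 0) :: 'f::field palg set)"
  unfolding theta_mult[OF n]
proof (rule theta_cong)
  fix \<tau> assume "admissible n \<tau>"
  obtain u w d where \<tau>: "\<tau> = (u, w, d)" by (cases \<tau>)
  let ?f = "if w = w0 \<and> f \<le> d \<and> admissible n (v0, w0, f) \<and> admissible n (u, v0, d - f)
      then Z (u, v0, d - f) else 0"
  have "(\<Sum>e\<le>d. \<Sum>v<n.
    (if admissible n (v, w, d - e) then if (v, w, d - e) = (v0, w0, f) then 1 else 0 else 0) *
    (if admissible n (u, v, e) then Z (u, v, e) else 0)) =
    (\<Sum>e\<le>d. \<Sum>v<n. if e = d - f \<and> v = v0 then ?f else 0)"
  proof (intro sum.cong refl)
    fix e v assume "e \<in> {..d}"
    then have e: "e \<le> d" by simp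
    show "(if admissible n (v, w, d - e) then if (v, w, d - e) = (v0, w0, f) then 1 else 0 else 0) *
      (if admissible n (u, v, e) then Z (u, v, e) else 0) = (if e = d - f \<and> v = v0 then ?f else 0)"
    proof (cases "(v, w, d - e) = (v0, w0, f)")
      case True
      then have "v = v0" "w = w0" "e = d - f" "f \<le> d" using e by auto
      then show ?thesis by simp
    next
      case False
      \<comment> \<open>With truncated subtraction, e = d - f does not imply f <= d, which therefore
        has to be carried along.\<close>
      then have "\<not> (e = d - f \<and> v = v0 \<and> w = w0 \<and> f \<le> d)" using e by auto
      then show ?thesis
        by (simp only: False if_False if_cancel mult_zero_left) (simp; metis)
    qed
  qed
  also have "\<dots> = ?f"
    unfolding sum_single_pair using admissible_less[of n v0 w0 f] n by simp
  finally show "(\<lambda>(u, w, d). \<Sum>e\<le>d. \<Sum>v<n.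
    (if admissible n (v, w, d - e) then if (v, w, d - e) = (v0, w0, f) then 1 else 0 else 0) *
    (if admissible n (u, v, e) then Z (u, v, e) else 0)) \<tau> =
    (\<lambda>(u, w, d). if w = w0 \<and> f \<le> d \<and> admissible n (v0, w0, f) \<and> admissible n (u, v0, d - f)
      then Z (u, v0, d - f) else 0) \<tau>"
    unfolding \<tau> prod.case .
qed

lemma theta_mult_mono:
  assumes n: "n \<ge> 2"
  shows "theta n Z \<otimes>\<^bsub>preproj n\<^esub> theta n (\<lambda>\<tau>. if \<tau> = (u0, v0, f) then 1 else 0) =
    (theta n (\<lambda>(u, w, d). if u = u0 \<and> f \<le> d \<and> admissible n (u0, v0, f) \<and> admissible n (v0, w, d - f)
      then Z (v0, w, d - f) else 0) :: 'f::field palg set)"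
  unfolding theta_mult[OF n]
proof (rule theta_cong)
  fix \<tau> assume "admissible n \<tau>"
  obtain u w d where \<tau>: "\<tau> = (u, w, d)" by (cases \<tau>)
  let ?f = "if u = u0 \<and> f \<le> d \<and> admissible n (u0, v0, f) \<and> admissible n (v0, w, d - f)
      then Z (v0, w, d - f) else 0"
  have "(\<Sum>e\<le>d. \<Sum>v<n. (if admissible n (v, w, d - e) then Z (v, w, d - e) else 0) *
    (if admissible n (u, v, e) then if (u, v, e) = (u0, v0, f) then 1 else 0 else 0)) =
    (\<Sum>e\<le>d. \<Sum>v<n. if e = f \<and> v = v0 then ?f else 0)"
  proof (intro sum.cong refl)
    fix e v assume "e \<in> {..d}"
    then have "e \<le> d" by simp
    then show "(if admissible n (v, w, d - e) then Z (v, w, d - e) else 0) *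
      (if admissible n (u, v, e) then if (u, v, e) = (u0, v0, f) then 1 else 0 else 0) = (if e = f \<and> v = v0 then ?f else 0)"
    proof (cases "e = f \<and> v = v0")
      case False
      then have "(u, v, e) \<noteq> (u0, v0, f)" by (metis prod.inject)
      then show ?thesis
        by (simp only: False if_False if_cancel mult_zero_right)
    qed simp
  qed
  also have "\<dots> = ?f"
    unfolding sum_single_pair using admissible_less[of n u0 v0 f] n by simp
  finally show "(\<lambda>(u, w, d). \<Sum>e\<le>d. \<Sum>v<n. (if admissible n (v, w, d - e) then Z (v, w, d - e) else 0) *
    (if admissible n (u, v, e) then if (u, v, e) = (u0, v0, f) then 1 else 0 else 0)) \<tau> =
    (\<lambda>(u, w, d). if u = u0 \<and> f \<le> d \<and> admissible n (u0, v0, f) \<and> admissible n (v0, w, d - f)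
      then Z (v0, w, d - f) else 0) \<tau>"
    unfolding \<tau> prod.case .
qed

text \<open>Degree k = 0 covers the combinations of the vertices e_i; the mirror version
  \<open>theta_mult_diag\<close> is also used with k = 2, for powers of z_1.\<close>

lemma theta_diag_mult:
  assumes n: "n \<ge> 2"
  shows "theta n (\<lambda>(u, v, d). if u = v \<and> d = k then c u else 0) \<otimes>\<^bsub>preproj n\<^esub> theta n Z =
    (theta n (\<lambda>(u, w, d). if k \<le> d \<and> admissible n (w, w, k) \<and> admissible n (u, w, d - k)
      then c w * Z (u, w, d - k) else 0) :: 'f::field palg set)"
  unfolding theta_mult[OF n]
proof (rule theta_cong)
  fix \<tau> assume adm: "admissible n \<tau>"
  obtain u w d where \<tau>: "\<tau> = (u, w, d)" by (cases \<tau>)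
  let ?f = "if k \<le> d \<and> admissible n (w, w, k) \<and> admissible n (u, w, d - k)
      then c w * Z (u, w, d - k) else 0"
  have "(\<Sum>e\<le>d. \<Sum>v<n.
    (if admissible n (v, w, d - e) then (case (v, w, d - e) of (u, v, d) \<Rightarrow> if u = v \<and> d = k then c u else 0) else 0) *
    (if admissible n (u, v, e) then Z (u, v, e) else 0)) =
    (\<Sum>e\<le>d. \<Sum>v<n. if e = d - k \<and> v = w then ?f else 0)"
  proof (intro sum.cong refl)
    fix e v assume "e \<in> {..d}"
    then have e: "e \<le> d" by simp
    show "(if admissible n (v, w, d - e) then (case (v, w, d - e) of (u, v, d) \<Rightarrow> if u = v \<and> d = k then c u else 0) else 0) *
      (if admissible n (u, v, e) then Z (u, v, e) else 0) = (if e = d - k \<and> v = w then ?f else 0)"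
    proof (cases "v = w \<and> d - e = k")
      case True
      then have "v = w" "e = d - k" "k \<le> d" using e by auto
      then show ?thesis by simp
    next
      case False
      then have "\<not> (e = d - k \<and> v = w \<and> k \<le> d)" using e by auto
      then show ?thesis
        by (simp only: prod.case False if_False if_cancel mult_zero_left) (simp; metis)
    qed
  qed
  also have "\<dots> = ?f"
    unfolding sum_single_pair using admissible_less[of n u w d] n adm by (simp add: \<tau>)
  finally show "(\<lambda>(u, w, d). \<Sum>e\<le>d. \<Sum>v<n.
    (if admissible n (v, w, d - e) then (case (v, w, d - e) of (u, v, d) \<Rightarrow> if u = v \<and> d = k then c u else 0) else 0) *
    (if admissible n (u, v, e) then Z (u, v, e) else 0)) \<tau> =
    (\<lambda>(u, w, d). if k \<le> d \<and> admissible n (w, w, k) \<and> admissible n (u, w, d - k)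
      then c w * Z (u, w, d - k) else 0) \<tau>"
    unfolding \<tau> prod.case .
qed

lemma theta_mult_diag:
  assumes n: "n \<ge> 2"
  shows "theta n Z \<otimes>\<^bsub>preproj n\<^esub> theta n (\<lambda>(u, v, d). if u = v \<and> d = k then c u else 0) =
    (theta n (\<lambda>(u, w, d). if k \<le> d \<and> admissible n (u, u, k) \<and> admissible n (u, w, d - k)
      then Z (u, w, d - k) * c u else 0) :: 'f::field palg set)"
  unfolding theta_mult[OF n]
proof (rule theta_cong)
  fix \<tau> assume adm: "admissible n \<tau>"
  obtain u w d where \<tau>: "\<tau> = (u, w, d)" by (cases \<tau>)
  let ?f = "if k \<le> d \<and> admissible n (u, u, k) \<and> admissible n (u, w, d - k)
      then Z (u, w, d - k) * c u else 0"
  have "(\<Sum>e\<le>d. \<Sum>v<n. (if admissible n (v, w, d - e) then Z (v, w, d - e) else 0) *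
    (if admissible n (u, v, e) then (case (u, v, e) of (u, v, d) \<Rightarrow> if u = v \<and> d = k then c u else 0) else 0)) =
    (\<Sum>e\<le>d. \<Sum>v<n. if e = k \<and> v = u then ?f else 0)"
  proof (intro sum.cong refl)
    fix e v assume "e \<in> {..d}"
    then have "e \<le> d" by simp
    then show "(if admissible n (v, w, d - e) then Z (v, w, d - e) else 0) *
      (if admissible n (u, v, e) then (case (u, v, e) of (u, v, d) \<Rightarrow> if u = v \<and> d = k then c u else 0) else 0) = (if e = k \<and> v = u then ?f else 0)"
    proof (cases "e = k \<and> v = u")
      case False
      then have "\<not> (u = v \<and> e = k)" by metis
      then show ?thesis
        by (simp only: prod.case False if_False if_cancel mult_zero_right)
    qed simp
  qed
  also have "\<dots> = ?f"
    unfolding sum_single_pair using admissible_less[of n u w d] n adm by (simp add: \<tau>)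
  finally show "(\<lambda>(u, w, d). \<Sum>e\<le>d. \<Sum>v<n. (if admissible n (v, w, d - e) then Z (v, w, d - e) else 0) *
    (if admissible n (u, v, e) then (case (u, v, e) of (u, v, d) \<Rightarrow> if u = v \<and> d = k then c u else 0) else 0)) \<tau> =
    (\<lambda>(u, w, d). if k \<le> d \<and> admissible n (u, u, k) \<and> admissible n (u, w, d - k)
      then Z (u, w, d - k) * c u else 0) \<tau>"
    unfolding \<tau> prod.case .
qed

section \<open>The spaces \<open>W\<^sub>0\<close>, \<open>W\<^sub>1\<close>, \<open>W\<^sub>2\<close>, \<open>W\<^sub>3\<close>\<close>

text \<open>The combination of the e_i with coefficients \<open>c\<close>, as a pointwise formula
  that avoids sums; \<open>arrow_comb\<close> and \<open>relation_comb\<close> do the same for the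
  arrows and the sigma_i. Coefficients outside the index set are ignored.\<close>

definition vertex_comb :: "nat \<Rightarrow> (nat \<Rightarrow> 'f) \<Rightarrow> 'f::field palg" where
  "vertex_comb n c = (\<lambda>(w, es). if w < n \<and> es = [] then c w else 0)"

definition arrow_comb :: "nat \<Rightarrow> (arrow \<Rightarrow> 'f) \<Rightarrow> 'f::field palg" where
  "arrow_comb n c = (\<lambda>(w, es).
    if \<exists>\<alpha>\<in>arcs (double_quiver n). w = arrow_tail \<alpha> \<and> es = [\<alpha>] then c (hd es) else 0)"

text \<open>The coefficient of sigma_w appears twice, with opposite signs at the two turns at w; at
  an end of the quiver only one turn exists.\<close>

definition relation_comb :: "nat \<Rightarrow> (nat \<Rightarrow> 'f) \<Rightarrow> 'f::field palg" where
  "relation_comb n c = (\<lambda>(w, es).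
    if 0 < w \<and> w < n \<and> es = [Down (w - 1), Up (w - 1)] then c w
    else if w < n - 1 \<and> es = [Up w, Down w] then - c w else 0)"

lemma vertex_space_eq: "vertex_space n = range (vertex_comb n :: (nat \<Rightarrow> 'f) \<Rightarrow> 'f::field palg)"
proof -
  have "vertex_space n = range (\<lambda>c p. \<Sum>i\<in>{..<n}. c i * (vert_elt i p :: 'f))"
    unfolding vertex_space_def by (subst pspan_family[symmetric])
      (simp_all add: double_quiver_def vert_elt_def paths_iff)
  also have "(\<lambda>(c :: nat \<Rightarrow> 'f) p. \<Sum>i\<in>{..<n}. c i * vert_elt i p) = vertex_comb n"
  proof (rule ext, rule ext, clarify)
    fix c :: "nat \<Rightarrow> 'f" and w es
    have "(\<Sum>i\<in>{..<n}. c i * vert_elt i (w, es)) = (\<Sum>i\<in>{..<n}. if i = w then (if es = [] then c w else 0) else 0)"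
      by (rule sum.cong) (simp_all add: vert_elt_def path_elt_def)
    then show "(\<Sum>i\<in>{..<n}. c i * vert_elt i (w, es)) = vertex_comb n c (w, es)"
      by (simp add: vertex_comb_def)
  qed
  finally show ?thesis .
qed

lemma arrow_space_eq: "arrow_space n = range (arrow_comb n :: (arrow \<Rightarrow> 'f) \<Rightarrow> 'f::field palg)"
proof -
  have "arrow_space n = range (\<lambda>c p. \<Sum>\<alpha>\<in>arcs (double_quiver n). c \<alpha> * (arrow_elt \<alpha> p :: 'f))"
    unfolding arrow_space_def
    by (subst pspan_family[symmetric]) (simp_all add: arrow_elt_def paths_iff arrow_ends_less)
  also have "(\<lambda>(c :: arrow \<Rightarrow> 'f) p. \<Sum>\<alpha>\<in>arcs (double_quiver n). c \<alpha> * arrow_elt \<alpha> p) = arrow_comb n"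
  proof (rule ext, rule ext, clarify)
    fix c :: "arrow \<Rightarrow> 'f" and w es
    have "(\<Sum>\<alpha>\<in>arcs (double_quiver n). c \<alpha> * arrow_elt \<alpha> (w, es)) =
        (\<Sum>\<alpha>\<in>arcs (double_quiver n). if \<alpha> = hd es then (if w = arrow_tail \<alpha> \<and> es = [\<alpha>] then c \<alpha> else 0) else 0)"
      by (rule sum.cong) (simp_all add: arrow_elt_def path_elt_def)
    also have "\<dots> = arrow_comb n c (w, es)"
      by (subst sum.delta) (auto simp: arrow_comb_def)
    finally show "(\<Sum>\<alpha>\<in>arcs (double_quiver n). c \<alpha> * arrow_elt \<alpha> (w, es)) = arrow_comb n c (w, es)" .
  qed
  finally show ?thesis .
qed

lemma relation_space_eq:
  assumes n: "n \<ge> 2"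
  shows "relation_space n = range (relation_comb n :: (nat \<Rightarrow> 'f) \<Rightarrow> 'f::field palg)"
proof -
  have "relation_space n = range (\<lambda>c p. \<Sum>i\<in>{..<n}. c i * (sigma n i p :: 'f))"
    unfolding relation_space_def
    by (subst pspan_family[symmetric]) (simp_all add: sigma_closed[OF n])
  also have "(\<lambda>(c :: nat \<Rightarrow> 'f) p. \<Sum>i\<in>{..<n}. c i * sigma n i p) = relation_comb n"
  proof (rule ext, rule ext, clarify)
    fix c :: "nat \<Rightarrow> 'f" and w es
    have "(\<Sum>i\<in>{..<n}. c i * sigma n i (w, es)) =
        (\<Sum>i\<in>{..<n}. if i = w then c w * sigma n w (w, es) else 0)"
      by (rule sum.cong) (simp_all add: sigma_eq[OF n] path_elt_def)
    also have "\<dots> = (if w < n then c w * sigma n w (w, es) else 0)"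
      by simp
    also have "\<dots> = relation_comb n c (w, es)"
      using n by (cases "w < n") (simp_all add: relation_comb_def sigma_eq[OF n] path_elt_def, linarith)
    finally show "(\<Sum>i\<in>{..<n}. c i * sigma n i (w, es)) = relation_comb n c (w, es)" .
  qed
  finally show ?thesis .
qed

lemma vertex_space_carrier: "vertex_space n \<subseteq> carrier (path_algebra n)"
  unfolding vertex_space_def
  by (rule pspan_least[OF _ submodule_carrier])
    (simp add: image_subset_iff double_quiver_def vert_elt_def paths_iff)

lemma arrow_space_carrier: "arrow_space n \<subseteq> carrier (path_algebra n)"
  unfolding arrow_space_def
  by (rule pspan_least[OF _ submodule_carrier])
    (simp add: image_subset_iff arrow_elt_def paths_iff arrow_ends_less)

lemma vertex_comb_closed: "vertex_comb n c \<in> carrier (path_algebra n)"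
  by (rule subsetD[OF vertex_space_carrier]) (simp add: vertex_space_eq)

lemma arrow_comb_closed: "arrow_comb n c \<in> carrier (path_algebra n)"
  by (rule subsetD[OF arrow_space_carrier]) (simp add: arrow_space_eq)

lemma relation_comb_closed: "n \<ge> 2 \<Longrightarrow> relation_comb n c \<in> carrier (path_algebra n)"
  by (rule subsetD[OF relation_space_closed]) (simp_all add: relation_space_eq)

lemma arrow_comb_zero: "length es \<noteq> 1 \<Longrightarrow> arrow_comb n c (w, es) = 0"
  by (auto simp: arrow_comb_def)

lemma arrow_comb_single:
  "arrow_comb n c (w, [\<alpha>]) = (if \<alpha> \<in> arcs (double_quiver n) \<and> w = arrow_tail \<alpha> then c \<alpha> else 0)"
  by (simp add: arrow_comb_def)

lemma vertex_comb_mult: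
  assumes "x \<in> carrier (path_algebra n)"
  shows "(vertex_comb n a \<otimes>\<^bsub>path_algebra n\<^esub> x) (w, es) = a (walk_end w es) * x (w, es)"
proof -
  have "(vertex_comb n a \<otimes>\<^bsub>path_algebra n\<^esub> x) (w, es) =
      (\<Sum>k\<le>length es. if k = length es then (if walk_end w es < n then a (walk_end w es) * x (w, es) else 0) else 0)"
    unfolding path_algebra_mult by (rule sum.cong) (auto simp: vertex_comb_def)
  moreover have "x (w, es) = 0" if "\<not> walk_end w es < n"
    using path_algebra_support[OF assms, of "(w, es)"] that walk_end_less[of n es w] unfolding paths_iff by metis
  ultimately show ?thesis by auto
qed

lemma mult_vertex_comb:
  assumes "x \<in> carrier (path_algebra n)"
  shows "(x \<otimes>\<^bsub>path_algebra n\<^esub> vertex_comb n b) (w, es) = x (w, es) * b w"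
proof -
  have "(x \<otimes>\<^bsub>path_algebra n\<^esub> vertex_comb n b) (w, es) =
      (\<Sum>k\<le>length es. if k = 0 then (if w < n then x (w, es) * b w else 0) else 0)"
    unfolding path_algebra_mult by (rule sum.cong) (auto simp: vertex_comb_def)
  moreover have "x (w, es) = 0" if "\<not> w < n"
    using path_algebra_support[OF assms, of "(w, es)"] that walk_start_less[of n es w] unfolding paths_iff by metis
  ultimately show ?thesis by auto
qed

lemma vertex_comb_one: "vertex_comb n (\<lambda>_. 1) = \<one>\<^bsub>path_algebra n\<^esub>"
  by (rule ext) (simp add: vertex_comb_def split: prod.split)

lemma bimodule_vertex_comb:
  "vertex_comb n a \<otimes>\<^bsub>path_algebra n\<^esub> vertex_comb n c \<otimes>\<^bsub>path_algebra n\<^esub> vertex_comb n b =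
    vertex_comb n (\<lambda>i. a i * c i * b i)"
proof (rule ext, clarify)
  fix w es
  show "(vertex_comb n a \<otimes>\<^bsub>path_algebra n\<^esub> vertex_comb n c \<otimes>\<^bsub>path_algebra n\<^esub> vertex_comb n b) (w, es) =
      vertex_comb n (\<lambda>i. a i * c i * b i) (w, es)"
    unfolding mult_vertex_comb[OF path_algebra_mult_closed[OF vertex_comb_closed vertex_comb_closed]]
      vertex_comb_mult[OF vertex_comb_closed]
    by (simp add: vertex_comb_def)
qed

lemma bimodule_arrow_comb:
  "vertex_comb n a \<otimes>\<^bsub>path_algebra n\<^esub> arrow_comb n c \<otimes>\<^bsub>path_algebra n\<^esub> vertex_comb n b =
    arrow_comb n (\<lambda>\<alpha>. a (arrow_head \<alpha>) * c \<alpha> * b (arrow_tail \<alpha>))"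
proof (rule ext, clarify)
  fix w es
  show "(vertex_comb n a \<otimes>\<^bsub>path_algebra n\<^esub> arrow_comb n c \<otimes>\<^bsub>path_algebra n\<^esub> vertex_comb n b) (w, es) =
      arrow_comb n (\<lambda>\<alpha>. a (arrow_head \<alpha>) * c \<alpha> * b (arrow_tail \<alpha>)) (w, es)"
    unfolding mult_vertex_comb[OF path_algebra_mult_closed[OF vertex_comb_closed arrow_comb_closed]]
      vertex_comb_mult[OF arrow_comb_closed]
    by (auto simp: arrow_comb_def)
qed

lemma bimodule_relation_comb:
  assumes "n \<ge> 2"
  shows "vertex_comb n a \<otimes>\<^bsub>path_algebra n\<^esub> relation_comb n c \<otimes>\<^bsub>path_algebra n\<^esub> vertex_comb n b =
    relation_comb n (\<lambda>i. a i * c i * b i)"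
proof (rule ext, clarify)
  fix w es
  show "(vertex_comb n a \<otimes>\<^bsub>path_algebra n\<^esub> relation_comb n c \<otimes>\<^bsub>path_algebra n\<^esub> vertex_comb n b) (w, es) =
      relation_comb n (\<lambda>i. a i * c i * b i) (w, es)"
    unfolding mult_vertex_comb[OF path_algebra_mult_closed[OF vertex_comb_closed relation_comb_closed[OF assms]]]
      vertex_comb_mult[OF relation_comb_closed[OF assms]]
    by (simp add: relation_comb_def)
qed

lemma W_0: "W n 0 = range (vertex_comb n)"
  by (simp add: W_def vertex_space_eq)

lemma W_1: "W n 1 = range (arrow_comb n)"
  by (simp add: W_def arrow_space_eq)

section \<open>Tensor products over k inside the path algebra\<close>

lemma tensor_least:
  assumes "submodule class_ring U (path_algebra n)"
    and "\<And>x y. x \<in> X \<Longrightarrow> y \<in> Y \<Longrightarrow> x \<otimes>\<^bsub>path_algebra n\<^esub> y \<in> U"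
  shows "tensor n X Y \<subseteq> U"
  unfolding tensor_def by (rule pspan_least[OF _ assms(1)]) (use assms(2) in blast)

lemma tensor_mem:
  assumes "X \<subseteq> carrier (path_algebra n)" "Y \<subseteq> carrier (path_algebra n)" "x \<in> X" "y \<in> Y"
  shows "x \<otimes>\<^bsub>path_algebra n\<^esub> y \<in> tensor n X Y"
  unfolding tensor_def
  by (rule subsetD[OF pspan_superset]) (use assms path_algebra_mult_closed in blast)+

text \<open>k is a unit for the tensor product: it contains 1, and \<open>U\<close> is stable under
  k on both sides. This removes the factors V^0 = k from the definition of W_p.\<close>

lemma tensor_vertex_space:
  fixes U :: "'f::field palg set"
  assumes U: "submodule class_ring U (path_algebra n)"
    and bimodule: "\<And>a x b. x \<in> U \<Longrightarrow>
      vertex_comb n a \<otimes>\<^bsub>path_algebra n\<^esub> x \<otimes>\<^bsub>path_algebra n\<^esub> vertex_comb n b \<in> U"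
  shows "tensor n (vertex_space n) U = U" "tensor n U (vertex_space n) = U"
proof -
  interpret ring "path_algebra n :: ('f, 'f palg) module"
    by (rule ring_path_algebra)
  have U_closed: "U \<subseteq> carrier (path_algebra n)"
    by (rule submodule.subset[OF U])
  have one: "\<one>\<^bsub>path_algebra n\<^esub> \<in> (vertex_space n :: 'f palg set)"
    unfolding vertex_space_eq vertex_comb_one[symmetric] by (rule rangeI)
  have l: "vertex_comb n a \<otimes>\<^bsub>path_algebra n\<^esub> x \<in> U" if "x \<in> U" for a x
    using bimodule[OF that, of a "\<lambda>_. 1"] subsetD[OF U_closed that]
    by (simp only: vertex_comb_one r_one path_algebra_mult_closed vertex_comb_closed)
  have r: "x \<otimes>\<^bsub>path_algebra n\<^esub> vertex_comb n a \<in> U" if "x \<in> U" for a x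
    using bimodule[OF that, of "\<lambda>_. 1" a] subsetD[OF U_closed that]
    by (simp only: vertex_comb_one l_one)
  show "tensor n (vertex_space n) U = U"
  proof
    show "tensor n (vertex_space n) U \<subseteq> U"
      by (rule tensor_least[OF U]) (simp only: vertex_space_eq, elim rangeE, simp only: l)
    show "U \<subseteq> tensor n (vertex_space n) U"
    proof
      fix x assume x: "x \<in> U"
      from tensor_mem[OF vertex_space_carrier U_closed one x] show "x \<in> tensor n (vertex_space n) U"
        by (simp only: l_one subsetD[OF U_closed x])
    qed
  qed
  show "tensor n U (vertex_space n) = U"
  proof
    show "tensor n U (vertex_space n) \<subseteq> U"
      by (rule tensor_least[OF U]) (simp only: vertex_space_eq, elim rangeE, simp only: r)
    show "U \<subseteq> tensor n U (vertex_space n)"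
    proof
      fix x assume x: "x \<in> U"
      from tensor_mem[OF U_closed vertex_space_carrier x one] show "x \<in> tensor n U (vertex_space n)"
        by (simp only: r_one subsetD[OF U_closed x])
    qed
  qed
qed

lemma submodule_relation_space: "n \<ge> 2 \<Longrightarrow> submodule class_ring (relation_space n) (path_algebra n)"
  unfolding relation_space_def by (rule submodule_pspan) (auto simp: sigma_closed)

lemma submodule_arrow_space: "submodule class_ring (arrow_space n) (path_algebra n)"
  unfolding arrow_space_def
  by (rule submodule_pspan) (simp add: image_subset_iff arrow_elt_def paths_iff arrow_ends_less)

lemma relation_space_bimodule:
  "n \<ge> 2 \<Longrightarrow> x \<in> relation_space n \<Longrightarrow>
    vertex_comb n a \<otimes>\<^bsub>path_algebra n\<^esub> x \<otimes>\<^bsub>path_algebra n\<^esub> vertex_comb n b \<in> relation_space n"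
  unfolding relation_space_eq by (elim rangeE) (simp only: bimodule_relation_comb rangeI)

lemma arrow_space_bimodule:
  "x \<in> arrow_space n \<Longrightarrow>
    vertex_comb n a \<otimes>\<^bsub>path_algebra n\<^esub> x \<otimes>\<^bsub>path_algebra n\<^esub> vertex_comb n b \<in> arrow_space n"
  unfolding arrow_space_eq by (elim rangeE) (simp only: bimodule_arrow_comb rangeI)

lemma W_2:
  assumes "n \<ge> 2"
  shows "W n 2 = range (relation_comb n :: (nat \<Rightarrow> 'f) \<Rightarrow> 'f::field palg)"
proof -
  have "tensor n (vertex_space n) (relation_space n) = (relation_space n :: 'f palg set)"
    by (rule tensor_vertex_space(1)[OF submodule_relation_space[OF assms]])
      (rule relation_space_bimodule[OF assms])
  moreover have "tensor n (relation_space n) (vertex_space n) = (relation_space n :: 'f palg set)"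
    by (rule tensor_vertex_space(2)[OF submodule_relation_space[OF assms]])
      (rule relation_space_bimodule[OF assms])
  ultimately have "{tensor n (tensor n (tensor_power n i) (relation_space n)) (tensor_power n j) | i j. i + 2 + j = 2}
      = {relation_space n :: 'f palg set}"
    by simp
  then show ?thesis
    unfolding W_def by (simp add: relation_space_eq[OF assms])
qed

lemma mult_arrow_comb:
  "(x \<otimes>\<^bsub>path_algebra n\<^esub> arrow_comb n b) (w, es) =
    (if es \<noteq> [] \<and> hd es \<in> arcs (double_quiver n) \<and> w = arrow_tail (hd es)
     then x (arrow_head (hd es), tl es) * b (hd es) else 0)"
proof (cases es)
  case Nil
  then show ?thesis
    by (simp add: path_algebra_mult arrow_comb_def)
next
  case (Cons \<alpha> fs)
  have "(x \<otimes>\<^bsub>path_algebra n\<^esub> arrow_comb n b) (w, es) =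
      (\<Sum>k\<le>length es. if k = 1 then (if \<alpha> \<in> arcs (double_quiver n) \<and> w = arrow_tail \<alpha>
        then x (arrow_head \<alpha>, fs) * b \<alpha> else 0) else 0)"
    unfolding path_algebra_mult
  proof (rule sum.cong)
    fix k assume "k \<in> {..length es}"
    then show "x (walk_end w (take k es), drop k es) * arrow_comb n b (w, take k es) =
      (if k = 1 then (if \<alpha> \<in> arcs (double_quiver n) \<and> w = arrow_tail \<alpha>
        then x (arrow_head \<alpha>, fs) * b \<alpha> else 0) else 0)"
    proof (cases "k = 1")
      case True
      then show ?thesis by (simp add: Cons arrow_comb_def)
    next
      case False
      with \<open>k \<in> {..length es}\<close> have "length (take k es) \<noteq> 1" by simp
      then show ?thesis
        using False by (simp add: arrow_comb_zero)
    qed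
  qed simp
  also have "\<dots> = (if \<alpha> \<in> arcs (double_quiver n) \<and> w = arrow_tail \<alpha> then x (arrow_head \<alpha>, fs) * b \<alpha> else 0)"
    by (subst sum.delta) (simp_all add: Cons)
  finally show ?thesis
    by (simp add: Cons)
qed

lemma arrow_comb_mult:
  "(arrow_comb n b \<otimes>\<^bsub>path_algebra n\<^esub> x) (w, es) =
    (if es \<noteq> [] \<and> last es \<in> arcs (double_quiver n) \<and> walk_end w (butlast es) = arrow_tail (last es)
     then b (last es) * x (w, butlast es) else 0)"
proof (cases es rule: rev_cases)
  case Nil
  then show ?thesis
    by (simp add: path_algebra_mult arrow_comb_def)
next
  case (snoc fs \<alpha>)
  have "(arrow_comb n b \<otimes>\<^bsub>path_algebra n\<^esub> x) (w, es) =
      (\<Sum>k\<le>length es. if k = length fs then (if \<alpha> \<in> arcs (double_quiver n) \<and> walk_end w fs = arrow_tail \<alpha>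
        then b \<alpha> * x (w, fs) else 0) else 0)"
    unfolding path_algebra_mult
  proof (rule sum.cong)
    fix k assume k: "k \<in> {..length es}"
    show "arrow_comb n b (walk_end w (take k es), drop k es) * x (w, take k es) =
      (if k = length fs then (if \<alpha> \<in> arcs (double_quiver n) \<and> walk_end w fs = arrow_tail \<alpha>
        then b \<alpha> * x (w, fs) else 0) else 0)"
    proof (cases "k = length fs")
      case True
      then show ?thesis by (simp add: snoc arrow_comb_def)
    next
      case False
      have "length (drop k es) \<noteq> 1"
        using False k by (simp add: snoc)
      with False show ?thesis
        by (simp add: arrow_comb_zero del: length_drop)
    qed
  qed simp
  also have "\<dots> = (if \<alpha> \<in> arcs (double_quiver n) \<and> walk_end w fs = arrow_tail \<alpha> then b \<alpha> * x (w, fs) else 0)"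
    by (simp add: snoc)
  finally show ?thesis
    by (simp add: snoc)
qed

text \<open>The two conditions that membership in \<open>R \<otimes> V\<close> and in \<open>V \<otimes> R\<close> imposes on the coefficients
  of an element of length three.\<close>

fun opposite :: "arrow \<Rightarrow> arrow" where
  "opposite (Up i) = Down i"
| "opposite (Down i) = Up i"

definition relation_then :: "nat \<Rightarrow> 'f::field palg set" where
  "relation_then n = {x \<in> carrier (path_algebra n).
    (\<forall>w es. length es \<noteq> 3 \<longrightarrow> x (w, es) = 0) \<and>
    (\<forall>w \<alpha> \<beta> \<gamma>. \<gamma> \<noteq> opposite \<beta> \<longrightarrow> x (w, [\<alpha>, \<beta>, \<gamma>]) = 0) \<and>
    (\<forall>w \<alpha> i. 0 < i \<longrightarrow> i < n - 1 \<longrightarrow> x (w, [\<alpha>, Up i, Down i]) = - x (w, [\<alpha>, Down (i - 1), Up (i - 1)]))}"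

definition then_relation :: "nat \<Rightarrow> 'f::field palg set" where
  "then_relation n = {x \<in> carrier (path_algebra n).
    (\<forall>w es. length es \<noteq> 3 \<longrightarrow> x (w, es) = 0) \<and>
    (\<forall>w \<alpha> \<beta> \<gamma>. \<beta> \<noteq> opposite \<alpha> \<longrightarrow> x (w, [\<alpha>, \<beta>, \<gamma>]) = 0) \<and>
    (\<forall>w \<gamma> i. 0 < i \<longrightarrow> i < n - 1 \<longrightarrow> x (w, [Up i, Down i, \<gamma>]) = - x (w, [Down (i - 1), Up (i - 1), \<gamma>]))}"

lemma submodule_relation_then:
  "submodule class_ring (relation_then n) (path_algebra n :: ('f::field, 'f palg) module)"
proof (rule submodule_path_algebraI)
  interpret coordinates "path_algebra n :: ('f, 'f palg) module" "carrier (path_algebra n)" "\<lambda>x. x"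
    by (rule coordinates_path_algebra)
  show "relation_then n \<subseteq> carrier (path_algebra n :: ('f, 'f palg) module)"
    unfolding relation_then_def by (rule subsetI) (erule CollectE, erule conjunct1)
  show "(\<lambda>_. 0) \<in> (relation_then n :: 'f palg set)"
    by (simp add: relation_then_def zero_mem)
  show "(\<lambda>p. x p + y p) \<in> relation_then n" if "x \<in> relation_then n" "y \<in> relation_then n" for x y :: "'f palg"
    using that by (simp add: relation_then_def add_mem)
  show "(\<lambda>p. c * x p) \<in> relation_then n" if "x \<in> relation_then n" for c and x :: "'f palg"
    using that by (simp add: relation_then_def smult_mem)
qed

lemma submodule_then_relation:
  "submodule class_ring (then_relation n) (path_algebra n :: ('f::field, 'f palg) module)"
proof (rule submodule_path_algebraI)
  interpret coordinates "path_algebra n :: ('f, 'f palg) module" "carrier (path_algebra n)" "\<lambda>x. x"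
    by (rule coordinates_path_algebra)
  show "then_relation n \<subseteq> carrier (path_algebra n :: ('f, 'f palg) module)"
    unfolding then_relation_def by (rule subsetI) (erule CollectE, erule conjunct1)
  show "(\<lambda>_. 0) \<in> (then_relation n :: 'f palg set)"
    by (simp add: then_relation_def zero_mem)
  show "(\<lambda>p. x p + y p) \<in> then_relation n" if "x \<in> then_relation n" "y \<in> then_relation n" for x y :: "'f palg"
    using that by (simp add: then_relation_def add_mem)
  show "(\<lambda>p. c * x p) \<in> then_relation n" if "x \<in> then_relation n" for c and x :: "'f palg"
    using that by (simp add: then_relation_def smult_mem)
qed

lemma relation_comb_zero:
  "length es \<noteq> 2 \<Longrightarrow> relation_comb n c (w, es) = 0"
  "\<gamma> \<noteq> opposite \<beta> \<Longrightarrow> relation_comb n c (w, [\<beta>, \<gamma>]) = 0"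
  by (auto simp: relation_comb_def)

lemma relation_comb_opposite:
  "0 < i \<Longrightarrow> i < n - 1 \<Longrightarrow>
    relation_comb n c (w, [Up i, Down i]) = - relation_comb n c (w, [Down (i - 1), Up (i - 1)])"
  by (auto simp: relation_comb_def)

text \<open>In a written product the right factor is traversed first, so in R V the relation
  occupies the last two steps.\<close>

lemma relation_arrow_mem:
  assumes n: "n \<ge> 2"
  shows "relation_comb n c \<otimes>\<^bsub>path_algebra n\<^esub> arrow_comb n b \<in> relation_then n"
  unfolding relation_then_def
proof (intro CollectI conjI allI impI)
  show "relation_comb n c \<otimes>\<^bsub>path_algebra n\<^esub> arrow_comb n b \<in> carrier (path_algebra n)"
    by (rule path_algebra_mult_closed[OF relation_comb_closed[OF n] arrow_comb_closed])
next
  fix w and es :: "arrow list" assume "length es \<noteq> 3"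
  then have "length (tl es) \<noteq> 2" by simp
  then have "relation_comb n c (v, tl es) = 0" for v
    by (rule relation_comb_zero(1))
  then show "(relation_comb n c \<otimes>\<^bsub>path_algebra n\<^esub> arrow_comb n b) (w, es) = 0"
    unfolding mult_arrow_comb by simp
next
  fix w \<alpha> \<beta> \<gamma> assume "\<gamma> \<noteq> opposite \<beta>"
  then show "(relation_comb n c \<otimes>\<^bsub>path_algebra n\<^esub> arrow_comb n b) (w, [\<alpha>, \<beta>, \<gamma>]) = 0"
    unfolding mult_arrow_comb by (simp add: relation_comb_zero(2))
next
  fix w \<alpha> i assume i: "0 < i" "i < n - 1"
  show "(relation_comb n c \<otimes>\<^bsub>path_algebra n\<^esub> arrow_comb n b) (w, [\<alpha>, Up i, Down i]) =
      - (relation_comb n c \<otimes>\<^bsub>path_algebra n\<^esub> arrow_comb n b) (w, [\<alpha>, Down (i - 1), Up (i - 1)])"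
    unfolding mult_arrow_comb list.sel relation_comb_opposite[OF i] by simp
qed

lemma arrow_relation_mem:
  assumes n: "n \<ge> 2"
  shows "arrow_comb n b \<otimes>\<^bsub>path_algebra n\<^esub> relation_comb n c \<in> then_relation n"
  unfolding then_relation_def
proof (intro CollectI conjI allI impI)
  show "arrow_comb n b \<otimes>\<^bsub>path_algebra n\<^esub> relation_comb n c \<in> carrier (path_algebra n)"
    by (rule path_algebra_mult_closed[OF arrow_comb_closed relation_comb_closed[OF n]])
next
  fix w and es :: "arrow list" assume "length es \<noteq> 3"
  then have "length (butlast es) \<noteq> 2" by simp
  then have "relation_comb n c (v, butlast es) = 0" for v
    by (rule relation_comb_zero(1))
  then show "(arrow_comb n b \<otimes>\<^bsub>path_algebra n\<^esub> relation_comb n c) (w, es) = 0"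
    unfolding arrow_comb_mult by simp
next
  fix w \<alpha> \<beta> \<gamma> assume "\<beta> \<noteq> opposite \<alpha>"
  then show "(arrow_comb n b \<otimes>\<^bsub>path_algebra n\<^esub> relation_comb n c) (w, [\<alpha>, \<beta>, \<gamma>]) = 0"
    unfolding arrow_comb_mult by (simp add: relation_comb_zero(2))
next
  fix w \<gamma> i assume i: "0 < i" "i < n - 1"
  have eqs: "butlast [Up i, Down i, \<gamma>] = [Up i, Down i]"
    "butlast [Down (i - 1), Up (i - 1), \<gamma>] = [Down (i - 1), Up (i - 1)]"
    "last [Up i, Down i, \<gamma>] = \<gamma>" "last [Down (i - 1), Up (i - 1), \<gamma>] = \<gamma>"
    "walk_end w [Up i, Down i] = i" "walk_end w [Down (i - 1), Up (i - 1)] = i"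
    using i by simp_all
  show "(arrow_comb n b \<otimes>\<^bsub>path_algebra n\<^esub> relation_comb n c) (w, [Up i, Down i, \<gamma>]) =
      - (arrow_comb n b \<otimes>\<^bsub>path_algebra n\<^esub> relation_comb n c) (w, [Down (i - 1), Up (i - 1), \<gamma>])"
    unfolding arrow_comb_mult eqs relation_comb_opposite[OF i] by simp
qed

text \<open>Both conditions together leave only walks that go back and forth along one edge. At an
  end of that edge which is interior, a turn can be moved to the other side at the cost of a sign,
  and the new walk does not turn back twice, so its coefficient is zero.\<close>

lemma relation_then_Int_then_relation:
  assumes n: "n \<ge> 3" and x1: "x \<in> relation_then n" and x2: "x \<in> then_relation n"
  shows "x = (\<lambda>_. 0 :: 'f::field)"
proof (rule ext, clarify)
  fix w es
  have xP: "x \<in> carrier (path_algebra n)"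
    and l: "\<And>w es. length es \<noteq> 3 \<Longrightarrow> x (w, es) = 0"
    and a1: "\<And>w \<alpha> \<beta> \<gamma>. \<gamma> \<noteq> opposite \<beta> \<Longrightarrow> x (w, [\<alpha>, \<beta>, \<gamma>]) = 0"
    and b1: "\<And>w \<alpha> i. 0 < i \<Longrightarrow> i < n - 1 \<Longrightarrow> x (w, [\<alpha>, Up i, Down i]) = - x (w, [\<alpha>, Down (i - 1), Up (i - 1)])"
    using x1 unfolding relation_then_def by simp_all
  have a2: "\<And>w \<alpha> \<beta> \<gamma>. \<beta> \<noteq> opposite \<alpha> \<Longrightarrow> x (w, [\<alpha>, \<beta>, \<gamma>]) = 0"
    and b2: "\<And>w \<gamma> i. 0 < i \<Longrightarrow> i < n - 1 \<Longrightarrow> x (w, [Up i, Down i, \<gamma>]) = - x (w, [Down (i - 1), Up (i - 1), \<gamma>])"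
    using x2 unfolding then_relation_def by simp_all
  show "x (w, es) = 0"
  proof (cases "length es = 3 \<and> (w, es) \<in> paths n")
    case False
    then show ?thesis
      using l[of es w] path_algebra_support[OF xP, of "(w, es)"] by metis
  next
    case True
    then obtain \<alpha> \<beta> \<gamma> where es: "es = [\<alpha>, \<beta>, \<gamma>]"
      by (auto simp: numeral_3_eq_3 length_Suc_conv)
    have \<alpha>: "\<alpha> \<in> arcs (double_quiver n)"
      using True by (simp add: es paths_iff)
    show ?thesis
    proof (cases "\<beta> = opposite \<alpha> \<and> \<gamma> = opposite \<beta>")
      case False
      then show ?thesis
        unfolding es using a1[of \<gamma> \<beta> w \<alpha>] a2[of \<beta> \<alpha> w \<gamma>] by metis
    next
      case opp: True
      show ?thesis
      proof (cases \<alpha>)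
        case (Up i)
        have i: "i < n - 1" using \<alpha> Up by simp
        show ?thesis
        \<comment> \<open>The walk is \<open>Up i\<close>, \<open>Down i\<close>,
          \<open>Up i\<close>. If i + 1 is interior, its last two steps, a turn there, are replaced
          by \<open>Up (i + 1)\<close>, \<open>Down (i + 1)\<close>.\<close>
        proof (cases "i + 1 < n - 1")
          case True
          then show ?thesis
            using b1[of "i + 1" w "Up i"] a2[of "Up (i + 1)" "Up i" w "Down (i + 1)"] opp by (simp add: es Up)
        next
          case False
          \<comment> \<open>Here i + 1 is the last vertex, so n >= 3 makes i interior, and the first
            two steps cannot be used: the turn at i after them is moved through the mirror
            condition.\<close>
          then have "0 < i" using i n by linarith
          then show ?thesis
            using b2[of i w "Up i"] a1[of "Up i" "Up (i - 1)" w "Down (i - 1)"] opp i by (simp add: es Up)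
        qed
      next
        case (Down i)
        have i: "i < n - 1" using \<alpha> Down by simp
        show ?thesis
        proof (cases "0 < i")
          case True
          then show ?thesis
            using b1[of i w "Down i"] a2[of "Down (i - 1)" "Down i" w "Up (i - 1)"] opp i by (simp add: es Down)
        next
          \<comment> \<open>The edge is the one between 0 and 1, and vertex 1 is interior because n
            >= 3; the turn there is made by the first two steps.\<close>
          case False
          then show ?thesis
            using b2[of 1 w "Down 0"] a1[of "Down 0" "Down 1" w "Up 1"] opp n by (simp add: es Down)
        qed
      qed
    qed
  qed
qed

text \<open>The vanishing of \<open>W\<^sub>3\<close>, which makes every 2-cochain a cocycle, is where \<open>n \<ge> 3\<close> is needed.\<close>

lemma W_3:
  assumes n: "n \<ge> 3"
  shows "W n 3 \<subseteq> {\<lambda>_. 0 :: 'f::field}"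
proof
  fix x :: "'f palg" assume x: "x \<in> W n 3"
  have n2: "n \<ge> 2" using n by simp
  have kR: "tensor n (vertex_space n) (relation_space n) = (relation_space n :: 'f palg set)"
    by (rule tensor_vertex_space(1)[OF submodule_relation_space[OF n2]])
      (rule relation_space_bimodule[OF n2])
  have kV: "tensor n (vertex_space n) (arrow_space n) = (arrow_space n :: 'f palg set)"
    by (rule tensor_vertex_space(1)[OF submodule_arrow_space]) (rule arrow_space_bimodule)
  have x_mem: "x \<in> tensor n (tensor n (tensor_power n i) (relation_space n)) (tensor_power n j)"
    if "i + 2 + j = 3" for i j
    using x that unfolding W_def by auto
  have "tensor n (relation_space n) (arrow_space n) \<subseteq> (relation_then n :: 'f palg set)"
    by (rule tensor_least[OF submodule_relation_then])
      (simp only: relation_space_eq[OF n2] arrow_space_eq, elim rangeE, simp only: relation_arrow_mem[OF n2])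
  then have x1: "x \<in> relation_then n"
    using x_mem[of 0 1] by (simp add: kR kV subset_iff)
  have VR: "tensor n (arrow_space n) (relation_space n) \<subseteq> (then_relation n :: 'f palg set)"
    by (rule tensor_least[OF submodule_then_relation])
      (simp only: relation_space_eq[OF n2] arrow_space_eq, elim rangeE, simp only: arrow_relation_mem[OF n2])
  \<comment> \<open>For i = 1, j = 0 the definition has a further right factor k, under which
    \<open>then_relation\<close> is stable.\<close>
  have "tensor n (tensor n (arrow_space n) (relation_space n)) (vertex_space n) \<subseteq> (then_relation n :: 'f palg set)"
  proof (rule tensor_least[OF submodule_then_relation])
    fix y v :: "'f palg" assume y: "y \<in> tensor n (arrow_space n) (relation_space n)" and v: "v \<in> vertex_space n"
    from v obtain b where b: "v = vertex_comb n b"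
      unfolding vertex_space_eq by (elim rangeE)
    have y': "y \<in> then_relation n"
      by (rule subsetD[OF VR y])
    then have yP: "y \<in> carrier (path_algebra n)"
      by (rule subsetD[OF submodule.subset[OF submodule_then_relation]])
    have eq: "(y \<otimes>\<^bsub>path_algebra n\<^esub> v) (w, es) = y (w, es) * b w" for w es
      unfolding b by (rule mult_vertex_comb[OF yP])
    show "y \<otimes>\<^bsub>path_algebra n\<^esub> v \<in> then_relation n"
      using y' path_algebra_mult_closed[OF yP vertex_comb_closed[of n b]] unfolding then_relation_def
      by (simp add: eq b[symmetric])
  qed
  then have x2: "x \<in> then_relation n"
    using x_mem[of 1 0] by (simp add: kV subset_iff)
  show "x \<in> {\<lambda>_. 0 :: 'f}"
    using relation_then_Int_then_relation[OF n x1 x2] by simp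
qed

section \<open>Factoring off the first or the last arrow\<close>

lemma right_part_arrow_comb:
  assumes "\<alpha> \<in> arcs (double_quiver n)"
  shows "right_part \<alpha> (arrow_comb n c) = vertex_comb n (\<lambda>w. if w = arrow_head \<alpha> then c \<alpha> else 0)"
  using assms arrow_ends_less[OF assms]
  by (intro ext) (auto simp: right_part_def arrow_comb_def vertex_comb_def)

lemma left_part_arrow_comb:
  assumes "\<alpha> \<in> arcs (double_quiver n)"
  shows "left_part n \<alpha> (arrow_comb n c) = vertex_comb n (\<lambda>w. if w = arrow_tail \<alpha> then c \<alpha> else 0)"
  using assms arrow_ends_less[OF assms]
  by (intro ext) (auto simp: left_part_def arrow_comb_def vertex_comb_def path_end_eq)

text \<open>Each arrow is traversed first in exactly one relation: a_i in sigma_i, with sign -, and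
  a_i^* in sigma_{i+1}, with sign +. In \<open>left_part_relation_comb\<close> the roles of the two
  arrows are exchanged.\<close>

lemma right_part_relation_comb:
  assumes "i < n - 1"
  shows "right_part (Up i) (relation_comb n c) = arrow_comb n (\<lambda>\<beta>. if \<beta> = Down i then - c i else 0)"
    and "right_part (Down i) (relation_comb n c) = arrow_comb n (\<lambda>\<beta>. if \<beta> = Up i then c (i + 1) else 0)"
  using assms by (auto simp: right_part_def arrow_comb_def relation_comb_def intro!: ext)

lemma left_part_relation_comb:
  assumes "i < n - 1"
  shows "left_part n (Up i) (relation_comb n c) = arrow_comb n (\<lambda>\<beta>. if \<beta> = Down i then c (i + 1) else 0)"
    and "left_part n (Down i) (relation_comb n c) = arrow_comb n (\<lambda>\<beta>. if \<beta> = Up i then - c i else 0)"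
proof -
  have *: "left_part n \<alpha> (relation_comb n c) (w, es) = 0 \<and> arrow_comb n c' (w, es) = 0"
    if "length es \<noteq> 1" for w es \<alpha> and c' :: "arrow \<Rightarrow> 'a"
    using that by (simp add: left_part_def relation_comb_zero(1) arrow_comb_zero)
  have "left_part n (Up i) (relation_comb n c) (w, es) = arrow_comb n (\<lambda>\<beta>. if \<beta> = Down i then c (i + 1) else 0) (w, es) \<and>
    left_part n (Down i) (relation_comb n c) (w, es) = arrow_comb n (\<lambda>\<beta>. if \<beta> = Up i then - c i else 0) (w, es)" for w es
  proof (cases "length es = 1")
    case True
    then obtain \<beta> where es: "es = [\<beta>]" by (auto simp: length_Suc_conv)
    show ?thesis
      using assms unfolding es arrow_comb_single
      by (cases \<beta>) (auto simp: left_part_def relation_comb_def path_end_eq)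
  qed (use * in simp)
  then show "left_part n (Up i) (relation_comb n c) = arrow_comb n (\<lambda>\<beta>. if \<beta> = Down i then c (i + 1) else 0)"
    and "left_part n (Down i) (relation_comb n c) = arrow_comb n (\<lambda>\<beta>. if \<beta> = Up i then - c i else 0)"
    by (simp_all add: fun_eq_iff)
qed

lemma admissible_diag: "admissible n (u, v, d) \<Longrightarrow> admissible n (u, u, 0) \<and> admissible n (v, v, 0)"
  by (simp add: admissible_def)

lemma admissible_arrow:
  assumes "\<alpha> \<in> arcs (double_quiver n)"
  shows "admissible n (arrow_tail \<alpha>, arrow_head \<alpha>, 1)"
  using assms by (cases \<alpha>) (simp_all add: admissible_def)

lemma proj_vertex_comb:
  assumes n: "n \<ge> 2"
  shows "proj n (vertex_comb n a) = (theta n (\<lambda>(u, v, d). if u = v \<and> d = 0 then a u else 0) :: 'f::field palg set)"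
  unfolding proj_eq_theta[OF n vertex_comb_closed]
proof (rule theta_cong)
  fix \<tau> assume adm: "admissible n \<tau>"
  obtain u v d where \<tau>: "\<tau> = (u, v, d)" by (cases \<tau>)
  have "coef n (vertex_comb n a) (u, v, d) = (\<Sum>es\<in>walks n u v d. if es = [] then a u else 0)"
    unfolding coef_def prod.case
  proof (rule sum.cong)
    fix es assume "es \<in> walks n u v d"
    then have "u < n"
      using walk_start_less[of n es u v] by (simp add: walks_def)
    then show "vertex_comb n a (u, es) = (if es = [] then a u else 0)"
      by (simp add: vertex_comb_def)
  qed simp
  also have "\<dots> = (if [] \<in> walks n u v d then a u else 0)"
    by (rule sum.delta) simp
  also have "\<dots> = (if u = v \<and> d = 0 then a u else 0)"
    using admissible_less[of n u v d] adm n by (auto simp: walks_def \<tau>)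
  finally show "coef n (vertex_comb n a) \<tau> = (\<lambda>(u, v, d). if u = v \<and> d = 0 then a u else 0) \<tau>"
    by (simp only: \<tau> prod.case)
qed

text \<open>A left factor from k sees the end v of a monomial, a right factor its start u.\<close>

lemma theta_bimodule:
  assumes n: "n \<ge> 2"
  shows "proj n (vertex_comb n a) \<otimes>\<^bsub>preproj n\<^esub> theta n Z \<otimes>\<^bsub>preproj n\<^esub> proj n (vertex_comb n b) =
    (theta n (\<lambda>(u, v, d). a v * Z (u, v, d) * b u) :: 'f::field palg set)"
  unfolding proj_vertex_comb[OF n] theta_diag_mult[OF n] theta_mult_diag[OF n]
proof (rule theta_cong)
  fix \<tau> assume adm: "admissible n \<tau>"
  obtain u v d where \<tau>: "\<tau> = (u, v, d)" by (cases \<tau>)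
  show "(\<lambda>(u, w, d). if 0 \<le> d \<and> admissible n (u, u, 0) \<and> admissible n (u, w, d - 0)
      then (\<lambda>(u, w, d). if 0 \<le> d \<and> admissible n (w, w, 0) \<and> admissible n (u, w, d - 0)
        then a w * Z (u, w, d - 0) else 0) (u, w, d - 0) * b u else 0) \<tau>
      = (\<lambda>(u, v, d). a v * Z (u, v, d) * b u) \<tau>"
    using adm admissible_diag[of n u v d] by (simp add: \<tau>)
qed

lemma proj_arrow_elt:
  assumes n: "n \<ge> 2" and \<alpha>: "\<alpha> \<in> arcs (double_quiver n)"
  shows "proj n (arrow_elt \<alpha>) =
    (theta n (\<lambda>\<tau>. if \<tau> = (arrow_tail \<alpha>, arrow_head \<alpha>, 1) then 1 else 0) :: 'f::field palg set)"
  using proj_path_elt[OF n, of "[\<alpha>]" "arrow_tail \<alpha>" "arrow_head \<alpha>"] \<alpha> arrow_ends_less[OF \<alpha>]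
  by (simp add: arrow_elt_def)

section \<open>Koszul cochains in coordinates\<close>

text \<open>\<open>G c\<close> is the combination with coefficients \<open>c\<close> of a basis of \<open>W\<^sub>p\<close> that is indexed by \<open>I\<close>,
  where the element with index \<open>i\<close> lies in \<open>e\<^bsub>t i\<^esub> W\<^sub>p e\<^bsub>s i\<^esub>\<close>; the functions \<open>D i\<close> form the dual basis.\<close>

locale generators =
  fixes n p :: nat and I :: "'i set" and s t :: "'i \<Rightarrow> nat"
    and G :: "('i \<Rightarrow> 'f::field) \<Rightarrow> 'f palg" and D :: "'i \<Rightarrow> 'f palg \<Rightarrow> 'f"
  assumes n: "n \<ge> 2"
    and fin_I: "finite I"
    and W_eq: "W n p = range G"
    and D_G: "\<And>i c. i \<in> I \<Longrightarrow> D i (G c) = c i"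
    and G_cong: "\<And>c c'. (\<And>i. i \<in> I \<Longrightarrow> c i = c' i) \<Longrightarrow> G c = G c'"
    and G_add: "\<And>c c'. (\<lambda>q. G c q + G c' q) = G (\<lambda>i. c i + c' i)"
    and G_smult: "\<And>k c. (\<lambda>q. k * G c q) = G (\<lambda>i. k * c i)"
    and bimodule: "\<And>a b c. vertex_comb n a \<otimes>\<^bsub>path_algebra n\<^esub> G c \<otimes>\<^bsub>path_algebra n\<^esub> vertex_comb n b =
      G (\<lambda>i. a (t i) * c i * b (s i))"
begin

sublocale A: coordinates "preproj n :: ('f, 'f palg set) module" UNIV "theta n"
  by (rule coordinates_theta[OF n])

text \<open>A cochain is given by the coefficients \<open>y (i, d)\<close> of the monomials of length \<open>d\<close> in its value
  on the basis element with index \<open>i\<close>.\<close>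

definition ev :: "('i \<Rightarrow> 'f) \<Rightarrow> ('i \<times> nat \<Rightarrow> 'f) \<Rightarrow> nat \<times> nat \<times> nat \<Rightarrow> 'f" where
  "ev c y = (\<lambda>(u, v, d). \<Sum>i\<in>I. if u = s i \<and> v = t i then c i * y (i, d) else 0)"

definition cochain :: "('i \<times> nat \<Rightarrow> 'f) \<Rightarrow> 'f cochain" where
  "cochain y = (\<lambda>x\<in>W n p. theta n (ev (\<lambda>i. D i x) y))"

lemma cochain_G: "cochain y (G c) = theta n (ev c y)"
proof -
  have "ev (\<lambda>i. D i (G c)) y = ev c y"
    unfolding ev_def by (intro ext) (auto simp: D_G intro!: sum.cong)
  then show ?thesis
    by (simp add: cochain_def W_eq)
qed

lemma ev_add: "ev (\<lambda>i. c i + c' i) y \<tau> = ev c y \<tau> + ev c' y \<tau>"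
  unfolding ev_def by (cases \<tau>) (simp add: sum.distrib[symmetric] algebra_simps if_distrib cong: if_cong sum.cong)

lemma ev_smult: "ev (\<lambda>i. k * c i) y \<tau> = k * ev c y \<tau>"
  unfolding ev_def by (cases \<tau>) (simp add: sum_distrib_left algebra_simps if_distrib cong: if_cong)

lemma ev_add_right: "ev c (\<lambda>a. y a + y' a) \<tau> = ev c y \<tau> + ev c y' \<tau>"
  unfolding ev_def by (cases \<tau>) (simp add: sum.distrib[symmetric] algebra_simps if_distrib cong: if_cong sum.cong)

lemma ev_smult_right: "ev c (\<lambda>a. k * y a) \<tau> = k * ev c y \<tau>"
  unfolding ev_def by (cases \<tau>) (simp add: sum_distrib_left algebra_simps if_distrib cong: if_cong)

lemma ev_zero_right: "ev c (\<lambda>a. 0) \<tau> = 0"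
  unfolding ev_def by (cases \<tau>) simp

lemma ev_delta:
  assumes "i \<in> I"
  shows "ev (\<lambda>j. if j = i then k else 0) y (u, v, d) = (if u = s i \<and> v = t i then k * y (i, d) else 0)"
proof -
  have "ev (\<lambda>j. if j = i then k else 0) y (u, v, d) =
      (\<Sum>j\<in>I. if j = i then (if u = s i \<and> v = t i then k * y (i, d) else 0) else 0)"
    unfolding ev_def prod.case by (rule sum.cong) auto
  then show ?thesis
    using assms fin_I by simp
qed

text \<open>All quantifiers over W_p are turned into quantifiers over coefficient functions, where
  linearity and the bimodule law are plain identities.\<close>

lemma cochains_simps:
  "f \<in> carrier (cochains n p) \<longleftrightarrow>
    (\<forall>c. f (G c) \<in> carrier (preproj n)) \<and>
    (\<forall>c c'. f (G (\<lambda>i. c i + c' i)) = f (G c) \<oplus>\<^bsub>preproj n\<^esub> f (G c')) \<and>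
    (\<forall>k c. f (G (\<lambda>i. k * c i)) = k \<odot>\<^bsub>preproj n\<^esub> f (G c)) \<and>
    f \<in> extensional (W n p) \<and>
    (\<forall>a b c. f (G (\<lambda>i. a (t i) * c i * b (s i))) =
      proj n (vertex_comb n a) \<otimes>\<^bsub>preproj n\<^esub> f (G c) \<otimes>\<^bsub>preproj n\<^esub> proj n (vertex_comb n b))"
proof -
  let ?P = "path_algebra n :: ('f, 'f palg) module" and ?A = "preproj n :: ('f, 'f palg set) module"
  have hom: "f \<in> LinearCombinations.module_hom class_ring (?P\<lparr>carrier := W n p\<rparr>) ?A \<longleftrightarrow>
      (\<forall>c. f (G c) \<in> carrier ?A) \<and>
      (\<forall>c c'. f (G (\<lambda>i. c i + c' i)) = f (G c) \<oplus>\<^bsub>?A\<^esub> f (G c')) \<and>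
      (\<forall>k c. f (G (\<lambda>i. k * c i)) = k \<odot>\<^bsub>?A\<^esub> f (G c))"
    unfolding LinearCombinations.module_hom_def mem_Collect_eq
  proof (intro arg_cong2[of _ _ _ _ "(\<and>)"])
    show "f \<in> carrier (?P\<lparr>carrier := W n p\<rparr>) \<rightarrow> carrier ?A \<longleftrightarrow> (\<forall>c. f (G c) \<in> carrier ?A)"
      by (simp add: W_eq Pi_iff)
    have "(\<forall>m1 m2. m1 \<in> range G \<and> m2 \<in> range G \<longrightarrow> Q m1 m2) \<longleftrightarrow> (\<forall>c c'. Q (G c) (G c'))" for Q
      by (metis (no_types, lifting) rangeE rangeI)
    then show "(\<forall>m1 m2. m1 \<in> carrier (?P\<lparr>carrier := W n p\<rparr>) \<and> m2 \<in> carrier (?P\<lparr>carrier := W n p\<rparr>) \<longrightarrow>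
        f (m1 \<oplus>\<^bsub>?P\<lparr>carrier := W n p\<rparr>\<^esub> m2) = f m1 \<oplus>\<^bsub>?A\<^esub> f m2) \<longleftrightarrow>
      (\<forall>c c'. f (G (\<lambda>i. c i + c' i)) = f (G c) \<oplus>\<^bsub>?A\<^esub> f (G c'))"
      by (simp add: W_eq G_add)
    have "(\<forall>r m. r \<in> (UNIV :: 'f set) \<and> m \<in> range G \<longrightarrow> Q r m) \<longleftrightarrow> (\<forall>k c. Q k (G c))" for Q
      by (metis (no_types, lifting) rangeE rangeI UNIV_I)
    then show "(\<forall>r m. r \<in> carrier (class_ring :: 'f ring) \<and> m \<in> carrier (?P\<lparr>carrier := W n p\<rparr>) \<longrightarrow>
        f (r \<odot>\<^bsub>?P\<lparr>carrier := W n p\<rparr>\<^esub> m) = r \<odot>\<^bsub>?A\<^esub> f m) \<longleftrightarrow>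
      (\<forall>k c. f (G (\<lambda>i. k * c i)) = k \<odot>\<^bsub>?A\<^esub> f (G c))"
      by (simp add: W_eq G_smult)
  qed
  have bim: "(\<forall>u\<in>vertex_space n. \<forall>v\<in>vertex_space n. \<forall>x\<in>W n p.
        f (u \<otimes>\<^bsub>?P\<^esub> x \<otimes>\<^bsub>?P\<^esub> v) = proj n u \<otimes>\<^bsub>?A\<^esub> f x \<otimes>\<^bsub>?A\<^esub> proj n v) \<longleftrightarrow>
      (\<forall>a b c. f (G (\<lambda>i. a (t i) * c i * b (s i))) =
        proj n (vertex_comb n a) \<otimes>\<^bsub>?A\<^esub> f (G c) \<otimes>\<^bsub>?A\<^esub> proj n (vertex_comb n b))"
    by (simp add: W_eq vertex_space_eq bimodule)
  show ?thesis
    unfolding cochains_def Let_def partial_object.simps mem_Collect_eq Int_iff hom bim conj_assoc ..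
qed

lemma cochain_closed: "cochain y \<in> carrier (cochains n p)"
  unfolding cochains_simps cochain_G
proof (intro conjI allI)
  show "cochain y \<in> extensional (W n p)"
    by (simp add: cochain_def)
  fix c c' :: "'i \<Rightarrow> 'f" and k :: 'f and a b :: "nat \<Rightarrow> 'f"
  show "theta n (ev c y) \<in> carrier (preproj n)"
    by (simp add: A.carrier_eq)
  show "theta n (ev (\<lambda>i. c i + c' i) y) = theta n (ev c y) \<oplus>\<^bsub>preproj n\<^esub> theta n (ev c' y)"
    by (simp add: A.add_eq) (rule theta_cong, rule ev_add)
  show "theta n (ev (\<lambda>i. k * c i) y) = k \<odot>\<^bsub>preproj n\<^esub> theta n (ev c y)"
    by (simp add: A.smult_eq) (rule theta_cong, rule ev_smult)
  show "theta n (ev (\<lambda>i. a (t i) * c i * b (s i)) y) =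
      proj n (vertex_comb n a) \<otimes>\<^bsub>preproj n\<^esub> theta n (ev c y) \<otimes>\<^bsub>preproj n\<^esub> proj n (vertex_comb n b)"
    unfolding theta_bimodule[OF n]
  proof (rule theta_cong)
    fix \<tau> :: "nat \<times> nat \<times> nat"
    obtain u v d where \<tau>: "\<tau> = (u, v, d)" by (cases \<tau>)
    show "ev (\<lambda>i. a (t i) * c i * b (s i)) y \<tau> = (\<lambda>(u, v, d). a v * ev c y (u, v, d) * b u) \<tau>"
      unfolding \<tau> ev_def prod.case sum_distrib_left sum_distrib_right
      by (rule sum.cong) simp_all
  qed
qed

text \<open>The bimodule law confines the value on the basis element with index i to e_{t i} A e_{s
  i}, so that only its coefficients in the various degrees d remain; linearity then determines the
  cochain.\<close>

lemma cochain_surj: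
  assumes f: "f \<in> carrier (cochains n p)"
  obtains y where "f = cochain y"
proof -
  define g where "g i = G (\<lambda>j. if j = i then 1 else 0)" for i
  have f': "\<And>c. f (G c) \<in> carrier (preproj n)"
    "\<And>c c'. f (G (\<lambda>i. c i + c' i)) = f (G c) \<oplus>\<^bsub>preproj n\<^esub> f (G c')"
    "\<And>k c. f (G (\<lambda>i. k * c i)) = k \<odot>\<^bsub>preproj n\<^esub> f (G c)"
    "f \<in> extensional (W n p)"
    "\<And>a b c. f (G (\<lambda>i. a (t i) * c i * b (s i))) =
      proj n (vertex_comb n a) \<otimes>\<^bsub>preproj n\<^esub> f (G c) \<otimes>\<^bsub>preproj n\<^esub> proj n (vertex_comb n b)"
    using f unfolding cochains_simps by simp_all
  have "\<exists>Z. f (g i) = theta n Z" for i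
    using f'(1)[of "\<lambda>j. if j = i then 1 else 0"] unfolding g_def A.carrier_eq by (elim imageE) (rule exI)
  then obtain Z where Z: "\<And>i. f (g i) = theta n (Z i)"
    by metis
  have fg: "f (g i) = theta n (\<lambda>(u, v, d). if u = s i \<and> v = t i then Z i (u, v, d) else 0)" for i
  proof -
    \<comment> \<open>The basis element equals e_{t i} g_i e_{s i}, so the same holds for its
      value.\<close>
    have "g i = G (\<lambda>j. (if t j = t i then 1 else 0) * (if j = i then 1 else 0) * (if s j = s i then 1 else 0))"
      unfolding g_def by (rule G_cong) simp
    then have "f (g i) = proj n (vertex_comb n (\<lambda>v. if v = t i then 1 else 0)) \<otimes>\<^bsub>preproj n\<^esub> f (g i)
        \<otimes>\<^bsub>preproj n\<^esub> proj n (vertex_comb n (\<lambda>u. if u = s i then 1 else 0))"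
      using f'(5)[of "\<lambda>v. if v = t i then 1 else 0" "\<lambda>j. if j = i then 1 else 0" "\<lambda>u. if u = s i then 1 else 0"]
      unfolding g_def by metis
    also have "\<dots> = theta n (\<lambda>(u, v, d). if u = s i \<and> v = t i then Z i (u, v, d) else 0)"
      unfolding Z theta_bimodule[OF n] by (rule theta_cong) (simp split: prod.split)
    finally show ?thesis .
  qed
  define y where "y = (\<lambda>(i, d). Z i (s i, t i, d))"
  \<comment> \<open>Additivity is available for two summands only, hence the induction on the set of
    indices with nonzero coefficient.\<close>
  have fG: "f (G (\<lambda>i. if i \<in> J then c i else 0)) = cochain y (G (\<lambda>i. if i \<in> J then c i else 0))"
    if "finite J" "J \<subseteq> I" for J c
    using that
  proof (induction J rule: finite_induct)
    case empty
    have "f (G (\<lambda>i. 0 * 0)) = 0 \<odot>\<^bsub>preproj n\<^esub> f (G (\<lambda>i. 0))"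
      by (rule f'(3))
    also have "\<dots> = theta n (\<lambda>_. 0)"
      using f'(1)[of "\<lambda>i. 0"] unfolding A.carrier_eq by (elim imageE) (simp add: A.smult_eq)
    finally have "f (G (\<lambda>i. 0)) = theta n (\<lambda>_. 0)"
      by simp
    moreover have "cochain y (G (\<lambda>i. 0)) = theta n (\<lambda>_. 0)"
      unfolding cochain_G by (rule theta_cong) (simp add: ev_def split: prod.split)
    ultimately show ?case by simp
  next
    case (insert j J)
    have G: "G (\<lambda>i. if i \<in> insert j J then c i else 0) =
        G (\<lambda>i. (if i \<in> J then c i else 0) + c j * (if i = j then 1 else 0))"
      by (rule G_cong) (use insert.hyps in auto)
    have h_add: "h (G (\<lambda>i. (if i \<in> J then c i else 0) + c j * (if i = j then 1 else 0))) =
        h (G (\<lambda>i. if i \<in> J then c i else 0)) \<oplus>\<^bsub>preproj n\<^esub> (c j \<odot>\<^bsub>preproj n\<^esub> h (g j))"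
      if "h \<in> carrier (cochains n p)" for h
      using that unfolding cochains_simps g_def by simp
    have "f (g j) = cochain y (g j)"
      unfolding fg unfolding g_def cochain_G
    proof (rule theta_cong)
      fix \<tau> :: "nat \<times> nat \<times> nat"
      obtain u v d where \<tau>: "\<tau> = (u, v, d)" by (cases \<tau>)
      show "(\<lambda>(u, v, d). if u = s j \<and> v = t j then Z j (u, v, d) else 0) \<tau> = ev (\<lambda>i. if i = j then 1 else 0) y \<tau>"
        using insert.prems by (simp add: \<tau> ev_delta y_def)
    qed
    then show ?case
      unfolding G h_add[OF f] h_add[OF cochain_closed] using insert.IH insert.prems by simp
  qed
  have "f = cochain y"
  proof (rule extensionalityI[OF f'(4)])
    show "cochain y \<in> extensional (W n p)"
      by (simp add: cochain_def)
    fix x :: "'f palg" assume "x \<in> W n p"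
    then obtain c where x: "x = G c" unfolding W_eq by (elim rangeE)
    have "G c = G (\<lambda>i. if i \<in> I then c i else 0)"
      by (rule G_cong) simp
    then show "f x = cochain y x"
      unfolding x using fG[OF fin_I subset_refl, of c] by simp
  qed
  then show thesis by (rule that)
qed

lemma coordinates_cochains: "coordinates (cochains n p :: ('f, 'f cochain) module) UNIV cochain"
proof
  show "carrier (cochains n p) = range cochain"
    using cochain_closed cochain_surj by (metis (no_types, lifting) rangeI subsetI subset_antisym image_subset_iff UNIV_I)
  show "\<zero>\<^bsub>cochains n p\<^esub> = cochain (\<lambda>_. 0)"
  proof -
    have "theta n (ev c (\<lambda>_. 0)) = \<zero>\<^bsub>preproj n\<^esub>" for c
      unfolding A.zero_eq by (rule theta_cong) (rule ev_zero_right)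
    then show ?thesis
      by (simp add: cochains_def Let_def cochain_def)
  qed
  show "cochain y \<oplus>\<^bsub>cochains n p\<^esub> cochain y' = cochain (\<lambda>a. y a + y' a)" for y y'
  proof -
    have "theta n (ev c y) \<oplus>\<^bsub>preproj n\<^esub> theta n (ev c y') = theta n (ev c (\<lambda>a. y a + y' a))" for c
      by (simp add: A.add_eq) (rule theta_cong, simp add: ev_add_right)
    then show ?thesis
      by (simp add: cochains_def Let_def cochain_def cong: restrict_cong)
  qed
  show "k \<odot>\<^bsub>cochains n p\<^esub> cochain y = cochain (\<lambda>a. k * y a)" for k y
  proof -
    have "k \<odot>\<^bsub>preproj n\<^esub> theta n (ev c y) = theta n (ev c (\<lambda>a. k * y a))" for c
      by (simp add: A.smult_eq) (rule theta_cong, simp add: ev_smult_right)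
    then show ?thesis
      by (simp add: cochains_def Let_def cochain_def cong: restrict_cong)
  qed
qed simp_all

lemma cochain_eq_iff:
  "cochain y = cochain y' \<longleftrightarrow> (\<forall>i\<in>I. \<forall>d. admissible n (s i, t i, d) \<longrightarrow> y (i, d) = y' (i, d))"
proof
  assume eq: "cochain y = cochain y'"
  show "\<forall>i\<in>I. \<forall>d. admissible n (s i, t i, d) \<longrightarrow> y (i, d) = y' (i, d)"
  proof (intro ballI allI impI)
    fix i d assume i: "i \<in> I" and adm: "admissible n (s i, t i, d)"
    have "theta n (ev (\<lambda>j. if j = i then 1 else 0) y) = theta n (ev (\<lambda>j. if j = i then 1 else 0) y')"
      using eq cochain_G[of y] cochain_G[of y'] by metis
    then have "ev (\<lambda>j. if j = i then 1 else 0) y (s i, t i, d) = ev (\<lambda>j. if j = i then 1 else 0) y' (s i, t i, d)"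
      using adm unfolding theta_eq_iff[OF n] by metis
    then show "y (i, d) = y' (i, d)"
      unfolding ev_delta[OF i] by simp
  qed
next
  assume eq: "\<forall>i\<in>I. \<forall>d. admissible n (s i, t i, d) \<longrightarrow> y (i, d) = y' (i, d)"
  have "theta n (ev c y) = theta n (ev c y')" for c
  proof (rule theta_cong)
    fix \<tau> assume adm: "admissible n \<tau>"
    obtain u v d where \<tau>: "\<tau> = (u, v, d)" by (cases \<tau>)
    show "ev c y \<tau> = ev c y' \<tau>"
      unfolding \<tau> ev_def prod.case
    proof (rule sum.cong)
      fix i assume "i \<in> I"
      then show "(if u = s i \<and> v = t i then c i * y (i, d) else 0) = (if u = s i \<and> v = t i then c i * y' (i, d) else 0)"
        using eq adm unfolding \<tau> by metis
    qed simp
  qed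
  then show "cochain y = cochain y'"
    by (simp add: cochain_def)
qed

lemma cochain_eq_zero_iff:
  "cochain y = \<zero>\<^bsub>cochains n p\<^esub> \<longleftrightarrow> (\<forall>i\<in>I. \<forall>d. admissible n (s i, t i, d) \<longrightarrow> y (i, d) = 0)"
  using coordinates.zero_eq[OF coordinates_cochains] cochain_eq_iff[of y "\<lambda>_. 0"] by simp

text \<open>Multiplication by an arrow removes it from the start or from the end of the parameters
  and lowers the degree by one. The factorisations of \<open>x\<close> enter through their
  coordinates \<rho> and l, so no basis of W_{p+1} is involved.\<close>

lemma b_K_cochain:
  assumes x: "x \<in> W n (p + 1)"
    and \<rho>: "\<And>\<alpha>. \<alpha> \<in> arcs (double_quiver n) \<Longrightarrow> right_part \<alpha> x = G (\<rho> \<alpha>)"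
    and l: "\<And>\<alpha>. \<alpha> \<in> arcs (double_quiver n) \<Longrightarrow> left_part n \<alpha> x = G (l \<alpha>)"
  shows "b_K n p (cochain y) x = theta n (\<lambda>(u, w, d).
      (\<Sum>\<alpha>\<in>arcs (double_quiver n). if u = arrow_tail \<alpha> \<and> 1 \<le> d \<and> admissible n (arrow_head \<alpha>, w, d - 1)
        then ev (\<rho> \<alpha>) y (arrow_head \<alpha>, w, d - 1) else 0)
      - (- 1) ^ p * (\<Sum>\<alpha>\<in>arcs (double_quiver n). if w = arrow_head \<alpha> \<and> 1 \<le> d \<and> admissible n (u, arrow_tail \<alpha>, d - 1)
        then ev (l \<alpha>) y (u, arrow_tail \<alpha>, d - 1) else 0))"
proof -
  let ?Q = "arcs (double_quiver n)"
  let ?r = "\<lambda>\<alpha> (u, w, d). if u = arrow_tail \<alpha> \<and> 1 \<le> d \<and> admissible n (arrow_head \<alpha>, w, d - 1)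
        then ev (\<rho> \<alpha>) y (arrow_head \<alpha>, w, d - 1) else 0"
  let ?l = "\<lambda>\<alpha> (u, w, d). if w = arrow_head \<alpha> \<and> 1 \<le> d \<and> admissible n (u, arrow_tail \<alpha>, d - 1)
        then ev (l \<alpha>) y (u, arrow_tail \<alpha>, d - 1) else 0"
  interpret A': abelian_group "preproj n :: ('f, 'f palg set) module"
    by (rule A.abelian_group)
  have r: "cochain y (right_part \<alpha> x) \<otimes>\<^bsub>preproj n\<^esub> proj n (arrow_elt \<alpha>) = theta n (?r \<alpha>)" if "\<alpha> \<in> ?Q" for \<alpha>
    unfolding \<rho>[OF that] cochain_G proj_arrow_elt[OF n that] theta_mult_mono[OF n]
    using admissible_arrow[OF that] by simp
  have l: "proj n (arrow_elt \<alpha>) \<otimes>\<^bsub>preproj n\<^esub> cochain y (left_part n \<alpha> x) = theta n (?l \<alpha>)" if "\<alpha> \<in> ?Q" for \<alpha>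
    unfolding l[OF that] cochain_G proj_arrow_elt[OF n that] theta_mono_mult[OF n]
    using admissible_arrow[OF that] by simp
  have "(\<Oplus>\<^bsub>preproj n\<^esub>\<alpha>\<in>?Q. cochain y (right_part \<alpha> x) \<otimes>\<^bsub>preproj n\<^esub> proj n (arrow_elt \<alpha>)) =
      (\<Oplus>\<^bsub>preproj n\<^esub>\<alpha>\<in>?Q. theta n (?r \<alpha>))"
    by (rule A'.finsum_cong') (simp_all add: r A.carrier_eq)
  also have "\<dots> = theta n (\<lambda>\<tau>. \<Sum>\<alpha>\<in>?Q. ?r \<alpha> \<tau>)"
    by (rule A.finsum_eq) simp_all
  finally have R: "(\<Oplus>\<^bsub>preproj n\<^esub>\<alpha>\<in>?Q. cochain y (right_part \<alpha> x) \<otimes>\<^bsub>preproj n\<^esub> proj n (arrow_elt \<alpha>)) =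
      theta n (\<lambda>\<tau>. \<Sum>\<alpha>\<in>?Q. ?r \<alpha> \<tau>)" .
  have "(\<Oplus>\<^bsub>preproj n\<^esub>\<alpha>\<in>?Q. proj n (arrow_elt \<alpha>) \<otimes>\<^bsub>preproj n\<^esub> cochain y (left_part n \<alpha> x)) =
      (\<Oplus>\<^bsub>preproj n\<^esub>\<alpha>\<in>?Q. theta n (?l \<alpha>))"
    by (rule A'.finsum_cong') (simp_all add: l A.carrier_eq)
  also have "\<dots> = theta n (\<lambda>\<tau>. \<Sum>\<alpha>\<in>?Q. ?l \<alpha> \<tau>)"
    by (rule A.finsum_eq) simp_all
  finally have L: "(\<Oplus>\<^bsub>preproj n\<^esub>\<alpha>\<in>?Q. proj n (arrow_elt \<alpha>) \<otimes>\<^bsub>preproj n\<^esub> cochain y (left_part n \<alpha> x)) =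
      theta n (\<lambda>\<tau>. \<Sum>\<alpha>\<in>?Q. ?l \<alpha> \<tau>)" .
  have "b_K n p (cochain y) x =
      (\<Oplus>\<^bsub>preproj n\<^esub>\<alpha>\<in>?Q. cochain y (right_part \<alpha> x) \<otimes>\<^bsub>preproj n\<^esub> proj n (arrow_elt \<alpha>))
      \<ominus>\<^bsub>preproj n\<^esub> ((- 1) ^ p \<odot>\<^bsub>preproj n\<^esub>
        (\<Oplus>\<^bsub>preproj n\<^esub>\<alpha>\<in>?Q. proj n (arrow_elt \<alpha>) \<otimes>\<^bsub>preproj n\<^esub> cochain y (left_part n \<alpha> x)))"
    unfolding b_K_def Let_def using x by (rule restrict_apply')
  also have "\<dots> = theta n (\<lambda>\<tau>. (\<Sum>\<alpha>\<in>?Q. ?r \<alpha> \<tau>) - (- 1) ^ p * (\<Sum>\<alpha>\<in>?Q. ?l \<alpha> \<tau>))"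
    unfolding R L by (simp add: A.smult_eq A.a_minus_eq)
  also have "\<dots> = theta n (\<lambda>(u, w, d). (\<Sum>\<alpha>\<in>?Q. ?r \<alpha> (u, w, d)) - (- 1) ^ p * (\<Sum>\<alpha>\<in>?Q. ?l \<alpha> (u, w, d)))"
    by (rule theta_cong) (simp split: prod.split)
  finally show ?thesis
    unfolding prod.case .
qed

lemma b_K_extensional: "b_K n p f \<in> extensional (W n (p + 1))"
  by (simp add: b_K_def Let_def)

end

section \<open>Cohomology from functionals on cocycle coordinates\<close>

text \<open>The functionals \<open>T\<close> must cut out the coboundaries within the cocycles and
  be dual to \<open>e\<close>. \<open>T_zero\<close> makes them well defined on cochains, since
  \<open>cochain\<close> forgets the values in inadmissible degrees.\<close>

lemma (in generators) HK_basis_familyI: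
  fixes T :: "('i \<times> nat \<Rightarrow> 'f) \<Rightarrow> 'j \<Rightarrow> 'f"
  assumes J: "finite J"
    and Y: "cocycles n p = cochain ` Y" "(\<lambda>_. 0) \<in> Y"
      "\<And>y y'. y \<in> Y \<Longrightarrow> y' \<in> Y \<Longrightarrow> (\<lambda>a. y a + y' a) \<in> Y"
      "\<And>c y. y \<in> Y \<Longrightarrow> (\<lambda>a. c * y a) \<in> Y"
    and cob: "coboundaries n p = cochain ` {y \<in> Y. \<forall>j\<in>J. T y j = 0}"
    and T_add: "\<And>y y' j. j \<in> J \<Longrightarrow> T (\<lambda>a. y a + y' a) j = T y j + T y' j"
    and T_smult: "\<And>c y j. j \<in> J \<Longrightarrow> T (\<lambda>a. c * y a) j = c * T y j"
    and T_zero: "\<And>y j. y \<in> Y \<Longrightarrow> cochain y = \<zero>\<^bsub>cochains n p\<^esub> \<Longrightarrow> j \<in> J \<Longrightarrow> T y j = 0"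
    and e: "\<And>j. j \<in> J \<Longrightarrow> e j \<in> Y" "\<And>i j. i \<in> J \<Longrightarrow> j \<in> J \<Longrightarrow> T (e i) j = (if i = j then 1 else 0)"
    and b: "\<And>j. j \<in> J \<Longrightarrow> b j = cochain (e j)"
  shows "basis_family (HK n p :: ('f, 'f cochain set) module) (\<lambda>j. HK_class n p (b j)) J"
proof -
  let ?M = "(cochains n p)\<lparr>carrier := cocycles n p\<rparr> :: ('f, 'f cochain) module"
  interpret C: coordinates "cochains n p :: ('f, 'f cochain) module" UNIV cochain
    by (rule coordinates_cochains)
  interpret M: coordinates ?M Y cochain
    unfolding Y(1) by (rule C.restrict) (use Y in simp_all)
  have T0: "T (\<lambda>_. 0) j = 0" if "j \<in> J" for j
    using T_smult[OF that, of 0 "\<lambda>_. 0"] by simp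
  have T_diff: "T (\<lambda>a. y a - y' a) j = T y j - T y' j" if "j \<in> J" for y y' j
    using T_add[OF that, of y "\<lambda>a. -1 * y' a"] T_smult[OF that, of "-1" y'] by simp
  have cong: "\<forall>j\<in>J. T y' j = 0"
    if "cochain y = cochain y'" "y \<in> Y" "y' \<in> Y" "\<forall>j\<in>J. T y j = 0" for y y'
  proof
    fix j assume j: "j \<in> J"
    have "cochain (\<lambda>a. y a - y' a) = \<zero>\<^bsub>cochains n p\<^esub>"
      using that(1) C.mk_eq_iff[of y y'] by simp
    then have "T (\<lambda>a. y a - y' a) j = 0"
      by (rule T_zero[OF M.minus_mem[OF that(2,3)] _ j])
    then show "T y' j = 0"
      using that(4) j T_diff[OF j, of y y'] by simp
  qed
  have q: "coordinates (quotient ?M (coboundaries n p)) Y (\<lambda>y. coboundaries n p +>\<^bsub>?M\<^esub> cochain y)"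
    "\<And>y. y \<in> Y \<Longrightarrow> coboundaries n p +>\<^bsub>?M\<^esub> cochain y = \<zero>\<^bsub>quotient ?M (coboundaries n p)\<^esub>
      \<longleftrightarrow> (\<forall>j\<in>J. T y j = 0)"
  proof -
    have 0: "\<forall>j\<in>J. T (\<lambda>_. 0) j = 0"
      by (simp add: T0)
    have 1: "\<forall>j\<in>J. T (\<lambda>a. y a + y' a) j = 0" if "\<forall>j\<in>J. T y j = 0" "\<forall>j\<in>J. T y' j = 0" for y y'
      using that by (simp add: T_add)
    have 2: "\<forall>j\<in>J. T (\<lambda>a. c * y a) j = 0" if "\<forall>j\<in>J. T y j = 0" for c y
      using that by (simp add: T_smult)
    show "coordinates (quotient ?M (coboundaries n p)) Y (\<lambda>y. coboundaries n p +>\<^bsub>?M\<^esub> cochain y)"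
      by (rule M.quotient(1)[where Q = "\<lambda>y. \<forall>j\<in>J. T y j = 0", OF 0 _ _ cob]) (assumption | rule 1 2 cong)+
    show "\<And>y. y \<in> Y \<Longrightarrow> coboundaries n p +>\<^bsub>?M\<^esub> cochain y = \<zero>\<^bsub>quotient ?M (coboundaries n p)\<^esub>
      \<longleftrightarrow> (\<forall>j\<in>J. T y j = 0)"
      by (rule M.quotient(2)[where Q = "\<lambda>y. \<forall>j\<in>J. T y j = 0", OF 0 _ _ cob]) (assumption | rule 1 2 cong)+
  qed
  \<comment> \<open>\<open>HK_class\<close> forms the coset among all cochains; only the addition
    enters, and it is the same as among cocycles.\<close>
  have class_eq: "HK_class n p (b j) = coboundaries n p +>\<^bsub>?M\<^esub> cochain (e j)" if "j \<in> J" for j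
    unfolding HK_class_def b[OF that] by (simp add: a_r_coset_def r_coset_def)
  show ?thesis
    unfolding HK_def
    by (rule coordinates.basis_familyI[OF q(1) J, where T = T and e = e])
      (fact T_add T_smult q(2) e class_eq)+
qed

text \<open>A cochain is determined by its values on the basis of W_p, which justifies the definite
  descriptions of \<open>zeta\<close> and \<open>hcochain\<close>.\<close>

lemma (in generators) cochain_the:
  assumes z: "\<And>i. i \<in> I \<Longrightarrow> z i = theta n (\<lambda>(u, v, d). if u = s i \<and> v = t i then y (i, d) else 0)"
  shows "(THE f. f \<in> carrier (cochains n p) \<and> (\<forall>i\<in>I. f (G (\<lambda>j. if j = i then 1 else 0)) = z i)) = cochain y"
proof (rule the_equality)
  have val: "cochain y' (G (\<lambda>j. if j = i then 1 else 0)) =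
      theta n (\<lambda>(u, v, d). if u = s i \<and> v = t i then y' (i, d) else 0)" if "i \<in> I" for y' i
    unfolding cochain_G by (rule theta_cong) (simp add: ev_delta[OF that] split: prod.split)
  show "cochain y \<in> carrier (cochains n p) \<and> (\<forall>i\<in>I. cochain y (G (\<lambda>j. if j = i then 1 else 0)) = z i)"
    using val z by (simp add: cochain_closed)
  fix f assume f: "f \<in> carrier (cochains n p) \<and> (\<forall>i\<in>I. f (G (\<lambda>j. if j = i then 1 else 0)) = z i)"
  then obtain y' where y': "f = cochain y'"
    using cochain_surj by metis
  show "f = cochain y"
    unfolding y' cochain_eq_iff
  proof (intro ballI allI impI)
    fix i d assume i: "i \<in> I" and adm: "admissible n (s i, t i, d)"
    have "theta n (\<lambda>(u, v, d). if u = s i \<and> v = t i then y' (i, d) else 0) =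
        theta n (\<lambda>(u, v, d). if u = s i \<and> v = t i then y (i, d) else 0)"
      using f i val[OF i, of y'] z[OF i] unfolding y' by metis
    from this[unfolded theta_eq_iff[OF n], rule_format, OF adm]
    show "y' (i, d) = y (i, d)" by simp
  qed
qed

lemma generators_vertex:
  assumes "n \<ge> 2"
  shows "generators n 0 {..<n} (\<lambda>i. i) (\<lambda>i. i) (vertex_comb n) (\<lambda>i x. x (i, []))"
proof
  show "(\<lambda>q. vertex_comb n c q + vertex_comb n c' q) = vertex_comb n (\<lambda>i. c i + c' i)"
    for c c' :: "nat \<Rightarrow> 'a"
    by (rule ext) (simp add: vertex_comb_def split: prod.split)
  show "(\<lambda>q. k * vertex_comb n c q) = vertex_comb n (\<lambda>i. k * c i)" for k and c :: "nat \<Rightarrow> 'a"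
    by (rule ext) (simp add: vertex_comb_def split: prod.split)
  show "vertex_comb n c = vertex_comb n c'" if "\<And>i. i \<in> {..<n} \<Longrightarrow> c i = c' i" for c c' :: "nat \<Rightarrow> 'a"
    by (rule ext) (use that in \<open>simp add: vertex_comb_def split: prod.split\<close>)
qed (use assms in \<open>simp_all add: W_0 bimodule_vertex_comb, simp_all add: vertex_comb_def\<close>)

lemma generators_arrow:
  assumes "n \<ge> 2"
  shows "generators n 1 (arcs (double_quiver n)) arrow_tail arrow_head (arrow_comb n)
    (\<lambda>\<alpha> x. x (arrow_tail \<alpha>, [\<alpha>]))"
proof
  show "(\<lambda>q. arrow_comb n c q + arrow_comb n c' q) = arrow_comb n (\<lambda>i. c i + c' i)"
    for c c' :: "arrow \<Rightarrow> 'a"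
    by (rule ext) (auto simp: arrow_comb_def split: prod.split)
  show "(\<lambda>q. k * arrow_comb n c q) = arrow_comb n (\<lambda>i. k * c i)" for k and c :: "arrow \<Rightarrow> 'a"
    by (rule ext) (auto simp: arrow_comb_def split: prod.split)
  show "arrow_comb n c = arrow_comb n c'" if "\<And>i. i \<in> arcs (double_quiver n) \<Longrightarrow> c i = c' i"
    for c c' :: "arrow \<Rightarrow> 'a"
    by (rule ext) (use that in \<open>auto simp: arrow_comb_def split: prod.split\<close>)
qed (use assms in \<open>simp_all add: W_1[simplified] bimodule_arrow_comb arrow_comb_single\<close>)

text \<open>The coefficient of sigma_i is read off at the turn \<open>[Up i, Down i]\<close>, where
  it has the sign -; at the last vertex only the other turn exists.\<close>

lemma generators_relation:
  assumes "n \<ge> 2"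
  shows "generators n 2 {..<n} (\<lambda>i. i) (\<lambda>i. i) (relation_comb n)
    (\<lambda>i x. if i = n - 1 then x (i, [Down (i - 1), Up (i - 1)]) else - x (i, [Up i, Down i]))"
proof
  show "(\<lambda>q. relation_comb n c q + relation_comb n c' q) = relation_comb n (\<lambda>i. c i + c' i)"
    for c c' :: "nat \<Rightarrow> 'a"
    by (rule ext) (simp add: relation_comb_def split: prod.split)
  show "(\<lambda>q. k * relation_comb n c q) = relation_comb n (\<lambda>i. k * c i)" for k and c :: "nat \<Rightarrow> 'a"
    by (rule ext) (simp add: relation_comb_def split: prod.split)
  show "relation_comb n c = relation_comb n c'" if "\<And>i. i \<in> {..<n} \<Longrightarrow> c i = c' i" for c c' :: "nat \<Rightarrow> 'a"
    by (rule ext) (use that in \<open>auto simp: relation_comb_def split: prod.split\<close>)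
qed (use assms in \<open>simp_all add: W_2 bimodule_relation_comb, simp_all add: relation_comb_def, linarith?\<close>)

lemma sum_arcs: "(\<Sum>\<alpha>\<in>arcs (double_quiver n). f \<alpha>) = (\<Sum>i<n - 1. f (Up i) + f (Down i) :: 'b::comm_monoid_add)"
proof -
  have "(\<Sum>\<alpha>\<in>arcs (double_quiver n). f \<alpha>) = (\<Sum>\<alpha>\<in>Up ` {..<n - 1}. f \<alpha>) + (\<Sum>\<alpha>\<in>Down ` {..<n - 1}. f \<alpha>)"
    unfolding double_quiver_def by simp (rule sum.union_disjoint, auto)
  then show ?thesis
    by (simp add: sum.reindex inj_on_def sum.distrib)
qed

section \<open>Admissible degrees at vertices and edges\<close>

lemma admissible_loop_iff:
  "admissible n (i, i, d) \<longleftrightarrow> even d \<and> d \<le> 2 * i \<and> 2 * i + d \<le> 2 * (n - 1)"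
  by (auto simp: admissible_def)

lemma admissible_edge_iff:
  "admissible n (i, Suc i, d) \<longleftrightarrow> odd d \<and> d \<le> 2 * i + 1 \<and> 2 * i + 1 + d \<le> 2 * (n - 1)"
  "admissible n (Suc i, i, d) \<longleftrightarrow> odd d \<and> d \<le> 2 * i + 1 \<and> 2 * i + 1 + d \<le> 2 * (n - 1)"
  by (auto simp: admissible_def elim: oddE)

text \<open>Along an edge the degree is odd, hence positive, and removing the arrow leaves
  admissible loops at both ends. The side conditions of \<open>b_K_cochain\<close> for p = 0 are
  thereby satisfied.\<close>

lemma admissible_arrow_loop:
  assumes "admissible n (arrow_tail \<alpha>, arrow_head \<alpha>, d)"
  shows "1 \<le> d" "admissible n (arrow_head \<alpha>, arrow_head \<alpha>, d - 1)"
    "admissible n (arrow_tail \<alpha>, arrow_tail \<alpha>, d - 1)"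
  using assms by (cases \<alpha>; auto simp: admissible_edge_iff admissible_loop_iff elim!: oddE)+

text \<open>A loop of positive degree 2 (l + 1) needs room for l + 1 steps on both sides of j, so j
  is interior and both neighbouring edges are admissible in degree 2l + 1. This serves the side
  conditions for p = 1.\<close>

lemma admissible_loop_arrow:
  assumes "admissible n (j, j, d)" "1 \<le> d"
  shows "0 < j" "j < n - 1"
    "admissible n (j - 1, j, d - 1)" "admissible n (j, j - 1, d - 1)"
    "admissible n (j, j + 1, d - 1)" "admissible n (j + 1, j, d - 1)"
proof -
  obtain l where l: "d = 2 * l + 2" "l + 1 \<le> j" "j + l + 1 \<le> n - 1"
    using assms unfolding admissible_loop_iff by (elim conjE evenE) (cases "d div 2", auto)
  then show "0 < j" "j < n - 1" by linarith+
  obtain k where k: "j = Suc k" using l by (cases j) auto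
  show "admissible n (j - 1, j, d - 1)" "admissible n (j, j - 1, d - 1)"
    "admissible n (j, j + 1, d - 1)" "admissible n (j + 1, j, d - 1)"
    using l by (simp_all add: k admissible_edge_iff)
qed

text \<open>\<open>F\<close> carries the field as a type, so that the instances for p = 0, 1, 2
  share their scalars.\<close>

locale preprojective_A =
  fixes n :: nat and F :: "'f::field itself"
  assumes n3: "n \<ge> 3"
begin

lemma n2: "n \<ge> 2"
  using n3 by simp

sublocale V: generators n 0 "{..<n}" "\<lambda>i. i" "\<lambda>i. i" "vertex_comb n :: (nat \<Rightarrow> 'f) \<Rightarrow> 'f palg" "\<lambda>i x. x (i, [])"
  by (rule generators_vertex[OF n2])

sublocale E: generators n 1 "arcs (double_quiver n)" arrow_tail arrow_head
    "arrow_comb n :: (arrow \<Rightarrow> 'f) \<Rightarrow> 'f palg" "\<lambda>\<alpha> x. x (arrow_tail \<alpha>, [\<alpha>])"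
  by (rule generators_arrow[OF n2])

sublocale R: generators n 2 "{..<n}" "\<lambda>i. i" "\<lambda>i. i" "relation_comb n :: (nat \<Rightarrow> 'f) \<Rightarrow> 'f palg"
    "\<lambda>i x. if i = n - 1 then x (i, [Down (i - 1), Up (i - 1)]) else - x (i, [Up i, Down i])"
  by (rule generators_relation[OF n2])

section \<open>The differential in coordinates\<close>

text \<open>For an arrow the differential is f(e_h) \<alpha> - \<alpha> f(e_t), with h its head and
  t its tail; both terms have the ends of \<alpha>, so the coefficients subtract, one degree
  lower.\<close>

lemma b_K_0:
  "b_K n 0 (V.cochain y) = E.cochain (\<lambda>(\<alpha>, d). y (arrow_head \<alpha>, d - 1) - y (arrow_tail \<alpha>, d - 1))"
    (is "_ = E.cochain ?y")
proof (rule extensionalityI)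
  show "b_K n 0 (V.cochain y) \<in> extensional (W n 1)"
    using V.b_K_extensional by simp
  show "E.cochain ?y \<in> extensional (W n 1)"
    unfolding E.cochain_def by (rule restrict_extensional)
  fix x :: "'f palg" assume x: "x \<in> W n 1"
  then obtain c where c: "x = arrow_comb n c"
    unfolding E.W_eq by (elim rangeE)
  let ?Q = "arcs (double_quiver n)"
  show "b_K n 0 (V.cochain y) x = E.cochain ?y x"
  proof (subst V.b_K_cochain)
    show "x \<in> W n (0 + 1)" using x by simp
    show "right_part \<alpha> x = vertex_comb n (\<lambda>w. if w = arrow_head \<alpha> then c \<alpha> else 0)" if "\<alpha> \<in> ?Q" for \<alpha>
      unfolding c by (rule right_part_arrow_comb[OF that])
    show "left_part n \<alpha> x = vertex_comb n (\<lambda>w. if w = arrow_tail \<alpha> then c \<alpha> else 0)" if "\<alpha> \<in> ?Q" for \<alpha>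
      unfolding c by (rule left_part_arrow_comb[OF that])
    show "theta n (\<lambda>(u, w, d).
        (\<Sum>\<alpha>\<in>?Q. if u = arrow_tail \<alpha> \<and> 1 \<le> d \<and> admissible n (arrow_head \<alpha>, w, d - 1)
          then V.ev (\<lambda>w. if w = arrow_head \<alpha> then c \<alpha> else 0) y (arrow_head \<alpha>, w, d - 1) else 0)
        - (- 1) ^ 0 * (\<Sum>\<alpha>\<in>?Q. if w = arrow_head \<alpha> \<and> 1 \<le> d \<and> admissible n (u, arrow_tail \<alpha>, d - 1)
          then V.ev (\<lambda>w. if w = arrow_tail \<alpha> then c \<alpha> else 0) y (u, arrow_tail \<alpha>, d - 1) else 0)) =
        E.cochain ?y x"
      unfolding c E.cochain_G
    proof (rule theta_cong)
      fix \<tau> assume adm: "admissible n \<tau>"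
      obtain u w d where \<tau>: "\<tau> = (u, w, d)" by (cases \<tau>)
      have "(if u = arrow_tail \<alpha> \<and> 1 \<le> d \<and> admissible n (arrow_head \<alpha>, w, d - 1)
          then V.ev (\<lambda>w. if w = arrow_head \<alpha> then c \<alpha> else 0) y (arrow_head \<alpha>, w, d - 1) else 0)
        - (if w = arrow_head \<alpha> \<and> 1 \<le> d \<and> admissible n (u, arrow_tail \<alpha>, d - 1)
          then V.ev (\<lambda>w. if w = arrow_tail \<alpha> then c \<alpha> else 0) y (u, arrow_tail \<alpha>, d - 1) else 0) =
        (if u = arrow_tail \<alpha> \<and> w = arrow_head \<alpha> then c \<alpha> * ?y (\<alpha>, d) else 0)" if \<alpha>: "\<alpha> \<in> ?Q" for \<alpha>
      proof (cases "u = arrow_tail \<alpha> \<and> w = arrow_head \<alpha>")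
        case True
        then show ?thesis
          using admissible_arrow_loop[of n \<alpha> d] adm arrow_ends_less[OF \<alpha>]
          by (simp add: \<tau> V.ev_delta algebra_simps)
      next
        case False
        then show ?thesis
          using arrow_ends_less[OF \<alpha>] by (simp add: V.ev_delta)
      qed
      then show "(\<lambda>(u, w, d).
        (\<Sum>\<alpha>\<in>?Q. if u = arrow_tail \<alpha> \<and> 1 \<le> d \<and> admissible n (arrow_head \<alpha>, w, d - 1)
          then V.ev (\<lambda>w. if w = arrow_head \<alpha> then c \<alpha> else 0) y (arrow_head \<alpha>, w, d - 1) else 0)
        - (- 1) ^ 0 * (\<Sum>\<alpha>\<in>?Q. if w = arrow_head \<alpha> \<and> 1 \<le> d \<and> admissible n (u, arrow_tail \<alpha>, d - 1)
          then V.ev (\<lambda>w. if w = arrow_tail \<alpha> then c \<alpha> else 0) y (u, arrow_tail \<alpha>, d - 1) else 0)) \<tau> = E.ev c ?y \<tau>"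
        unfolding \<tau> prod.case E.ev_def power_0 mult_1 sum_subtractf[symmetric] by (intro sum.cong refl)
    qed
  qed
qed

text \<open>At the vertex \<open>j\<close> in degree \<open>d \<ge> 1\<close> only \<open>0 < j < n - 1\<close> is admissible, so the boundary
  vertices do not have to be distinguished.\<close>

definition delta :: "(arrow \<times> nat \<Rightarrow> 'f) \<Rightarrow> nat \<times> nat \<Rightarrow> 'f" where
  "delta y = (\<lambda>(j, d). if d = 0 then 0
    else y (Up (j - 1), d - 1) + y (Down (j - 1), d - 1) - (y (Up j, d - 1) + y (Down j, d - 1)))"

text \<open>Since p = 1, the two sums are added. In each of the two words of sigma_j the cochain
  acts on either letter, and both results are multiples of the same monomial, so the coefficients at
  a_i and a_i^* occur only through their sum.\<close>

lemma b_K_1: "b_K n 1 (E.cochain y) = R.cochain (delta y)"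
proof (rule extensionalityI)
  show "b_K n 1 (E.cochain y) \<in> extensional (W n 2)"
    using E.b_K_extensional by (simp add: numeral_2_eq_2)
  show "R.cochain (delta y) \<in> extensional (W n 2)"
    unfolding R.cochain_def by (rule restrict_extensional)
  fix x :: "'f palg" assume x: "x \<in> W n 2"
  then obtain c where c: "x = relation_comb n c"
    unfolding R.W_eq by (elim rangeE)
  let ?Q = "arcs (double_quiver n)"
  \<comment> \<open>\<open>r\<close> and \<open>l\<close> are the coordinates of what remains of x
    when the first, respectively the last, arrow is split off.\<close>
  define r :: "arrow \<Rightarrow> arrow \<Rightarrow> 'f" where "r \<alpha> = (case \<alpha> of
      Up i \<Rightarrow> (\<lambda>\<beta>. if \<beta> = Down i then - c i else 0) | Down i \<Rightarrow> (\<lambda>\<beta>. if \<beta> = Up i then c (i + 1) else 0))" for \<alpha>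
  define l :: "arrow \<Rightarrow> arrow \<Rightarrow> 'f" where "l \<alpha> = (case \<alpha> of
      Up i \<Rightarrow> (\<lambda>\<beta>. if \<beta> = Down i then c (i + 1) else 0) | Down i \<Rightarrow> (\<lambda>\<beta>. if \<beta> = Up i then - c i else 0))" for \<alpha>
  show "b_K n 1 (E.cochain y) x = R.cochain (delta y) x"
  proof (subst E.b_K_cochain)
    show "x \<in> W n (1 + 1)" using x by (simp add: numeral_2_eq_2)
    show "right_part \<alpha> x = arrow_comb n (r \<alpha>)" if "\<alpha> \<in> ?Q" for \<alpha>
      using that unfolding c r_def by (cases \<alpha>) (simp_all add: right_part_relation_comb)
    show "left_part n \<alpha> x = arrow_comb n (l \<alpha>)" if "\<alpha> \<in> ?Q" for \<alpha>
      using that unfolding c l_def by (cases \<alpha>) (simp_all add: left_part_relation_comb)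
    show "theta n (\<lambda>(u, w, d).
        (\<Sum>\<alpha>\<in>?Q. if u = arrow_tail \<alpha> \<and> 1 \<le> d \<and> admissible n (arrow_head \<alpha>, w, d - 1)
          then E.ev (r \<alpha>) y (arrow_head \<alpha>, w, d - 1) else 0)
        - (- 1) ^ 1 * (\<Sum>\<alpha>\<in>?Q. if w = arrow_head \<alpha> \<and> 1 \<le> d \<and> admissible n (u, arrow_tail \<alpha>, d - 1)
          then E.ev (l \<alpha>) y (u, arrow_tail \<alpha>, d - 1) else 0)) = R.cochain (delta y) x"
      unfolding c R.cochain_G
    proof (rule theta_cong)
      fix \<tau> assume adm: "admissible n \<tau>"
      obtain u w d where \<tau>: "\<tau> = (u, w, d)" by (cases \<tau>)
      have uw: "u < n" "w < n"
        using admissible_less[of n u w d] adm n2 by (simp_all add: \<tau>)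
      let ?s = "\<lambda>\<alpha>. (if u = arrow_tail \<alpha> \<and> 1 \<le> d \<and> admissible n (arrow_head \<alpha>, w, d - 1)
          then E.ev (r \<alpha>) y (arrow_head \<alpha>, w, d - 1) else 0)
        + (if w = arrow_head \<alpha> \<and> 1 \<le> d \<and> admissible n (u, arrow_tail \<alpha>, d - 1)
          then E.ev (l \<alpha>) y (u, arrow_tail \<alpha>, d - 1) else 0)"
      \<comment> \<open>Collected by edges: edge i reaches the vertex u through sigma_i if i = u and
        through sigma_{i+1} if i = u - 1.\<close>
      have step: "?s (Up i) + ?s (Down i) =
          (if i = u then (if u = w \<and> 1 \<le> d then - c u * (y (Up u, d - 1) + y (Down u, d - 1)) else 0) else 0) +
          (if i = u - 1 then (if u = w \<and> 1 \<le> d then c u * (y (Up (u - 1), d - 1) + y (Down (u - 1), d - 1)) else 0) else 0)"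
        if i: "i < n - 1" for i
      proof (cases "u = w \<and> 1 \<le> d")
        case True
        \<comment> \<open>Positivity of u keeps the truncated u - 1 honest.\<close>
        then have *: "0 < u" "admissible n (u - 1, u, d - 1)" "admissible n (u, u - 1, d - 1)"
          "admissible n (u, u + 1, d - 1)" "admissible n (u + 1, u, d - 1)"
          using admissible_loop_arrow[of n u d] adm by (simp_all add: \<tau>)
        consider "i = u" | "u = i + 1" | "i \<noteq> u" "u \<noteq> i + 1" by blast
        then show ?thesis
          by cases (use True i * in \<open>simp_all add: r_def l_def E.ev_delta algebra_simps\<close>)
      next
        case False
        then have "?s (Up i) = 0" "?s (Down i) = 0"
          using i by (simp_all add: r_def l_def E.ev_delta; metis)+
        moreover have "(if i = u then (if u = w \<and> 1 \<le> d then a else 0) else 0) +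
            (if i = u - 1 then (if u = w \<and> 1 \<le> d then b else 0) else 0) = 0" for a b :: 'f
          by (simp only: False if_False if_cancel add_0_left)
        ultimately show ?thesis
          by (simp only: add_0_left)
      qed
      have "(\<Sum>\<alpha>\<in>?Q. ?s \<alpha>) = (\<Sum>i<n - 1. ?s (Up i) + ?s (Down i))"
        by (rule sum_arcs)
      also have "\<dots> = (\<Sum>i<n - 1.
          (if i = u then (if u = w \<and> 1 \<le> d then - c u * (y (Up u, d - 1) + y (Down u, d - 1)) else 0) else 0) +
          (if i = u - 1 then (if u = w \<and> 1 \<le> d then c u * (y (Up (u - 1), d - 1) + y (Down (u - 1), d - 1)) else 0) else 0))"
        by (rule sum.cong) (simp_all only: step lessThan_iff)
      also have "\<dots> = (if u = w \<and> 1 \<le> d then c u * delta y (u, d) else 0)"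
      proof (cases "u = w \<and> 1 \<le> d")
        case True
        then have "0 < u" "u < n - 1"
          using admissible_loop_arrow(1,2)[of n u d] adm by (simp_all add: \<tau>)
        with True show ?thesis
          by (simp add: sum.distrib delta_def algebra_simps)
      next
        case False
        show ?thesis
          by (simp only: False if_False if_cancel add_0_left sum.neutral_const)
      qed
      also have "\<dots> = R.ev c (delta y) \<tau>"
      proof -
        have "R.ev c (delta y) (u, w, d) = (\<Sum>i<n. if i = u then (if u = w then c u * delta y (u, d) else 0) else 0)"
          unfolding R.ev_def prod.case by (rule sum.cong) auto
        also have "\<dots> = (if u = w \<and> 1 \<le> d then c u * delta y (u, d) else 0)"
          using uw by (auto simp: delta_def)
        finally show ?thesis by (simp add: \<tau>)
      qed
      finally show "(\<lambda>(u, w, d).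
        (\<Sum>\<alpha>\<in>?Q. if u = arrow_tail \<alpha> \<and> 1 \<le> d \<and> admissible n (arrow_head \<alpha>, w, d - 1)
          then E.ev (r \<alpha>) y (arrow_head \<alpha>, w, d - 1) else 0)
        - (- 1) ^ 1 * (\<Sum>\<alpha>\<in>?Q. if w = arrow_head \<alpha> \<and> 1 \<le> d \<and> admissible n (u, arrow_tail \<alpha>, d - 1)
          then E.ev (l \<alpha>) y (u, arrow_tail \<alpha>, d - 1) else 0)) \<tau> = R.ev c (delta y) \<tau>"
        unfolding \<tau> prod.case by (simp add: sum.distrib)
    qed
  qed
qed

text \<open>The only possible argument is 0, both of whose parts are the zero combination of
  relations.\<close>

lemma b_K_2:
  assumes "f \<in> carrier (cochains n 2 :: ('f, 'f cochain) module)"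
  shows "b_K n 2 f = \<zero>\<^bsub>cochains n 3\<^esub>"
proof -
  obtain y where f: "f = R.cochain y"
    using R.cochain_surj[OF assms] .
  have "b_K n 2 f x = \<zero>\<^bsub>preproj n\<^esub>" if x: "x \<in> W n 3" for x
  proof -
    have x0: "x = (\<lambda>_. 0)"
      using W_3[OF n3] x by auto
    have 0: "(\<lambda>_. 0) = relation_comb n (\<lambda>_. 0 :: 'f)"
      by (rule ext) (simp add: relation_comb_def split: prod.split)
    have "b_K n 2 (R.cochain y) x = theta n (\<lambda>(u, w, d).
      (\<Sum>\<alpha>\<in>arcs (double_quiver n). if u = arrow_tail \<alpha> \<and> 1 \<le> d \<and> admissible n (arrow_head \<alpha>, w, d - 1)
        then R.ev (\<lambda>_. 0) y (arrow_head \<alpha>, w, d - 1) else 0)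
      - (- 1) ^ 2 * (\<Sum>\<alpha>\<in>arcs (double_quiver n). if w = arrow_head \<alpha> \<and> 1 \<le> d \<and> admissible n (u, arrow_tail \<alpha>, d - 1)
        then R.ev (\<lambda>_. 0) y (u, arrow_tail \<alpha>, d - 1) else 0))"
    proof (rule R.b_K_cochain)
      show "x \<in> W n (2 + 1)" using x by simp
      show "right_part \<alpha> x = relation_comb n (\<lambda>_. 0)" "left_part n \<alpha> x = relation_comb n (\<lambda>_. 0)" for \<alpha>
        unfolding x0 0[symmetric] by (rule ext, simp add: right_part_def left_part_def split: prod.split)+
    qed
    also have "\<dots> = theta n (\<lambda>_. 0)"
      by (rule theta_cong) (simp add: R.ev_def split: prod.split)
    finally show ?thesis
      by (simp add: f V.A.zero_eq)
  qed
  then show ?thesis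
    by (intro extensionalityI[of _ "W n 3"]) (simp_all add: b_K_def cochains_def Let_def)
qed

section \<open>Cohomology in degrees one and two\<close>

lemma sum_atMost_pred: "0 < j \<Longrightarrow> (\<Sum>k\<le>j. g k) = (\<Sum>k\<le>j - 1. g k) + (g j :: 'f)" for j :: nat
  by (cases j) simp_all

text \<open>\<open>delta\<close> is zero in degree 0 by definition. In positive degree it is a
  difference along the line, which is inverted by summation.\<close>

lemma coboundaries_2:
  "coboundaries n 2 = R.cochain ` {y \<in> UNIV. \<forall>i\<in>{0..n - 1}. y (i, 0) = 0}"
proof -
  have cob: "coboundaries n 2 = range (\<lambda>y. R.cochain (delta y))"
  proof -
    have "coboundaries n 2 = b_K n 1 ` range E.cochain"
      unfolding coboundaries_def numeral_2_eq_2 One_nat_def[symmetric] nat.case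
      by (simp only: coordinates.carrier_eq[OF E.coordinates_cochains])
    then show ?thesis
      by (simp only: image_image b_K_1)
  qed
  show ?thesis
    unfolding cob
  proof (intro subset_antisym image_subsetI)
    fix y
    have "\<forall>i\<in>{0..n - 1}. delta y (i, 0) = 0"
      by (simp add: delta_def)
    then show "R.cochain (delta y) \<in> R.cochain ` {y \<in> UNIV. \<forall>i\<in>{0..n - 1}. y (i, 0) = 0}"
      by (intro imageI CollectI conjI UNIV_I)
  next
    fix y assume "y \<in> {y \<in> UNIV. \<forall>i\<in>{0..n - 1}. y (i, 0 :: nat) = (0 :: 'f)}"
    then have y: "y (i, 0) = 0" if "i < n" for i
      using that by simp
    define g where "g d j = (if admissible n (j, j, d) then y (j, d) else 0)" for d j
    \<comment> \<open>The preimage lives on the arrows a_i alone. Its negative partial sums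
      telescope under \<open>delta\<close>, which subtracts the value at j from that at j - 1; the
      index e + 1 undoes the drop in degree.\<close>
    define z where "z = (\<lambda>(\<alpha>, e). case \<alpha> of Up i \<Rightarrow> - (\<Sum>k\<le>i. g (e + 1) k) | Down i \<Rightarrow> 0)"
    have "R.cochain y = R.cochain (delta z)"
      unfolding R.cochain_eq_iff
    proof (intro ballI allI impI)
      fix j d assume j: "j \<in> {..<n}" and adm: "admissible n (j, j, d)"
      show "y (j, d) = delta z (j, d)"
      proof (cases "d = 0")
        case True
        then show ?thesis
          using y j by (simp add: delta_def)
      next
        case False
        then have "0 < j"
          using admissible_loop_arrow(1)[OF adm] by simp
        moreover obtain e where "d = Suc e"
          using False by (cases d) simp_all
        ultimately show ?thesis
          using sum_atMost_pred[of j "g d"] adm by (simp add: delta_def z_def g_def)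
      qed
    qed
    then show "R.cochain y \<in> range (\<lambda>y. R.cochain (delta y))"
      by simp
  qed
qed

lemma HK_2_basis:
  assumes "\<And>i. i \<in> {0..n - 1} \<Longrightarrow> b i = R.cochain (\<lambda>(j, d). if j = i \<and> d = 0 then 1 else 0)"
  shows "basis_family (HK n 2 :: ('f, 'f cochain set) module) (\<lambda>i. HK_class n 2 (b i)) {0..n - 1}"
proof (rule R.HK_basis_familyI[where T = "\<lambda>y i. y (i, 0)" and Y = UNIV, OF _ _ _ _ _ coboundaries_2 _ _ _ _ _ assms])
  show "cocycles n 2 = range R.cochain"
    unfolding cocycles_def coordinates.carrier_eq[OF R.coordinates_cochains, symmetric]
    using b_K_2 by auto
  show "y (j, 0) = 0" if "R.cochain y = \<zero>\<^bsub>cochains n 2\<^esub>" "j \<in> {0..n - 1}" for y j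
  proof -
    have "j < n" using that(2) n3 by auto
    then show ?thesis
      using that(1) unfolding R.cochain_eq_zero_iff by (simp add: admissible_loop_iff)
  qed
qed simp_all

definition cocycle_coords_1 :: "(arrow \<times> nat \<Rightarrow> 'f) set" where
  "cocycle_coords_1 = {y. \<forall>j<n. \<forall>d. admissible n (j, j, d) \<longrightarrow> delta y (j, d) = 0}"

lemma cocycles_1: "cocycles n 1 = E.cochain ` cocycle_coords_1"
proof -
  have "cocycles n 1 = {f \<in> range E.cochain. b_K n 1 f = \<zero>\<^bsub>cochains n 2\<^esub>}"
    unfolding cocycles_def coordinates.carrier_eq[OF E.coordinates_cochains]
    by (simp add: numeral_2_eq_2)
  also have "\<dots> = E.cochain ` {y. b_K n 1 (E.cochain y) = \<zero>\<^bsub>cochains n 2\<^esub>}"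
    by auto
  also have "{y. b_K n 1 (E.cochain y) = \<zero>\<^bsub>cochains n 2\<^esub>} = cocycle_coords_1"
    unfolding b_K_1 R.cochain_eq_zero_iff cocycle_coords_1_def
    by (intro Collect_cong) (simp only: Ball_def lessThan_iff)
  finally show ?thesis .
qed

definition total :: "(arrow \<times> nat \<Rightarrow> 'f) \<Rightarrow> nat \<Rightarrow> nat \<Rightarrow> 'f" where
  "total y i d = y (Up i, d) + y (Down i, d)"

text \<open>The cocycle condition at the vertex i + 1 in degree 2l + 2 equates the sums on the edges
  i and i + 1; it is available as long as that loop is admissible.\<close>

lemma total_const:
  assumes y: "y \<in> cocycle_coords_1" and "l \<le> i" "i + l + 2 \<le> n"
  shows "total y i (2 * l + 1) = total y l (2 * l + 1)"
  using assms(2,3)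
proof (induction i rule: dec_induct)
  case (step i)
  have "admissible n (Suc i, Suc i, 2 * l + 2)"
    unfolding admissible_loop_iff using step by simp
  then have "delta y (Suc i, 2 * l + 2) = 0"
    using y step unfolding cocycle_coords_1_def by simp
  then have "total y i (2 * l + 1) = total y (Suc i) (2 * l + 1)"
    by (simp add: delta_def total_def)
  then show ?case
    using step by simp
qed simp

text \<open>If all sums vanish, the coefficient at a_i^* is minus that at a_i, and the coefficients
  at the a_i are the differences of a function on the vertices of a line. By
  \<open>total_const\<close> one sum per degree has to be tested.\<close>

lemma coboundaries_1:
  assumes m: "m = (n - 1) div 2"
  shows "coboundaries n 1 = E.cochain ` {y \<in> cocycle_coords_1. \<forall>l\<in>{0..n - 2 - m}. total y l (2 * l + 1) = 0}"
proof -
  let ?d = "\<lambda>y (\<alpha>, d). y (arrow_head \<alpha>, d - 1) - y (arrow_tail \<alpha>, d - 1) :: 'f"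
  have cob: "coboundaries n 1 = range (\<lambda>y. E.cochain (?d y))"
  proof -
    have "coboundaries n 1 = b_K n 0 ` range V.cochain"
      unfolding coboundaries_def One_nat_def nat.case
      by (simp only: coordinates.carrier_eq[OF V.coordinates_cochains])
    then show ?thesis
      by (simp add: image_image b_K_0)
  qed
  show ?thesis
    unfolding cob
  proof (intro subset_antisym image_subsetI)
    fix y :: "nat \<times> nat \<Rightarrow> 'f"
    \<comment> \<open>A coboundary is a cocycle because \<open>delta\<close> sees only sums, and
      here the two terms of each sum are opposite.\<close>
    have "?d y \<in> cocycle_coords_1"
      unfolding cocycle_coords_1_def by (simp add: delta_def)
    moreover have "\<forall>l\<in>{0..n - 2 - m}. total (?d y) l (2 * l + 1) = 0"
      by (simp add: total_def)
    ultimately show "E.cochain (?d y) \<in>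
        E.cochain ` {y \<in> cocycle_coords_1. \<forall>l\<in>{0..n - 2 - m}. total y l (2 * l + 1) = 0}"
      by (intro imageI CollectI conjI)
  next
    fix y assume "y \<in> {y \<in> cocycle_coords_1. \<forall>l\<in>{0..n - 2 - m}. total y l (2 * l + 1) = 0}"
    then have y: "y \<in> cocycle_coords_1" and 0: "\<And>l. l \<le> n - 2 - m \<Longrightarrow> total y l (2 * l + 1) = 0"
      by simp_all
    define g where "g d k = (if admissible n (k, Suc k, d) then y (Up k, d) else 0)" for d k
    \<comment> \<open>A potential for the coefficients at the a_k, starting with 0 at vertex 0; the
      differential raises the degree, hence d + 1.\<close>
    define z where "z = (\<lambda>(i, d). \<Sum>k<i. g (d + 1) k)"
    have "E.cochain y = E.cochain (?d z)"
      unfolding E.cochain_eq_iff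
    proof (intro ballI allI impI)
      fix \<alpha> d assume \<alpha>: "\<alpha> \<in> arcs (double_quiver n)" and adm: "admissible n (arrow_tail \<alpha>, arrow_head \<alpha>, d)"
      have d: "1 \<le> d"
        by (rule admissible_arrow_loop(1)[OF adm])
      obtain i where i: "\<alpha> = Up i \<or> \<alpha> = Down i"
        by (cases \<alpha>) auto
      then have adm': "admissible n (i, Suc i, d)"
        using adm by (auto simp: admissible_edge_iff)
      have z: "z (Suc i, d - 1) - z (i, d - 1) = y (Up i, d)"
        using d adm' by (simp add: z_def g_def)
      obtain l where l: "d = 2 * l + 1" "l \<le> i" "i + l + 2 \<le> n"
        using adm' n3 unfolding admissible_edge_iff by (elim conjE oddE) auto
      \<comment> \<open>Since 2l + 2 <= n: the bound is exactly the nonemptiness of the segment of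
        edges in degree 2l + 1.\<close>
      have "l \<le> n - 2 - m"
        using l(2,3) unfolding m by linarith
      then have "total y i d = 0"
        using total_const[OF y l(2,3)] 0[of l] by (simp add: l(1))
      then have "y (Down i, d) = - y (Up i, d)"
        by (simp add: total_def add_eq_0_iff)
      then show "y (\<alpha>, d) = ?d z (\<alpha>, d)"
        using i z by (auto simp: algebra_simps)
    qed
    then show "E.cochain y \<in> range (\<lambda>y. E.cochain (?d y))"
      by simp
  qed
qed

lemma HK_1_basis:
  assumes m: "m = (n - 1) div 2"
    and b: "\<And>l. l \<in> {0..n - 2 - m} \<Longrightarrow>
      b l = E.cochain (\<lambda>(\<alpha>, d). case \<alpha> of Up i \<Rightarrow> if d = 2 * l + 1 then 1 else 0 | Down i \<Rightarrow> 0)"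
  shows "basis_family (HK n 1 :: ('f, 'f cochain set) module) (\<lambda>l. HK_class n 1 (b l)) {0..n - 2 - m}"
proof (rule E.HK_basis_familyI[where T = "\<lambda>y l. total y l (2 * l + 1)", OF _ cocycles_1 _ _ _ coboundaries_1[OF m] _ _ _ _ _ b])
  show "(\<lambda>_. 0) \<in> cocycle_coords_1"
    by (simp add: cocycle_coords_1_def delta_def)
  show "(\<lambda>a. y a + y' a) \<in> cocycle_coords_1" if "y \<in> cocycle_coords_1" "y' \<in> cocycle_coords_1" for y y'
  proof -
    have "delta (\<lambda>a. y a + y' a) a = delta y a + delta y' a" for a
      by (simp add: delta_def split: prod.split)
    then show ?thesis
      using that by (simp add: cocycle_coords_1_def)
  qed
  show "(\<lambda>a. c * y a) \<in> cocycle_coords_1" if "y \<in> cocycle_coords_1" for c y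
  proof -
    have "delta (\<lambda>a. c * y a) a = c * delta y a" for a
      by (simp add: delta_def algebra_simps split: prod.split)
    then show ?thesis
      using that by (simp add: cocycle_coords_1_def)
  qed
  show "total y l (2 * l + 1) = 0" if "E.cochain y = \<zero>\<^bsub>cochains n 1\<^esub>" "l \<in> {0..n - 2 - m}" for y l
  proof -
    have l: "l + l + 2 \<le> n"
      using that(2) n3 unfolding m by auto
    then have "admissible n (l, Suc l, 2 * l + 1)" "admissible n (Suc l, l, 2 * l + 1)" "l < n - 1"
      unfolding admissible_edge_iff by auto
    then have "y (Up l, 2 * l + 1) = 0" "y (Down l, 2 * l + 1) = 0"
      using that(1)[unfolded E.cochain_eq_zero_iff, THEN bspec, of "Up l"]
        that(1)[unfolded E.cochain_eq_zero_iff, THEN bspec, of "Down l"] by simp_all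
    then show ?thesis
      by (simp add: total_def)
  qed
  show "(\<lambda>(\<alpha>, d). case \<alpha> of Up i \<Rightarrow> if d = 2 * l + 1 then 1 else 0 | Down i \<Rightarrow> 0) \<in> cocycle_coords_1"
    if "l \<in> {0..n - 2 - m}" for l
    by (simp add: cocycle_coords_1_def delta_def)
qed (simp_all add: total_def algebra_simps)

section \<open>The centre and cohomology in degree zero\<close>

definition cocycle_coords_0 :: "(nat \<times> nat \<Rightarrow> 'f) set" where
  "cocycle_coords_0 = {y. \<forall>\<alpha>\<in>arcs (double_quiver n). \<forall>d.
    admissible n (arrow_tail \<alpha>, arrow_head \<alpha>, d) \<longrightarrow> y (arrow_head \<alpha>, d - 1) - y (arrow_tail \<alpha>, d - 1) = 0}"

lemma cocycles_0: "cocycles n 0 = V.cochain ` cocycle_coords_0"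
proof -
  have "cocycles n 0 = {f \<in> range V.cochain. b_K n 0 f = \<zero>\<^bsub>cochains n 1\<^esub>}"
    unfolding cocycles_def coordinates.carrier_eq[OF V.coordinates_cochains] by simp
  also have "\<dots> = V.cochain ` {y. b_K n 0 (V.cochain y) = \<zero>\<^bsub>cochains n 1\<^esub>}"
    by auto
  also have "{y. b_K n 0 (V.cochain y) = \<zero>\<^bsub>cochains n 1\<^esub>} = cocycle_coords_0"
    unfolding b_K_0 E.cochain_eq_zero_iff cocycle_coords_0_def by simp
  finally show ?thesis .
qed

lemma cocycle_coords_0_linear:
  "(\<lambda>_. 0) \<in> cocycle_coords_0"
  "y \<in> cocycle_coords_0 \<Longrightarrow> y' \<in> cocycle_coords_0 \<Longrightarrow> (\<lambda>a. y a + y' a) \<in> cocycle_coords_0"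
  "y \<in> cocycle_coords_0 \<Longrightarrow> (\<lambda>a. c * y a) \<in> cocycle_coords_0"
  by (simp_all add: cocycle_coords_0_def)

text \<open>The cocycle condition on the edge i in degree 2l + 1 equates the values at i and i + 1
  in degree 2l.\<close>

lemma cocycle_coords_0_const:
  assumes y: "y \<in> cocycle_coords_0" and "l \<le> i" "i + l + 1 \<le> n"
  shows "y (i, 2 * l) = y (l, 2 * l)"
  using assms(2,3)
proof (induction i rule: dec_induct)
  case (step i)
  have adm: "admissible n (i, Suc i, 2 * l + 1)"
    unfolding admissible_edge_iff using step by auto
  have "Up i \<in> arcs (double_quiver n)"
    using step by simp
  from y[unfolded cocycle_coords_0_def, THEN CollectD, THEN bspec, OF this, THEN spec, of "2 * l + 1"] adm
  have "y (Suc i, 2 * l) = y (i, 2 * l)"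
    by simp
  then show ?case
    using step by simp
qed simp

lemma admissible_loopE:
  assumes "admissible n (i, i, d)"
  obtains l where "d = 2 * l" "l \<le> i" "i + l + 1 \<le> n"
  using assms n3 unfolding admissible_loop_iff by (elim conjE evenE) auto

text \<open>On each segment a cocycle is constant, so its value at the left end l decides; the
  segment for degree 2l is nonempty exactly if l <= m.\<close>

lemma cocycle_coords_0_zero_iff:
  assumes m: "m = (n - 1) div 2" and y: "y \<in> cocycle_coords_0"
  shows "(\<forall>i\<in>{..<n}. \<forall>d. admissible n (i, i, d) \<longrightarrow> y (i, d) = 0) \<longleftrightarrow> (\<forall>l\<in>{0..m}. y (l, 2 * l) = 0)"
proof
  assume 0: "\<forall>i\<in>{..<n}. \<forall>d. admissible n (i, i, d) \<longrightarrow> y (i, d) = 0"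
  show "\<forall>l\<in>{0..m}. y (l, 2 * l) = 0"
  proof
    fix l assume "l \<in> {0..m}"
    then have "l + l + 1 \<le> n" using n3 unfolding m by auto
    then have "l < n" "admissible n (l, l, 2 * l)"
      by (auto simp: admissible_loop_iff)
    then show "y (l, 2 * l) = 0"
      using 0 by simp
  qed
next
  assume 0: "\<forall>l\<in>{0..m}. y (l, 2 * l) = 0"
  show "\<forall>i\<in>{..<n}. \<forall>d. admissible n (i, i, d) \<longrightarrow> y (i, d) = 0"
  proof (intro ballI allI impI)
    fix i d assume "admissible n (i, i, d)"
    then obtain l where l: "d = 2 * l" "l \<le> i" "i + l + 1 \<le> n"
      by (rule admissible_loopE)
    have "l \<in> {0..m}"
      using l(2,3) unfolding m by auto
    then show "y (i, d) = 0"
      using 0 cocycle_coords_0_const[OF y l(2,3)] by (simp add: l(1))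
  qed
qed

lemma HK_0_basis:
  assumes m: "m = (n - 1) div 2"
    and b: "\<And>l. l \<in> {0..m} \<Longrightarrow> b l = V.cochain (\<lambda>(i, d). if d = 2 * l then 1 else 0)"
  shows "basis_family (HK n 0 :: ('f, 'f cochain set) module) (\<lambda>l. HK_class n 0 (b l)) {0..m}"
proof (rule V.HK_basis_familyI[where T = "\<lambda>y l. y (l, 2 * l)", OF _ cocycles_0 cocycle_coords_0_linear _ _ _ _ _ _ b])
  have "coboundaries n 0 = {\<zero>\<^bsub>cochains n 0\<^esub> :: 'f cochain}"
    by (simp add: coboundaries_def)
  \<comment> \<open>Although only zero is divided out, the functionals have to describe it in
    coordinates, where several functions represent the zero cochain.\<close>
  also have "\<dots> = V.cochain ` {y \<in> cocycle_coords_0. V.cochain y = \<zero>\<^bsub>cochains n 0\<^esub>}"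
    using cocycle_coords_0_linear(1) coordinates.zero_eq[OF V.coordinates_cochains] by auto
  also have "{y \<in> cocycle_coords_0. V.cochain y = \<zero>\<^bsub>cochains n 0\<^esub>} =
      {y \<in> cocycle_coords_0. \<forall>l\<in>{0..m}. y (l, 2 * l) = 0}"
    unfolding V.cochain_eq_zero_iff using cocycle_coords_0_zero_iff[OF m] by (simp cong: conj_cong)
  finally show "coboundaries n 0 = V.cochain ` {y \<in> cocycle_coords_0. \<forall>l\<in>{0..m}. y (l, 2 * l) = 0}" .
  show "y (l, 2 * l) = 0"
    if "y \<in> cocycle_coords_0" "V.cochain y = \<zero>\<^bsub>cochains n 0\<^esub>" "l \<in> {0..m}" for y l
    using that(2,3) cocycle_coords_0_zero_iff[OF m that(1)] unfolding V.cochain_eq_zero_iff by simp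
qed (simp_all add: cocycle_coords_0_def)

section \<open>The centre of the preprojective algebra\<close>

text \<open>The element of the sum of the e_i A e_i with the coordinates of a 0-cochain;
  \<open>cochain_of_elt_diag\<close> confirms the identification.\<close>

definition diag :: "(nat \<times> nat \<Rightarrow> 'f) \<Rightarrow> 'f palg set" where
  "diag y = theta n (\<lambda>(u, v, d). if u = v then y (u, d) else 0)"

text \<open>A product splits off a loop of some degree f at the end w on one side and at the start u
  on the other. If the monomial from u to w is admissible with and without this loop, both vertices
  lie in the segment of degree f, where \<open>y\<close> is constant.\<close>

lemma diag_central:
  assumes y: "y \<in> cocycle_coords_0"
  shows "diag y \<otimes>\<^bsub>preproj n\<^esub> theta n Z = theta n Z \<otimes>\<^bsub>preproj n\<^esub> diag y"
  unfolding diag_def theta_mult[OF n2]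
proof (rule theta_cong)
  fix \<tau> assume adm: "admissible n \<tau>"
  obtain u w d where \<tau>: "\<tau> = (u, w, d)" by (cases \<tau>)
  have uw: "u < n" "w < n"
    using admissible_less[of n u w d] adm n2 by (simp_all add: \<tau>)
  let ?Z = "\<lambda>e. if admissible n (u, w, e) then Z (u, w, e) else 0"
  have L: "(\<Sum>v<n. (if admissible n (v, w, d - e) then (if v = w then y (v, d - e) else 0) else 0) *
      (if admissible n (u, v, e) then Z (u, v, e) else 0)) =
      (if admissible n (w, w, d - e) then y (w, d - e) else 0) * ?Z e" for e
  proof -
    have "(\<Sum>v<n. (if admissible n (v, w, d - e) then (if v = w then y (v, d - e) else 0) else 0) *
        (if admissible n (u, v, e) then Z (u, v, e) else 0)) =
        (\<Sum>v<n. if v = w then (if admissible n (w, w, d - e) then y (w, d - e) else 0) * ?Z e else 0)"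
      by (rule sum.cong) simp_all
    then show ?thesis
      using uw by simp
  qed
  have R: "(\<Sum>v<n. (if admissible n (v, w, d - e) then Z (v, w, d - e) else 0) *
      (if admissible n (u, v, e) then (if u = v then y (u, e) else 0) else 0)) =
      ?Z (d - e) * (if admissible n (u, u, e) then y (u, e) else 0)" for e
  proof -
    have "(\<Sum>v<n. (if admissible n (v, w, d - e) then Z (v, w, d - e) else 0) *
        (if admissible n (u, v, e) then (if u = v then y (u, e) else 0) else 0)) =
        (\<Sum>v<n. if v = u then ?Z (d - e) * (if admissible n (u, u, e) then y (u, e) else 0) else 0)"
      by (rule sum.cong) simp_all
    then show ?thesis
      using uw by simp
  qed
  have "(\<Sum>e\<le>d. (if admissible n (w, w, d - e) then y (w, d - e) else 0) * ?Z e) =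
      (\<Sum>e\<le>d. ?Z e * (if admissible n (u, u, d - e) then y (u, d - e) else 0))"
  proof (rule sum.cong)
    fix e assume "e \<in> {..d}"
    then have e: "e \<le> d" by simp
    show "(if admissible n (w, w, d - e) then y (w, d - e) else 0) * ?Z e =
        ?Z e * (if admissible n (u, u, d - e) then y (u, d - e) else 0)"
    proof (cases "admissible n (u, w, e)")
      case True
      obtain f where f: "d = e + f" using e le_Suc_ex by blast
      have "even (u + w + e)" "even (u + w + (e + f))"
        using True adm unfolding \<tau> f admissible_def by simp_all
      then have "even f"
        by (metis add.assoc even_add)
      \<comment> \<open>From e + f <= u + w and w <= u + e, and symmetrically for w and for the
        other end of the quiver.\<close>
      moreover have "f \<le> 2 * u" "f \<le> 2 * w" "2 * u + f \<le> 2 * (n - 1)" "2 * w + f \<le> 2 * (n - 1)"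
        using True adm unfolding \<tau> f admissible_def by simp_all
      ultimately obtain l where l: "f = 2 * l" "l \<le> u" "l \<le> w" "u + l + 1 \<le> n" "w + l + 1 \<le> n"
        using n3 by (elim evenE) auto
      have "admissible n (u, u, d - e)" "admissible n (w, w, d - e)"
        using l unfolding admissible_loop_iff f by auto
      moreover have "y (u, d - e) = y (w, d - e)"
        using cocycle_coords_0_const[OF y l(2,4)] cocycle_coords_0_const[OF y l(3,5)] by (simp add: f l(1))
      ultimately show ?thesis by simp
    qed simp
  qed simp
  \<comment> \<open>The summation index is the degree of the right factor, which is \<open>Z\<close>
    on one side and the diagonal element on the other.\<close>
  also have "\<dots> = (\<Sum>e\<le>d. ?Z (d - e) * (if admissible n (u, u, e) then y (u, e) else 0))"
    by (rule sum.reindex_bij_witness[of _ "\<lambda>e. d - e" "\<lambda>e. d - e"]) simp_all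
  finally show "(\<lambda>(u, w, d). \<Sum>e\<le>d. \<Sum>v<n.
      (if admissible n (v, w, d - e) then (\<lambda>(u, v, d). if u = v then y (u, d) else 0) (v, w, d - e) else 0) *
      (if admissible n (u, v, e) then Z (u, v, e) else 0)) \<tau> =
    (\<lambda>(u, w, d). \<Sum>e\<le>d. \<Sum>v<n. (if admissible n (v, w, d - e) then Z (v, w, d - e) else 0) *
      (if admissible n (u, v, e) then (\<lambda>(u, v, d). if u = v then y (u, d) else 0) (u, v, e) else 0)) \<tau>"
    unfolding \<tau> prod.case L R .
qed

text \<open>Commuting with the vertices e_v kills the monomials with different ends; commuting with
  an arrow equates the loop coefficients at its two ends.\<close>

lemma central_diag:
  assumes comm: "\<And>x. x \<in> carrier (preproj n) \<Longrightarrow>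
    theta n Z \<otimes>\<^bsub>preproj n\<^esub> x = x \<otimes>\<^bsub>preproj n\<^esub> (theta n Z :: 'f palg set)"
  obtains y where "y \<in> cocycle_coords_0" "theta n Z = diag y"
proof -
  have comm': "theta n Z \<otimes>\<^bsub>preproj n\<^esub> theta n X = theta n X \<otimes>\<^bsub>preproj n\<^esub> theta n Z" for X
    by (rule comm) (simp add: V.A.mk_closed)
  have off: "Z (u, v, d) = 0" if "admissible n (u, v, d)" "u \<noteq> v" for u v d
  proof -
    \<comment> \<open>The test element is e_v: it fixes a monomial ending at v from the left and
      annihilates one starting at u from the right.\<close>
    let ?c = "\<lambda>w. if w = v then 1 else 0 :: 'f"
    note c = comm'[of "\<lambda>(u, v, d). if u = v \<and> d = 0 then ?c u else 0",
      unfolded theta_mult_diag[OF n2] theta_diag_mult[OF n2] theta_eq_iff[OF n2], rule_format, OF that(1)]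
    then show ?thesis
      using that admissible_diag[OF that(1)] by simp
  qed
  define y where "y = (\<lambda>(i, d). Z (i, i, d))"
  have "y \<in> cocycle_coords_0"
    unfolding cocycle_coords_0_def
  proof (intro CollectI ballI allI impI)
    fix \<alpha> d assume \<alpha>: "\<alpha> \<in> arcs (double_quiver n)" and adm: "admissible n (arrow_tail \<alpha>, arrow_head \<alpha>, d)"
    note c = comm'[of "\<lambda>\<tau>. if \<tau> = (arrow_tail \<alpha>, arrow_head \<alpha>, 1) then 1 else 0",
      unfolded theta_mult_mono[OF n2] theta_mono_mult[OF n2] theta_eq_iff[OF n2], rule_format, OF adm]
    then show "y (arrow_head \<alpha>, d - 1) - y (arrow_tail \<alpha>, d - 1) = 0"
      using admissible_arrow_loop[OF adm] admissible_arrow[OF \<alpha>] by (simp add: y_def)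
  qed
  moreover have "theta n Z = diag y"
    unfolding diag_def
  proof (rule theta_cong)
    fix \<tau> assume "admissible n \<tau>"
    moreover obtain u v d where "\<tau> = (u, v, d)" by (cases \<tau>)
    ultimately show "Z \<tau> = (\<lambda>(u, v, d). if u = v then y (u, d) else 0) \<tau>"
      using off[of u v d] by (simp add: y_def)
  qed
  ultimately show thesis by (rule that)
qed

text \<open>The coordinate space is that of the 0-cocycles, which is the identification of the
  centre with HK^0(A).\<close>

lemma coordinates_centre: "coordinates (centre n :: ('f, 'f palg set) module) cocycle_coords_0 diag"
proof
  show "carrier (centre n :: ('f, 'f palg set) module) = diag ` cocycle_coords_0"
  proof
    show "carrier (centre n :: ('f, 'f palg set) module) \<subseteq> diag ` cocycle_coords_0"
    proof
      fix z :: "'f palg set" assume "z \<in> carrier (centre n)"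
      then have z: "z \<in> carrier (preproj n)"
        and comm: "\<And>x. x \<in> carrier (preproj n) \<Longrightarrow> z \<otimes>\<^bsub>preproj n\<^esub> x = x \<otimes>\<^bsub>preproj n\<^esub> z"
        by (simp_all add: centre_def)
      from z obtain Z where Z: "z = theta n Z"
        unfolding V.A.carrier_eq by (elim rangeE)
      from comm[unfolded Z] obtain y where "y \<in> cocycle_coords_0" "theta n Z = diag y"
        by (rule central_diag)
      then show "z \<in> diag ` cocycle_coords_0"
        unfolding Z by (intro image_eqI)
    qed
    show "diag ` cocycle_coords_0 \<subseteq> carrier (centre n :: ('f, 'f palg set) module)"
    proof (rule image_subsetI)
      fix y assume y: "y \<in> cocycle_coords_0"
      have "diag y \<in> carrier (preproj n)"
        unfolding diag_def by (simp add: V.A.mk_closed)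
      moreover have "diag y \<otimes>\<^bsub>preproj n\<^esub> x = x \<otimes>\<^bsub>preproj n\<^esub> diag y" if x: "x \<in> carrier (preproj n)" for x
      proof -
        obtain Z where "x = theta n Z"
          using x unfolding V.A.carrier_eq by (elim rangeE)
        then show ?thesis
          using diag_central[OF y, of Z] by simp
      qed
      ultimately show "diag y \<in> carrier (centre n)"
        by (simp add: centre_def)
    qed
  qed
  show "\<zero>\<^bsub>centre n\<^esub> = diag (\<lambda>_. 0)"
    unfolding diag_def by (simp add: centre_def V.A.zero_eq) (rule theta_cong, simp split: prod.split)
  show "diag y \<oplus>\<^bsub>centre n\<^esub> diag y' = diag (\<lambda>a. y a + y' a)" for y y'
    unfolding diag_def by (simp add: centre_def V.A.add_eq) (rule theta_cong, simp split: prod.split)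
  show "c \<odot>\<^bsub>centre n\<^esub> diag y = diag (\<lambda>a. c * y a)" for c y
    unfolding diag_def by (simp add: centre_def V.A.smult_eq) (rule theta_cong, simp split: prod.split)
qed (simp_all add: cocycle_coords_0_linear)

lemma diag_eq_zero_iff:
  "diag y = \<zero>\<^bsub>centre n\<^esub> \<longleftrightarrow> (\<forall>i\<in>{..<n}. \<forall>d. admissible n (i, i, d) \<longrightarrow> y (i, d) = 0)"
proof -
  have "diag y = \<zero>\<^bsub>centre n\<^esub> \<longleftrightarrow> (\<forall>\<tau>. admissible n \<tau> \<longrightarrow> (\<lambda>(u, v, d). if u = v then y (u, d) else 0) \<tau> = 0)"
    unfolding diag_def centre_def by (simp add: V.A.zero_eq theta_eq_iff[OF n2])
  also have "\<dots> \<longleftrightarrow> (\<forall>i d. admissible n (i, i, d) \<longrightarrow> y (i, d) = 0)"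
    by auto
  also have "\<dots> \<longleftrightarrow> (\<forall>i\<in>{..<n}. \<forall>d. admissible n (i, i, d) \<longrightarrow> y (i, d) = 0)"
    using admissible_less(1)[of n] n2 by (metis One_nat_def Suc_1 Suc_leD lessThan_iff)
  finally show ?thesis .
qed

lemma centre_basis:
  assumes m: "m = (n - 1) div 2"
    and b: "\<And>l. l \<in> {0..m} \<Longrightarrow> b l = diag (\<lambda>(i, d). if d = 2 * l then 1 else 0)"
  shows "basis_family (centre n :: ('f, 'f palg set) module) b {0..m}"
proof (rule coordinates.basis_familyI[where T = "\<lambda>y l. y (l, 2 * l)", OF coordinates_centre _ _ _ _ _ _ b])
  show "diag y = \<zero>\<^bsub>centre n\<^esub> \<longleftrightarrow> (\<forall>l\<in>{0..m}. y (l, 2 * l) = 0)" if "y \<in> cocycle_coords_0" for y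
    unfolding diag_eq_zero_iff by (rule cocycle_coords_0_zero_iff[OF m that])
qed (simp_all add: cocycle_coords_0_def)

section \<open>The elements \<open>z\<^sub>\<ell>\<close> and the cochains \<open>\<zeta>\<^sub>\<ell>\<close>, \<open>h\<^sub>i\<close> in coordinates\<close>

lemma preproj_pow:
  "x [^]\<^bsub>preproj n\<^esub> (0 :: nat) = \<one>\<^bsub>preproj n\<^esub>"
  "x [^]\<^bsub>preproj n\<^esub> Suc k = x [^]\<^bsub>preproj n\<^esub> k \<otimes>\<^bsub>preproj n\<^esub> x"
  by (simp_all add: nat_pow_def)

lemma preproj_one:
  "\<one>\<^bsub>preproj n\<^esub> = (theta n (\<lambda>(u, v, d). if u = v \<and> d = 0 then 1 else 0) :: 'f palg set)"
  unfolding proj_one vertex_comb_one[symmetric] by (rule proj_vertex_comb[OF n2])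

lemma loop_eq:
  assumes "i < n - 1"
  shows "loop n i = (theta n (\<lambda>\<tau>. if \<tau> = (i, i, 2) then 1 else 0) :: 'f palg set)"
proof -
  have "proj n (arrow_elt (Down i)) \<otimes>\<^bsub>preproj n\<^esub> proj n (arrow_elt (Up i)) =
      (proj n (path_elt (i, [Up i, Down i])) :: 'f palg set)"
    using proj_Cons[OF n2, of "Up i" "[Down i]" i, where ?'f = 'f] assms by (simp add: arrow_elt_def)
  also have "\<dots> = theta n (\<lambda>\<tau>. if \<tau> = (i, i, length [Up i, Down i]) then 1 else 0)"
    using assms by (intro proj_path_elt[OF n2]) simp
  finally show ?thesis
    by (simp add: loop_def numeral_2_eq_2)
qed

text \<open>For \<open>l = 0\<close> the power is the unit of the whole algebra and not \<open>e\<^sub>i\<close>.\<close>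

lemma loop_pow:
  assumes i: "i < n - 1"
  shows "loop n i [^]\<^bsub>preproj n\<^esub> l =
    (theta n (\<lambda>(u, v, d). if u = v \<and> d = 2 * l \<and> (l = 0 \<or> u = i) then 1 else 0) :: 'f palg set)"
proof (induction l)
  case 0
  show ?case
    by (simp add: preproj_pow(1) preproj_one)
next
  case (Suc l)
  show ?case
    unfolding preproj_pow(2) Suc unfolding loop_eq[OF i] theta_mult_mono[OF n2]
  proof (rule theta_cong)
    fix \<tau> assume adm: "admissible n \<tau>"
    obtain u w d where \<tau>: "\<tau> = (u, w, d)" by (cases \<tau>)
    have *: "2 \<le> d \<and> admissible n (i, i, 2) \<and> admissible n (i, w, d - 2)" if "u = i" "w = i" "d = 2 * Suc l"
      using adm unfolding \<tau> that admissible_loop_iff by simp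
    have d: "2 \<le> d \<and> d - 2 = 2 * l \<longleftrightarrow> d = 2 * Suc l"
      by auto
    show "(\<lambda>(u, w, d). if u = i \<and> 2 \<le> d \<and> admissible n (i, i, 2) \<and> admissible n (i, w, d - 2)
        then (\<lambda>(u, v, d). if u = v \<and> d = 2 * l \<and> (l = 0 \<or> u = i) then 1 else 0) (i, w, d - 2) else 0) \<tau> =
      (\<lambda>(u, v, d). if u = v \<and> d = 2 * Suc l \<and> (Suc l = 0 \<or> u = i) then 1 else (0 :: 'f)) \<tau>"
      unfolding \<tau> prod.case
    proof (cases "u = i \<and> w = i \<and> d = 2 * Suc l")
      case True
      with * show "(if u = i \<and> 2 \<le> d \<and> admissible n (i, i, 2) \<and> admissible n (i, w, d - 2)
          then if i = w \<and> d - 2 = 2 * l \<and> (l = 0 \<or> i = i) then 1 else 0 else 0) =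
        (if u = w \<and> d = 2 * Suc l \<and> (Suc l = 0 \<or> u = i) then 1 else (0 :: 'f))"
        by simp
    next
      case False
      with d show "(if u = i \<and> 2 \<le> d \<and> admissible n (i, i, 2) \<and> admissible n (i, w, d - 2)
          then if i = w \<and> d - 2 = 2 * l \<and> (l = 0 \<or> i = i) then 1 else 0 else 0) =
        (if u = w \<and> d = 2 * Suc l \<and> (Suc l = 0 \<or> u = i) then 1 else (0 :: 'f))"
        by auto
    qed
  qed
qed

text \<open>Outside the segment for l the power of a loop is an inadmissible monomial, hence zero,
  so any \<open>S\<close> containing the segment gives the same sum. Both ranges of summation for
  z_l are instances. For l = 0 every summand would be the full unit, hence l >= 1.\<close>

lemma loop_pow_sum:
  assumes "finite S" "S \<subseteq> {..<n - 1}" and l: "l \<ge> 1"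
    and S: "\<And>u. l \<le> u \<Longrightarrow> u + l + 1 \<le> n \<Longrightarrow> u \<in> S"
  shows "(\<Oplus>\<^bsub>preproj n\<^esub>i\<in>S. loop n i [^]\<^bsub>preproj n\<^esub> l) = diag (\<lambda>(i, d). if d = 2 * l then 1 else 0)"
proof -
  interpret A': abelian_group "preproj n :: ('f, 'f palg set) module"
    by (rule V.A.abelian_group)
  let ?Z = "\<lambda>i (u, v, d). if u = v \<and> d = 2 * l \<and> (l = 0 \<or> u = i) then 1 else 0 :: 'f"
  have "(\<Oplus>\<^bsub>preproj n\<^esub>i\<in>S. loop n i [^]\<^bsub>preproj n\<^esub> l) = (\<Oplus>\<^bsub>preproj n\<^esub>i\<in>S. theta n (?Z i))"
  proof (rule A'.finsum_cong')
    fix i assume "i \<in> S"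
    then have "i < n - 1" using assms(2) by auto
    then show "loop n i [^]\<^bsub>preproj n\<^esub> l = theta n (?Z i)"
      by (rule loop_pow)
  qed (simp_all add: V.A.mk_closed)
  also have "\<dots> = theta n (\<lambda>\<tau>. \<Sum>i\<in>S. ?Z i \<tau>)"
    by (rule V.A.finsum_eq[OF assms(1)]) simp
  also have "\<dots> = diag (\<lambda>(i, d). if d = 2 * l then 1 else 0)"
    unfolding diag_def
  proof (rule theta_cong)
    fix \<tau> assume adm: "admissible n \<tau>"
    obtain u w d where \<tau>: "\<tau> = (u, w, d)" by (cases \<tau>)
    have "(\<Sum>i\<in>S. ?Z i (u, w, d)) = (\<Sum>i\<in>S. if i = u then (if u = w \<and> d = 2 * l then 1 else 0) else 0)"
      by (rule sum.cong) (use l in auto)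
    also have "\<dots> = (if u \<in> S then (if u = w \<and> d = 2 * l then 1 else 0) else 0)"
      by (rule sum.delta[OF assms(1)])
    also have "\<dots> = (if u = w \<and> d = 2 * l then 1 else 0)"
    proof (cases "u = w \<and> d = 2 * l")
      case True
      then have "admissible n (u, u, 2 * l)"
        using adm by (simp add: \<tau>)
      then have "u \<in> S"
        by (rule admissible_loopE) (rule S, simp_all)
      then show ?thesis by simp
    next
      case False
      show ?thesis
        by (simp only: False if_False if_cancel)
    qed
    finally show "(\<Sum>i\<in>S. ?Z i \<tau>) =
        (\<lambda>(u, v, d). if u = v then (\<lambda>(i, d). if d = 2 * l then 1 else 0) (u, d) else 0) \<tau>"
      unfolding \<tau> by simp
  qed
  finally show ?thesis .
qed

lemma zelt_eq:
  assumes m: "m = (n - 1) div 2" and l: "l \<le> m"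
  shows "zelt n l = diag (\<lambda>(i, d). if d = 2 * l then 1 else 0)"
proof (cases "l = 0")
  case True
  then show ?thesis
    unfolding zelt_def diag_def by (simp add: preproj_one) (rule theta_cong, simp split: prod.split)
next
  case False
  then show ?thesis
    unfolding zelt_def by simp (rule loop_pow_sum, auto)
qed

text \<open>In these coordinates z_1 is the loop of degree two with coefficient 1 at every vertex,
  and multiplying by it shifts the degree by two.\<close>

lemma diag_pow:
  "diag (\<lambda>(i, d). if d = 2 then 1 else 0) [^]\<^bsub>preproj n\<^esub> l = diag (\<lambda>(i, d). if d = 2 * l then 1 else 0)"
proof (induction l)
  case 0
  show ?case
    unfolding preproj_pow(1) preproj_one diag_def by (rule theta_cong) (simp split: prod.split)
next
  case (Suc l)
  have "diag (\<lambda>(i, d). if d = 2 then 1 else 0) =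
      theta n (\<lambda>(u, v, d). if u = v \<and> d = 2 then (\<lambda>_. 1) u else 0)"
    unfolding diag_def by (rule theta_cong) (simp split: prod.split)
  then have "diag (\<lambda>(i, d). if d = 2 then 1 else 0) [^]\<^bsub>preproj n\<^esub> Suc l =
      theta n (\<lambda>(u, w, d). if 2 \<le> d \<and> admissible n (u, u, 2) \<and> admissible n (u, w, d - 2)
        then (\<lambda>(u, v, d). if u = v then (\<lambda>(i, d). if d = 2 * l then 1 else 0) (u, d) else 0) (u, w, d - 2) * 1 else 0)"
    unfolding preproj_pow(2) Suc using theta_mult_diag[OF n2, of _ 2 "\<lambda>_. 1 :: 'f"] by (simp only: diag_def)
  also have "\<dots> = diag (\<lambda>(i, d). if d = 2 * Suc l then 1 else 0)"
    unfolding diag_def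
  proof (rule theta_cong)
    fix \<tau> assume adm: "admissible n \<tau>"
    obtain u w d where \<tau>: "\<tau> = (u, w, d)" by (cases \<tau>)
    have *: "2 \<le> d \<and> admissible n (u, u, 2) \<and> admissible n (u, w, d - 2)" if "w = u" "d = 2 * Suc l"
      using adm unfolding \<tau> that admissible_loop_iff by simp
    have d: "2 \<le> d \<and> d - 2 = 2 * l \<longleftrightarrow> d = 2 * Suc l"
      by auto
    show "(\<lambda>(u, w, d). if 2 \<le> d \<and> admissible n (u, u, 2) \<and> admissible n (u, w, d - 2)
        then (\<lambda>(u, v, d). if u = v then (\<lambda>(i, d). if d = 2 * l then 1 else 0) (u, d) else 0) (u, w, d - 2) * 1 else 0) \<tau> =
      (\<lambda>(u, v, d). if u = v then (\<lambda>(i, d). if d = 2 * Suc l then 1 else (0 :: 'f)) (u, d) else 0) \<tau>"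
      unfolding \<tau> prod.case mult_1_right
    proof (cases "w = u \<and> d = 2 * Suc l")
      case True
      with * show "(if 2 \<le> d \<and> admissible n (u, u, 2) \<and> admissible n (u, w, d - 2)
          then if u = w then if d - 2 = 2 * l then 1 else 0 else 0 else 0) =
        (if u = w then if d = 2 * Suc l then 1 else (0 :: 'f) else 0)"
        by simp
    next
      case False
      with d show "(if 2 \<le> d \<and> admissible n (u, u, 2) \<and> admissible n (u, w, d - 2)
          then if u = w then if d - 2 = 2 * l then 1 else 0 else 0 else 0) =
        (if u = w then if d = 2 * Suc l then 1 else (0 :: 'f) else 0)"
        by auto
    qed
  qed
  finally show ?case .
qed

lemma cochain_of_elt_diag: "cochain_of_elt n (diag y) = V.cochain y"
proof (rule extensionalityI)
  show "cochain_of_elt n (diag y) \<in> extensional (W n 0)"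
    unfolding cochain_of_elt_def by (rule restrict_extensional)
  show "V.cochain y \<in> extensional (W n 0)"
    unfolding V.cochain_def by (rule restrict_extensional)
  fix x :: "'f palg" assume x: "x \<in> W n 0"
  then obtain c where c: "x = vertex_comb n c"
    unfolding V.W_eq by (elim rangeE)
  have "cochain_of_elt n (diag y) x = proj n (vertex_comb n c) \<otimes>\<^bsub>preproj n\<^esub> diag y"
    using x by (simp add: cochain_of_elt_def c)
  also have "\<dots> = theta n (V.ev c y)"
    unfolding diag_def proj_vertex_comb[OF n2] theta_diag_mult[OF n2]
  proof (rule theta_cong)
    fix \<tau> assume adm: "admissible n \<tau>"
    obtain u w d where \<tau>: "\<tau> = (u, w, d)" by (cases \<tau>)
    have "u < n"
      using admissible_less[of n u w d] adm n2 by (simp add: \<tau>)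
    moreover have "V.ev c y (u, w, d) = (\<Sum>i<n. if i = u then (if w = u then c u * y (u, d) else 0) else 0)"
      unfolding V.ev_def prod.case by (rule sum.cong) auto
    ultimately have "V.ev c y (u, w, d) = (if w = u then c u * y (u, d) else 0)"
      by simp
    then show "(\<lambda>(u, w, d). if 0 \<le> d \<and> admissible n (w, w, 0) \<and> admissible n (u, w, d - 0)
        then c w * (\<lambda>(u, v, d). if u = v then y (u, d) else 0) (u, w, d - 0) else 0) \<tau> = V.ev c y \<tau>"
      using adm admissible_diag[of n u w d] by (simp add: \<tau>)
  qed
  also have "\<dots> = V.cochain y x"
    unfolding c by (rule V.cochain_G[symmetric])
  finally show "cochain_of_elt n (diag y) x = V.cochain y x" .
qed

lemma arrow_elt_eq:
  assumes "\<alpha> \<in> arcs (double_quiver n)"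
  shows "arrow_elt \<alpha> = arrow_comb n (\<lambda>\<beta>. if \<beta> = \<alpha> then 1 else 0 :: 'f)"
  by (rule ext) (use assms in \<open>auto simp: arrow_elt_def path_elt_def arrow_comb_def split: prod.split\<close>)

text \<open>Left multiplication by a_i keeps only the part of the power that ends at i. For l = 0 it
  thus cuts e_i out of the unit of the whole algebra, as the convention for the power
  requires.\<close>

lemma zeta_eq:
  "zeta n l = E.cochain (\<lambda>(\<alpha>, d). case \<alpha> of Up i \<Rightarrow> if d = 2 * l + 1 then 1 else 0 | Down i \<Rightarrow> 0)"
    (is "_ = E.cochain ?y")
proof -
  let ?z = "\<lambda>\<alpha>. (case \<alpha> of
      Up i \<Rightarrow> proj n (arrow_elt (Up i)) \<otimes>\<^bsub>preproj n\<^esub> (loop n i [^]\<^bsub>preproj n\<^esub> l)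
    | Down i \<Rightarrow> (\<zero>\<^bsub>preproj n\<^esub> :: 'f palg set))"
  have z: "?z \<alpha> = theta n (\<lambda>(u, v, d). if u = arrow_tail \<alpha> \<and> v = arrow_head \<alpha> then ?y (\<alpha>, d) else 0)"
    if \<alpha>: "\<alpha> \<in> arcs (double_quiver n)" for \<alpha>
  proof (cases \<alpha>)
    case (Up i)
    have i: "i < n - 1"
      using \<alpha> by (simp add: Up)
    have "?z \<alpha> = theta n (\<lambda>(u, w, d). if w = Suc i \<and> 1 \<le> d \<and> admissible n (i, Suc i, 1) \<and> admissible n (u, i, d - 1)
        then (\<lambda>(u, v, d). if u = v \<and> d = 2 * l \<and> (l = 0 \<or> u = i) then 1 else 0) (u, i, d - 1) else 0)"
      using theta_mono_mult[OF n2, of i "Suc i" 1, where ?'f = 'f] proj_arrow_elt[OF n2 \<alpha>, where ?'f = 'f] loop_pow[OF i, of l]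
      by (simp add: Up)
    also have "\<dots> = theta n (\<lambda>(u, v, d). if u = arrow_tail \<alpha> \<and> v = arrow_head \<alpha> then ?y (\<alpha>, d) else 0)"
    proof (rule theta_cong)
      fix \<tau> assume adm: "admissible n \<tau>"
      obtain u w d where \<tau>: "\<tau> = (u, w, d)" by (cases \<tau>)
      have *: "1 \<le> d \<and> admissible n (i, Suc i, 1) \<and> admissible n (u, i, d - 1)" if "u = i" "w = Suc i" "d = 2 * l + 1"
        using adm unfolding \<tau> that admissible_loop_iff admissible_edge_iff by simp
      have d: "1 \<le> d \<and> d - 1 = 2 * l \<longleftrightarrow> d = 2 * l + 1"
        by auto
      show "(\<lambda>(u, w, d). if w = Suc i \<and> 1 \<le> d \<and> admissible n (i, Suc i, 1) \<and> admissible n (u, i, d - 1)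
        then (\<lambda>(u, v, d). if u = v \<and> d = 2 * l \<and> (l = 0 \<or> u = i) then 1 else 0) (u, i, d - 1) else 0) \<tau> =
        (\<lambda>(u, v, d). if u = arrow_tail \<alpha> \<and> v = arrow_head \<alpha> then ?y (\<alpha>, d) else 0) \<tau>"
        unfolding \<tau> prod.case Up arrow.case arrow_tail.simps arrow_head.simps Suc_eq_plus1[symmetric]
      proof (cases "u = i \<and> w = Suc i \<and> d = 2 * l + 1")
        case True
        with * show "(if w = Suc i \<and> 1 \<le> d \<and> admissible n (i, Suc i, 1) \<and> admissible n (u, i, d - 1)
            then if u = i \<and> d - 1 = 2 * l \<and> (l = 0 \<or> u = i) then 1 else 0 else 0) =
          (if u = i \<and> w = Suc i then if d = Suc (2 * l) then 1 else (0 :: 'f) else 0)"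
          by simp
      next
        case False
        with d show "(if w = Suc i \<and> 1 \<le> d \<and> admissible n (i, Suc i, 1) \<and> admissible n (u, i, d - 1)
            then if u = i \<and> d - 1 = 2 * l \<and> (l = 0 \<or> u = i) then 1 else 0 else 0) =
          (if u = i \<and> w = Suc i then if d = Suc (2 * l) then 1 else (0 :: 'f) else 0)"
          by auto
      qed
    qed
    finally show ?thesis .
  next
    case (Down i)
    show ?thesis
      unfolding Down arrow.case V.A.zero_eq by (rule theta_cong) (simp split: prod.split)
  qed
  \<comment> \<open>The two prescribed families of values, on a_i and on a_i^*, are merged into one
    family on all arrows, the form that \<open>cochain_the\<close> expects.\<close>
  have iff: "(\<forall>i<n - 1. f (arrow_elt (Up i)) = proj n (arrow_elt (Up i)) \<otimes>\<^bsub>preproj n\<^esub> (loop n i [^]\<^bsub>preproj n\<^esub> l) \<and>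
      f (arrow_elt (Down i)) = \<zero>\<^bsub>preproj n\<^esub>) \<longleftrightarrow>
    (\<forall>\<alpha>\<in>arcs (double_quiver n). f (arrow_comb n (\<lambda>\<beta>. if \<beta> = \<alpha> then 1 else 0)) = ?z \<alpha>)" for f :: "'f cochain"
  proof -
    have "(\<forall>\<alpha>\<in>arcs (double_quiver n). f (arrow_comb n (\<lambda>\<beta>. if \<beta> = \<alpha> then 1 else 0)) = ?z \<alpha>) \<longleftrightarrow>
        (\<forall>\<alpha>\<in>arcs (double_quiver n). f (arrow_elt \<alpha>) = ?z \<alpha>)"
      by (rule ball_cong[OF refl]) (simp only: arrow_elt_eq)
    also have "\<dots> \<longleftrightarrow> (\<forall>i<n - 1. f (arrow_elt (Up i)) = ?z (Up i)) \<and> (\<forall>i<n - 1. f (arrow_elt (Down i)) = ?z (Down i))"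
      unfolding double_quiver_def by (simp add: ball_Un) (simp only: Ball_def lessThan_iff)
    finally show ?thesis
      by (simp add: all_conj_distrib imp_conjR)
  qed
  show ?thesis
    unfolding zeta_def iff by (rule E.cochain_the) (rule z)
qed

lemma hcochain_eq:
  assumes i: "i < n"
  shows "hcochain n i = R.cochain (\<lambda>(j, d). if j = i \<and> d = 0 then 1 else 0)"
    (is "_ = R.cochain ?y")
proof -
  let ?z = "\<lambda>j. if i = j then proj n (vert_elt i) else \<zero>\<^bsub>preproj n\<^esub> :: 'f palg set"
  have z: "?z j = theta n (\<lambda>(u, v, d). if u = j \<and> v = j then ?y (j, d) else 0)" if "j \<in> {..<n}" for j
  proof (cases "i = j")
    case True
    have "proj n (vert_elt i) = (theta n (\<lambda>\<tau>. if \<tau> = (i, i, 0) then 1 else 0) :: 'f palg set)"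
      using proj_path_elt[OF n2, of "[]" i i, where ?'f = 'f] i by (simp add: vert_elt_def)
    also have "\<dots> = theta n (\<lambda>(u, v, d). if u = j \<and> v = j then ?y (j, d) else 0)"
      by (rule theta_cong) (simp add: True split: prod.split)
    finally show ?thesis
      by (simp add: True)
  next
    case False
    then have "theta n (\<lambda>(u, v, d). if u = j \<and> v = j then ?y (j, d) else 0) = theta n (\<lambda>_. 0)"
      by (intro theta_cong) (simp split: prod.split)
    with False show ?thesis
      by (simp add: V.A.zero_eq)
  qed
  have sigma: "sigma n j = relation_comb n (\<lambda>k. if k = j then 1 else 0 :: 'f)" if "j < n" for j
    unfolding sigma_eq[OF n2 that]
  proof (rule ext, clarify)
    fix w es
    show "(if j = 0 then 0 else path_elt (j, [Down (j - 1), Up (j - 1)]) (w, es))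
       - (if j = n - 1 then 0 else path_elt (j, [Up j, Down j]) (w, es)) =
      relation_comb n (\<lambda>k. if k = j then 1 else 0 :: 'f) (w, es)"
      using that by (cases "w = j") (simp_all add: path_elt_def relation_comb_def, linarith?)
  qed
  have "(\<forall>j<n. f (sigma n j) = ?z j) \<longleftrightarrow>
      (\<forall>j\<in>{..<n}. f (relation_comb n (\<lambda>k. if k = j then 1 else 0)) = ?z j)" for f :: "'f cochain"
  proof -
    have "(\<forall>j<n. f (sigma n j) = ?z j) \<longleftrightarrow> (\<forall>j\<in>{..<n}. f (sigma n j) = ?z j)"
      by (simp only: Ball_def lessThan_iff)
    also have "\<dots> \<longleftrightarrow> (\<forall>j\<in>{..<n}. f (relation_comb n (\<lambda>k. if k = j then 1 else 0)) = ?z j)"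
      by (rule ball_cong[OF refl]) (simp only: sigma lessThan_iff)
    finally show ?thesis .
  qed
  then show ?thesis
    unfolding hcochain_def by (simp only:) (rule R.cochain_the, rule z)
qed

end

theorem proposition6p1:
  fixes n m :: nat
  assumes "n \<ge> 3" and "m = (n - 1) div 2"
  shows "basis_family (centre n :: ('f::field, 'f palg set) module) (zelt n) {0..m}
    \<and> basis_family (HK n 0 :: ('f, 'f cochain set) module)
        (\<lambda>l. HK_class n 0 (cochain_of_elt n (zelt n l))) {0..m}
    \<and> zelt n 0 = \<one>\<^bsub>(preproj n :: ('f, 'f palg set) module)\<^esub>
    \<and> (\<forall>l \<in> {1..m}.
         (zelt n l :: 'f palg set) = (\<Oplus>\<^bsub>preproj n\<^esub>i\<in>{1..n - 2}. loop n i [^]\<^bsub>preproj n\<^esub> l) \<and>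
         (zelt n l :: 'f palg set) = (\<Oplus>\<^bsub>preproj n\<^esub>i\<in>{l..n - 1 - l}. loop n i [^]\<^bsub>preproj n\<^esub> l) \<and>
         (zelt n l :: 'f palg set) = zelt n 1 [^]\<^bsub>preproj n\<^esub> l)
    \<and> basis_family (HK n 1 :: ('f, 'f cochain set) module)
        (\<lambda>l. HK_class n 1 (zeta n l)) {0..n - 2 - m}
    \<and> basis_family (HK n 2 :: ('f, 'f cochain set) module)
        (\<lambda>i. HK_class n 2 (hcochain n i)) {0..n - 1}"
proof -
  interpret preprojective_A n "TYPE('f)"
    by unfold_locales (rule assms(1))
  note m = assms(2)
  have z: "zelt n l = diag (\<lambda>(i, d). if d = 2 * l then 1 else 0)" if "l \<in> {0..m}" for l
    using zelt_eq[OF m, of l] that by simp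
  \<comment> \<open>n >= 3 gives m >= 1, so that z_1 is in the range where its coordinates are
    known.\<close>
  have one: "1 \<in> {0..m}"
    using assms by simp
  show ?thesis
  proof (intro conjI ballI)
    show "basis_family (centre n :: ('f, 'f palg set) module) (zelt n) {0..m}"
      by (rule centre_basis[OF m z])
    show "basis_family (HK n 0 :: ('f, 'f cochain set) module)
        (\<lambda>l. HK_class n 0 (cochain_of_elt n (zelt n l))) {0..m}"
      by (rule HK_0_basis[OF m]) (simp only: z cochain_of_elt_diag)
    show "zelt n 0 = \<one>\<^bsub>(preproj n :: ('f, 'f palg set) module)\<^esub>"
      by (simp add: zelt_def)
    show "basis_family (HK n 1 :: ('f, 'f cochain set) module) (\<lambda>l. HK_class n 1 (zeta n l)) {0..n - 2 - m}"
      by (rule HK_1_basis[OF m]) (rule zeta_eq)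
    show "basis_family (HK n 2 :: ('f, 'f cochain set) module) (\<lambda>i. HK_class n 2 (hcochain n i)) {0..n - 1}"
      by (rule HK_2_basis) (rule hcochain_eq, use assms(1) in auto)
  next
    fix l assume l: "l \<in> {1..m}"
    then have l': "l \<in> {0..m}" by simp
    show "(zelt n l :: 'f palg set) = (\<Oplus>\<^bsub>preproj n\<^esub>i\<in>{1..n - 2}. loop n i [^]\<^bsub>preproj n\<^esub> l)"
      using l by (simp add: zelt_def)
    show "(zelt n l :: 'f palg set) = (\<Oplus>\<^bsub>preproj n\<^esub>i\<in>{l..n - 1 - l}. loop n i [^]\<^bsub>preproj n\<^esub> l)"
      \<comment> \<open>l >= 1 keeps n - 1 - l below n - 1, so each index i has an arrow
        a_i.\<close>
      unfolding z[OF l'] by (rule loop_pow_sum[symmetric]) (use l assms in auto)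
    show "(zelt n l :: 'f palg set) = zelt n 1 [^]\<^bsub>preproj n\<^esub> l"
      unfolding z[OF l'] z[OF one] using diag_pow[of l] by simp
  qed
qed

end
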